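(* Let $\Delta$ be a simplicial complex on $[n]$ with $\dim\Delta\le n-3$, let $F_1,\dots,F_q$ be a shelling of $\Delta$, and let $U_{\bar\sigma}$ be a subspace in $L_\Delta$ for some subset $\bar\sigma\subseteq[n]$. Then the order complex $\Delta(\hat0,U_{\bar\sigma})$ of the open interval $(\hat 0,U_{\bar\sigma})$ in $L_\Delta$ is homotopy equivalent to a wedge of spheres consisting of $(p-1)!$ copies of spheres of dimension $$\delta(D):=p(2-n)+\sum_{j=1}^p|F_{i_j}|+|\bar\sigma|-3$$ for each shelling-trapped decomposition $D=\{(\bar\sigma_1,F_{i_1}),\dots,(\bar\sigma_p,F_{i_p})\}$ of $\bar\sigma$. Moreover, for each such $D$ and each permutation $w$ of $[p-1]$ there is a saturated chain $C_{D,w}$ from $\hat0$ to $U_{\bar\sigma}$ in $L_\Delta$ (whose elements other than $\hat 0$ and $U_{\bar\sigma}$ form a $\delta(D)$-dimensional simplex of $\Delta(\hat0,U_{\bar\sigma})$) such that removing these simplices for all pairs $(D,w)$ from $\Delta(\hat0,U_{\bar\sigma})$ leaves a contractible simplicial complex.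
   Context: For $S\subseteq[n]$, $U_S$ is the diagonal subspace $\{u\in\mathbb{R}^n: u_i=u_j\ \forall i,j\in S\}$; $\mathcal{A}_\Delta=\{U_{[n]-F}: F\text{ facet of }\Delta\}$; $L_\Delta$ is the set of all intersections of members of $\mathcal{A}_\Delta$ (bottom $\hat0=\mathbb{R}^n$) ordered by reverse inclusion. A shelling is an ordering $F_1,\dots,F_q$ of all facets such that for each $k\ge2$, $(\bigcup_{i<k}2^{F_i})\cap2^{F_k}$ is pure of dimension $\dim F_k-1$. A wall of $F_i$ is a codimension-one face of $F_i$. Set $G_1=F_1$ and, for $i\ge2$, let $G_i$ be the intersection of all walls of $F_i$ that lie in the subcomplex generated by $F_1,\dots,F_{i-1}$. For a subset $\tau\subseteq[n]$ write $\bar\tau=[n]-\tau$. A (unordered) shelling-trapped decomposition of $\bar\sigma$ is a family $\{(\bar\sigma_1,F_{i_1}),\dots,(\bar\sigma_p,F_{i_p})\}$ with $\bar\sigma=\bigsqcup_{j=1}^p\bar\sigma_j$ a disjoint union and $F_{i_1},\dots,F_{i_p}$ facets of $\Delta$ with $G_{i_j}\subseteq\sigma_j\subseteq F_{i_j}$ for all $j$, where $\sigma_j=[n]-\bar\sigma_j$. *)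

theory Defs
  imports "HOL-Analysis.Analysis"
begin

text \<open>An (abstract) simplicial complex: a family of finite sets closed under taking subsets
  (the empty face is allowed, the void complex is the empty family).\<close>
definition simplicial_complex :: "'v set set \<Rightarrow> bool" where
  "simplicial_complex K \<longleftrightarrow> (\<forall>s\<in>K. finite s) \<and> (\<forall>s\<in>K. \<forall>t. t \<subseteq> s \<longrightarrow> t \<in> K)"

definition facets :: "'v set set \<Rightarrow> 'v set set" where
  "facets K = {F\<in>K. \<forall>G\<in>K. F \<subseteq> G \<longrightarrow> G = F}"

text \<open>Geometric realization: functions (barycentric coordinates) whose support is a face,
  with nonnegative values summing to 1, with the topology induced from the product topology.\<close>
definition geom_realization :: "'v set set \<Rightarrow> ('v \<Rightarrow> real) topology" where
  "geom_realization K = subtopology euclidean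
     {f. (\<forall>v. 0 \<le> f v) \<and> {v. f v \<noteq> 0} \<in> K \<and> sum f {v. f v \<noteq> 0} = 1}"

text \<open>The k-th sphere of dimension d (d \<ge> -1; dimension -1 gives the empty set), embedded in
  coordinates (k,0..d), centred at the unit vector e_(k,0) and of radius 1, so that all these
  spheres pass through the origin and meet pairwise only there.\<close>
definition wedge_sphere :: "nat \<Rightarrow> int \<Rightarrow> (nat \<times> nat \<Rightarrow> real) set" where
  "wedge_sphere k d = {x. (\<forall>a i. (a \<noteq> k \<or> int i > d) \<longrightarrow> x (a, i) = 0) \<and>
      (\<Sum>i\<in>{i. int i \<le> d}. (x (k, i) - (if i = 0 then 1 else 0))^2) = 1 \<and> 0 \<le> d}"

text \<open>Wedge of spheres of the dimensions listed in ds, glued at the origin; the wedge of no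
  spheres is a point.\<close>
definition wedge_of_spheres :: "int list \<Rightarrow> (nat \<times> nat \<Rightarrow> real) topology" where
  "wedge_of_spheres ds = subtopology euclidean
     ((if ds = [] then {\<lambda>_. 0} else {}) \<union> (\<Union>k<length ds. wedge_sphere k (ds ! k)))"

text \<open>[n] is the finite type 'n, n = CARD('n), R^n = real^'n.\<close>
definition diag_subspace :: "'n set \<Rightarrow> (real^'n) set" where
  "diag_subspace S = {u. \<forall>i\<in>S. \<forall>j\<in>S. u $ i = u $ j}"

definition arrangement :: "'n set set \<Rightarrow> (real^'n) set set" where
  "arrangement \<Delta> = {diag_subspace (UNIV - F) | F. F \<in> facets \<Delta>}"

text \<open>Intersection lattice L_\<Delta> (ordered by reverse inclusion); the empty intersection is R^n.\<close>
definition intersection_lattice :: "'n set set \<Rightarrow> (real^'n) set set" where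
  "intersection_lattice \<Delta> = {\<Inter>S | S. S \<subseteq> arrangement \<Delta>}"

text \<open>Vertices of the open interval (0,U) of L_\<Delta> (0 = R^n, reverse inclusion).\<close>
definition open_interval :: "'n set set \<Rightarrow> (real^'n) set \<Rightarrow> (real^'n) set set" where
  "open_interval \<Delta> U = {X \<in> intersection_lattice \<Delta>. U \<subset> X \<and> X \<subset> UNIV}"

definition order_complex_interval :: "'n set set \<Rightarrow> (real^'n) set \<Rightarrow> (real^'n) set set set" where
  "order_complex_interval \<Delta> U = {c. c \<subseteq> open_interval \<Delta> U \<and> finite c \<and>
      (\<forall>X\<in>c. \<forall>Y\<in>c. X \<subseteq> Y \<or> Y \<subseteq> X)}"

definition saturated_chain :: "'n set set \<Rightarrow> (real^'n) set \<Rightarrow> (real^'n) set set \<Rightarrow> bool" where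
  "saturated_chain \<Delta> U C \<longleftrightarrow> C \<subseteq> intersection_lattice \<Delta> \<and> UNIV \<in> C \<and> U \<in> C \<and>
     (\<forall>X\<in>C. U \<subseteq> X) \<and> (\<forall>X\<in>C. \<forall>Y\<in>C. X \<subseteq> Y \<or> Y \<subseteq> X) \<and>
     (\<forall>X\<in>intersection_lattice \<Delta>. U \<subseteq> X \<and> (\<forall>Y\<in>C. X \<subseteq> Y \<or> Y \<subseteq> X) \<longrightarrow> X \<in> C)"

definition pure_of_dim :: "'v set set \<Rightarrow> int \<Rightarrow> bool" where
  "pure_of_dim K d \<longleftrightarrow> (\<forall>F\<in>facets K. int (card F) = d + 1)"

text \<open>A shelling: a list F_1,...,F_q (here 0-indexed) of all facets, without repetitions, such that
  for k \<ge> 2 the intersection of the complex generated by earlier facets with 2^F_k is pure of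
  dimension dim F_k - 1.\<close>
definition shelling :: "'v set set \<Rightarrow> 'v set list \<Rightarrow> bool" where
  "shelling \<Delta> Fs \<longleftrightarrow> distinct Fs \<and> set Fs = facets \<Delta> \<and>
     (\<forall>k. 0 < k \<and> k < length Fs \<longrightarrow>
        pure_of_dim {t. t \<subseteq> Fs ! k \<and> (\<exists>i<k. t \<subseteq> Fs ! i)} (int (card (Fs ! k)) - 2))"

definition old_walls :: "'v set list \<Rightarrow> nat \<Rightarrow> 'v set set" where
  "old_walls Fs i = {Fs ! i - {v} | v. v \<in> Fs ! i \<and> (\<exists>j<i. Fs ! i - {v} \<subseteq> Fs ! j)}"

definition shelling_G :: "'v set list \<Rightarrow> nat \<Rightarrow> 'v set" where
  "shelling_G Fs i = (if i = 0 then Fs ! 0 else Fs ! i \<inter> \<Inter>(old_walls Fs i))"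

definition shelling_trapped_decomp ::
  "'n set list \<Rightarrow> 'n set \<Rightarrow> ('n set \<times> 'n set) set \<Rightarrow> bool" where
  "shelling_trapped_decomp Fs \<sigma>bar D \<longleftrightarrow> finite D \<and>
     \<Union>(fst ` D) = \<sigma>bar \<and>
     (\<forall>a\<in>D. \<forall>b\<in>D. a \<noteq> b \<longrightarrow> fst a \<inter> fst b = {}) \<and>
     (\<forall>(\<tau>bar, F)\<in>D. \<exists>i<length Fs. Fs ! i = F \<and>
         shelling_G Fs i \<subseteq> UNIV - \<tau>bar \<and> UNIV - \<tau>bar \<subseteq> F)"

definition decomp_dim :: "('n::finite set \<times> 'n set) set \<Rightarrow> 'n set \<Rightarrow> int" where
  "decomp_dim D \<sigma>bar = int (card D) * (2 - int CARD('n)) + (\<Sum>d\<in>D. int (card (snd d)))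
      + int (card \<sigma>bar) - 3"

end

theory Submission
  imports Defs
begin

text \<open>
  Let \<open>E\<^sub>i\<close> be the complement of \<open>F\<^sub>i\<close>. In a shelled complex any two of these sets are connected
  through others inside their union, so \<open>L\<^sub>\<Delta>\<close> is the poset of disjoint families of unions of
  \<open>E\<^sub>i\<close>'s under refinement. Replacing unions of \<open>E\<^sub>i\<close>'s by arbitrary supersets of some \<open>E\<^sub>i\<close> enlarges
  an interval to one that collapses back onto it.

  In the enlarged interval below \<open>{B}\<close>, start with the families whose union is not \<open>B\<close>
  and add the families \<open>P\<close> with \<open>\<Union>P = B\<close> one at a time. The link of \<open>P\<close> is a join: its upper part
  is a partition lattice, from which \<open>(p-1)!\<close> maximal chains can be removed so that the
  rest collapses; its lower part reduces to the subsets of \<open>B\<close> that meet each block of \<open>P\<close> in the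
  empty set or in a superset of some \<open>E\<^sub>i\<close>, where the shelling allows removing one maximal
  chain for every choice of a facet trapping each block. Every chain removed in this way already
  consists of families of unions of \<open>E\<^sub>i\<close>'s.

  What remains collapses to nothing, hence is contractible, and a complex obtained
  from a contractible one by attaching simplices along their boundaries is a wedge of spheres.
\<close>

section \<open>Collapses of simplicial complexes\<close>

lemma
  assumes "simplicial_complex K" "s \<in> K"
  shows simplicial_complex_finite: "finite s"
    and simplicial_complex_subset: "t \<subseteq> s \<Longrightarrow> t \<in> K"
    and simplicial_complex_empty: "{} \<in> K"
  using assms unfolding simplicial_complex_def by auto

lemma simplicial_complex_diff_upset:
  assumes "simplicial_complex K" "\<And>s t. t \<in> S \<Longrightarrow> s \<in> K \<Longrightarrow> t \<subseteq> s \<Longrightarrow> s \<in> S"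
  shows "simplicial_complex (K - S)"
  using assms unfolding simplicial_complex_def by (meson DiffD1 DiffD2 DiffI)

lemma simplicial_complex_diff_facets:
  assumes "simplicial_complex K" "S \<subseteq> facets K"
  shows "simplicial_complex (K - S)"
proof (rule simplicial_complex_diff_upset[OF assms(1)])
  fix s t assume "t \<in> S" "s \<in> K" "t \<subseteq> s"
  then have "s = t" using assms(2) unfolding facets_def by auto
  then show "s \<in> S" using \<open>t \<in> S\<close> by simp
qed

definition free_face :: "'v set set \<Rightarrow> 'v set \<Rightarrow> 'v \<Rightarrow> bool" where
  "free_face K t v \<longleftrightarrow> t \<in> K \<and> v \<notin> t \<and> insert v t \<in> K \<and> (\<forall>s\<in>K. t \<subseteq> s \<longrightarrow> s = t \<or> s = insert v t)"

lemma
  assumes "free_face K t v"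
  shows free_face_mem: "t \<in> K" "insert v t \<in> K"
    and free_face_notin: "v \<notin> t"
    and free_face_cases: "s \<in> K \<Longrightarrow> t \<subseteq> s \<Longrightarrow> s = t \<or> s = insert v t"
  using assms unfolding free_face_def by auto

lemma simplicial_complex_remove_free_face:
  assumes "simplicial_complex K" "free_face K t v"
  shows "simplicial_complex (K - {t, insert v t})"
proof (rule simplicial_complex_diff_upset[OF assms(1)])
  fix s r assume "r \<in> {t, insert v t}" "s \<in> K" "r \<subseteq> s"
  then show "s \<in> {t, insert v t}" using free_face_cases[OF assms(2), of s] by auto
qed

inductive collapses :: "'v set set \<Rightarrow> 'v set set \<Rightarrow> bool" where
  refl: "collapses K K"
| step: "free_face K t v \<Longrightarrow> collapses (K - {t, insert v t}) L \<Longrightarrow> collapses K L"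

text \<open>The last collapse to the void complex removes a vertex together with the empty face.\<close>
abbreviation collapsible :: "'v set set \<Rightarrow> bool" where
  "collapsible K \<equiv> collapses K {}"

lemma collapses_trans: "collapses K L \<Longrightarrow> collapses L M \<Longrightarrow> collapses K M"
proof (induction rule: collapses.induct)
  case (step K t v L)
  show ?case by (rule collapses.step[OF step.hyps(1) step.IH[OF step.prems]])
qed

lemma collapses_subset: "collapses K L \<Longrightarrow> L \<subseteq> K"
  by (induction rule: collapses.induct) auto

lemma cone_free_face:
  assumes K: "finite K" "simplicial_complex K" "K \<noteq> {}" and cone: "\<forall>s\<in>K. insert a s \<in> K"
  shows "\<exists>t. free_face K t a"
proof -
  let ?A = "{s\<in>K. a \<notin> s}"
  have "{} \<in> ?A" using K(2,3) simplicial_complex_empty by blast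
  then obtain t where t: "t \<in> ?A" and max: "\<forall>s\<in>?A. t \<subseteq> s \<longrightarrow> t = s"
    using finite_has_maximal[of ?A] K(1) by auto
  have "s = t \<or> s = insert a t" if s: "s \<in> K" "t \<subseteq> s" for s
  proof -
    have "s - {a} \<in> ?A" using simplicial_complex_subset[OF K(2) s(1)] by auto
    then have "t = s - {a}" using max s(2) t by auto
    then show ?thesis by auto
  qed
  then have "free_face K t a" using t cone unfolding free_face_def by auto
  then show ?thesis by blast
qed

lemma collapsible_cone:
  assumes "finite K" "simplicial_complex K" "\<forall>s\<in>K. insert a s \<in> K"
  shows "collapsible K"
  using assms
proof (induction "card K" arbitrary: K rule: less_induct)
  case less
  show ?case
  proof (cases "K = {}")
    case True
    then show ?thesis by (simp add: collapses.refl)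
  next
    case False
    then obtain t where t: "free_face K t a" using cone_free_face[OF less.prems(1,2) _ less.prems(3)] by blast
    let ?K' = "K - {t, insert a t}"
    have "collapsible ?K'"
    proof (rule less.hyps)
      show "card ?K' < card K"
        using free_face_mem(1)[OF t] less.prems(1) by (intro psubset_card_mono) auto
      show "finite ?K'" using less.prems(1) by auto
      show "simplicial_complex ?K'" by (rule simplicial_complex_remove_free_face[OF less.prems(2) t])
      show "\<forall>s\<in>?K'. insert a s \<in> ?K'"
      proof
        fix s assume s: "s \<in> ?K'"
        have "insert a s \<noteq> insert a t"
        proof
          assume "insert a s = insert a t"
          then have "insert a s - {a} = insert a t - {a}" by simp
          then have "s - {a} = t" using free_face_notin[OF t] by simp
          then show False using s by auto
        qed
        moreover have "insert a s \<noteq> t" using free_face_notin[OF t] by auto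
        ultimately show "insert a s \<in> ?K'" using s less.prems(3) by auto
      qed
    qed
    then show ?thesis by (rule collapses.step[OF t])
  qed
qed

lemma free_face_star:
  assumes t: "free_face N t v" and dis: "\<forall>m\<in>N. m \<inter> s = {}" and A: "\<forall>r\<in>A. \<not> s \<subseteq> r"
  shows "free_face (A \<union> (\<union>) s ` N) (s \<union> t) v"
    and "(A \<union> (\<union>) s ` N) - {s \<union> t, insert v (s \<union> t)} = A \<union> (\<union>) s ` (N - {t, insert v t})"
proof -
  note free_N = free_face_mem[OF t]
  have "r = s \<union> t \<or> r = insert v (s \<union> t)" if r: "r \<in> A \<union> (\<union>) s ` N" "s \<union> t \<subseteq> r" for r
  proof -
    obtain m where m: "m \<in> N" "r = s \<union> m" using A r by auto
    then have "t \<subseteq> m" using r(2) bspec[OF dis free_N(1)] by auto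
    then show ?thesis using free_face_cases[OF t m(1)] m(2) by auto
  qed
  moreover have "s \<union> t \<in> (\<union>) s ` N" "insert v (s \<union> t) \<in> (\<union>) s ` N"
    using imageI[OF free_N(1), of "(\<union>) s"] imageI[OF free_N(2), of "(\<union>) s"] by simp_all
  moreover have "v \<notin> s \<union> t" using free_face_notin[OF t] bspec[OF dis free_N(2)] by auto
  ultimately show "free_face (A \<union> (\<union>) s ` N) (s \<union> t) v" unfolding free_face_def by blast
  have "inj_on ((\<union>) s) N" by (rule inj_on_inverseI[of _ "\<lambda>r. r - s"]) (use dis in blast)
  then have "(\<union>) s ` (N - {t, insert v t}) = (\<union>) s ` N - (\<union>) s ` {t, insert v t}"
    using free_N by (intro inj_on_image_set_diff) auto
  moreover have "A \<inter> {s \<union> t, insert v (s \<union> t)} = {}" using A by auto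
  ultimately show "(A \<union> (\<union>) s ` N) - {s \<union> t, insert v (s \<union> t)} = A \<union> (\<union>) s ` (N - {t, insert v t})"
    by auto
qed

text \<open>\<open>N\<close> is the link of \<open>s\<close> in the larger complex.\<close>
lemma collapses_star:
  assumes "collapses N M" "\<forall>m\<in>N. m \<inter> s = {}" "\<forall>r\<in>A. \<not> s \<subseteq> r"
  shows "collapses (A \<union> (\<union>) s ` N) (A \<union> (\<union>) s ` M)"
  using assms
proof (induction rule: collapses.induct)
  case (step N t v M)
  note free = free_face_star[OF step.hyps(1) step.prems]
  have "collapses (A \<union> (\<union>) s ` (N - {t, insert v t})) (A \<union> (\<union>) s ` M)"
    using step.prems by (intro step.IH) auto
  then show ?case using collapses.step[OF free(1)] unfolding free(2) by blast
qed (rule collapses.refl)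

lemma collapses_star_collapsible:
  assumes "collapsible N" "\<forall>m\<in>N. m \<inter> s = {}" "\<forall>r\<in>A. \<not> s \<subseteq> r"
  shows "collapses (A \<union> (\<union>) s ` N) A"
  using collapses_star[OF assms] by simp

lemma free_face_image:
  assumes t: "free_face K t v" and inj: "inj_on f (\<Union>K)"
  shows "free_face ((`) f ` K) (f ` t) (f v)"
    and "(`) f ` (K - {t, insert v t}) = (`) f ` K - {f ` t, insert (f v) (f ` t)}"
proof -
  note free_K = free_face_mem[OF t]
  have vertices: "v \<in> \<Union>K" "t \<subseteq> \<Union>K" using free_K by auto
  have "s = f ` t \<or> s = insert (f v) (f ` t)" if s: "s \<in> (`) f ` K" "f ` t \<subseteq> s" for s
  proof -
    obtain r where r: "r \<in> K" "s = f ` r" using s(1) by auto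
    then have "t \<subseteq> r"
      using s(2) inj_on_image_subset_iff[OF inj vertices(2) Sup_upper[OF r(1)]] by simp
    then show ?thesis using free_face_cases[OF t r(1)] r(2) by auto
  qed
  moreover have "f v \<notin> f ` t"
    using inj vertices free_face_notin[OF t] by (simp add: inj_on_image_mem_iff)
  moreover have "f ` t \<in> (`) f ` K" "insert (f v) (f ` t) \<in> (`) f ` K"
    using imageI[OF free_K(1), of "(`) f"] imageI[OF free_K(2), of "(`) f"] by auto
  ultimately show "free_face ((`) f ` K) (f ` t) (f v)" unfolding free_face_def by (intro conjI ballI impI)
  have "inj_on ((`) f) K"
    by (rule inj_on_subset[OF inj_on_image_Pow[OF inj]]) auto
  then have "(`) f ` (K - {t, insert v t}) = (`) f ` K - (`) f ` {t, insert v t}"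
    using free_K by (intro inj_on_image_set_diff) auto
  then show "(`) f ` (K - {t, insert v t}) = (`) f ` K - {f ` t, insert (f v) (f ` t)}" by simp
qed

lemma collapses_image:
  assumes "collapses K L" "inj_on f (\<Union>K)"
  shows "collapses ((`) f ` K) ((`) f ` L)"
  using assms
proof (induction rule: collapses.induct)
  case (step K t v L)
  note free = free_face_image[OF step.hyps(1) step.prems]
  have "collapses ((`) f ` (K - {t, insert v t})) ((`) f ` L)"
    by (rule step.IH, rule inj_on_subset[OF step.prems]) auto
  then show ?case using collapses.step[OF free(1)] unfolding free(2) by blast
qed (rule collapses.refl)

subsection \<open>Joins\<close>

definition complex_join :: "'v set set \<Rightarrow> 'v set set \<Rightarrow> 'v set set" where
  "complex_join K L = {k \<union> l | k l. k \<in> K \<and> l \<in> L}"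

lemma complex_join_empty [simp]: "complex_join {} L = {}"
  unfolding complex_join_def by simp

lemma complex_join_insert: "complex_join (insert s K) L = (\<union>) s ` L \<union> complex_join K L"
  unfolding complex_join_def by auto

lemma complex_join_unique:
  assumes "\<Union>K \<inter> \<Union>L = {}" "k \<in> K" "k' \<in> K" "l \<in> L" "l' \<in> L" "k \<union> l = k' \<union> l'"
  shows "k = k'" "l = l'"
proof -
  have "k \<inter> l = {}" "k' \<inter> l' = {}" "k \<inter> l' = {}" "k' \<inter> l = {}"
    using assms(1-5) by blast+
  then show "k = k'" "l = l'" using assms(6) by blast+
qed

lemma complex_join_diff:
  assumes dis: "\<Union>K \<inter> \<Union>L = {}" and S: "S \<subseteq> K" and R: "R \<subseteq> L"
  shows "complex_join K L - complex_join S R = complex_join (K - S) L \<union> complex_join S (L - R)"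
proof -
  have "k \<union> l \<in> complex_join S R \<longleftrightarrow> k \<in> S \<and> l \<in> R" if kl: "k \<in> K" "l \<in> L" for k l
  proof
    assume "k \<union> l \<in> complex_join S R"
    then obtain k' l' where kl': "k' \<in> S" "l' \<in> R" "k \<union> l = k' \<union> l'"
      unfolding complex_join_def by auto
    then show "k \<in> S \<and> l \<in> R"
      using complex_join_unique[OF dis kl(1) subsetD[OF S kl'(1)] kl(2) subsetD[OF R kl'(2)] kl'(3)] by simp
  qed (auto simp: complex_join_def)
  then have "complex_join K L - complex_join S R = {k \<union> l | k l. k \<in> K \<and> l \<in> L \<and> \<not> (k \<in> S \<and> l \<in> R)}"
    unfolding complex_join_def[of K L] by auto
  also have "\<dots> = complex_join (K - S) L \<union> complex_join S (L - R)"
    using S R unfolding complex_join_def by blast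
  finally show ?thesis .
qed

lemma simplicial_complex_cone:
  assumes "simplicial_complex L"
  shows "simplicial_complex (L \<union> insert v ` L)"
  unfolding simplicial_complex_def
proof (intro conjI ballI allI impI)
  fix s assume "s \<in> L \<union> insert v ` L"
  then obtain l where l: "l \<in> L" "s \<subseteq> insert v l" by auto
  then show "finite s" using simplicial_complex_finite[OF assms l(1)] finite_subset by blast
  fix t assume "t \<subseteq> s"
  then have "t - {v} \<in> L" using l by (intro simplicial_complex_subset[OF assms l(1)]) auto
  then show "t \<in> L \<union> insert v ` L"
    by (cases "v \<in> t") (auto simp: image_iff intro!: bexI[of _ "t - {v}"])
qed

text \<open>Removing the free pair \<open>t\<close>, \<open>t \<union> {v}\<close> from \<open>K\<close> removes from the join with \<open>L\<close> the faces
  \<open>t \<union> m\<close>, where \<open>m\<close> runs through the cone with apex \<open>v\<close> over \<open>L\<close>.\<close>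
lemma collapsible_complex_join:
  assumes "collapsible K" "simplicial_complex L" "finite L" "\<Union>K \<inter> \<Union>L = {}"
  shows "collapsible (complex_join K L)"
  using assms
proof (induction K "{} :: 'a set set" rule: collapses.induct)
  case refl
  then show ?case by (simp add: collapses.refl)
next
  case (step K t v)
  let ?K' = "K - {t, insert v t}" and ?N = "L \<union> insert v ` L"
  note free_K = free_face_mem[OF step.hyps(1)]
  have disjoint_L: "t \<inter> l = {}" "v \<notin> l" if "l \<in> L" for l
    using step.prems(3) free_K that by blast+
  have "K = insert t (insert (insert v t) ?K')" using free_K by auto
  then have "complex_join K L = complex_join (insert t (insert (insert v t) ?K')) L" by simp
  also have "\<dots> = complex_join ?K' L \<union> (\<union>) t ` ?N"
    unfolding complex_join_insert by (auto simp: image_Un image_image)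
  finally have join_eq: "complex_join K L = complex_join ?K' L \<union> (\<union>) t ` ?N" .
  have "collapsible ?N"
    using step.prems(1,2) by (intro collapsible_cone[of _ v] simplicial_complex_cone) auto
  then have "collapses (complex_join ?K' L \<union> (\<union>) t ` ?N) (complex_join ?K' L)"
  proof (rule collapses_star_collapsible)
    show "\<forall>m\<in>?N. m \<inter> t = {}" using disjoint_L free_face_notin[OF step.hyps(1)] by auto
    show "\<forall>r\<in>complex_join ?K' L. \<not> t \<subseteq> r"
    proof (intro ballI notI)
      fix r assume "r \<in> complex_join ?K' L" "t \<subseteq> r"
      then obtain k l where kl: "k \<in> ?K'" "l \<in> L" "t \<subseteq> k \<union> l"
        unfolding complex_join_def by auto
      then have "t \<subseteq> k" using disjoint_L(1)[OF kl(2)] by blast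
      then show False using kl(1) free_face_cases[OF step.hyps(1)] by blast
    qed
  qed
  moreover have "collapsible (complex_join ?K' L)"
    using step.prems by (intro step.hyps(3)) auto
  ultimately show ?case unfolding join_eq by (rule collapses_trans)
qed

lemma collapses_complex_join_facets:
  assumes dis: "\<Union>K \<inter> \<Union>L = {}" and S: "S \<subseteq> facets K" "T \<subseteq> S" "finite T" and R: "collapsible (L - R)"
  shows "collapses (complex_join (K - S) L \<union> complex_join T (L - R)) (complex_join (K - S) L)"
  using S(3,2)
proof (induction rule: finite_subset_induct')
  case empty
  then show ?case by (simp add: collapses.refl)
next
  case (insert s T)
  have s: "s \<in> K" "\<And>k. k \<in> K \<Longrightarrow> s \<subseteq> k \<Longrightarrow> k = s"
    using insert.hyps(2) S(1) unfolding facets_def by auto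
  let ?A = "complex_join (K - S) L \<union> complex_join T (L - R)"
  have "collapses (?A \<union> (\<union>) s ` (L - R)) ?A"
  proof (rule collapses_star_collapsible[OF R])
    show "\<forall>m\<in>L - R. m \<inter> s = {}" using dis s(1) by blast
    show "\<forall>r\<in>?A. \<not> s \<subseteq> r"
    proof (intro ballI notI)
      fix r assume "r \<in> ?A" "s \<subseteq> r"
      then obtain k l where kl: "k \<in> K - S \<or> k \<in> T" "l \<in> L" "s \<subseteq> k \<union> l"
        unfolding complex_join_def by auto
      have "s \<inter> l = {}" using dis s(1) kl(2) by blast
      then have "s \<subseteq> k" using kl(3) by blast
      moreover have "k \<in> K" using kl(1) insert.hyps(3) S(1) unfolding facets_def by auto
      ultimately have "k = s" by (intro s(2))
      then show False using kl(1) insert.hyps(2,4) by auto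
    qed
  qed
  then have "collapses (complex_join (K - S) L \<union> complex_join (insert s T) (L - R)) ?A"
    unfolding complex_join_insert by (simp add: Un_ac)
  then show ?case using insert.IH by (rule collapses_trans)
qed

lemma collapsible_complex_join_diff:
  assumes dis: "\<Union>K \<inter> \<Union>L = {}" and K: "finite K" "S \<subseteq> facets K" "collapsible (K - S)"
    and L: "simplicial_complex L" "finite L" "R \<subseteq> L" "collapsible (L - R)"
  shows "collapsible (complex_join K L - complex_join S R)"
proof -
  have S_subset: "S \<subseteq> K" using K(2) unfolding facets_def by auto
  have "collapses (complex_join (K - S) L \<union> complex_join S (L - R)) (complex_join (K - S) L)"
    by (rule collapses_complex_join_facets[OF dis K(2) order_refl finite_subset[OF S_subset K(1)] L(4)])
  moreover have "collapsible (complex_join (K - S) L)"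
    using dis by (intro collapsible_complex_join K(3) L(1,2)) blast
  ultimately show ?thesis unfolding complex_join_diff[OF dis S_subset L(3)] by (rule collapses_trans)
qed

section \<open>Order complexes with critical chains\<close>

definition comparable :: "('a \<Rightarrow> 'a \<Rightarrow> bool) \<Rightarrow> 'a \<Rightarrow> 'a \<Rightarrow> bool" where
  "comparable lt x y \<longleftrightarrow> x = y \<or> lt x y \<or> lt y x"

definition order_complex :: "('a \<Rightarrow> 'a \<Rightarrow> bool) \<Rightarrow> 'a set \<Rightarrow> 'a set set" where
  "order_complex lt X = {c. c \<subseteq> X \<and> finite c \<and> (\<forall>x\<in>c. \<forall>y\<in>c. comparable lt x y)}"

definition max_chain :: "('a \<Rightarrow> 'a \<Rightarrow> bool) \<Rightarrow> 'a set \<Rightarrow> 'a set \<Rightarrow> bool" where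
  "max_chain lt X c \<longleftrightarrow> c \<in> order_complex lt X \<and> (\<forall>x\<in>X. (\<forall>y\<in>c. comparable lt x y) \<longrightarrow> x \<in> c)"

text \<open>The maximal chains in \<open>S\<close> play the role of the critical cells of discrete Morse theory.\<close>
definition critical_chains :: "('a \<Rightarrow> 'a \<Rightarrow> bool) \<Rightarrow> 'a set \<Rightarrow> 'a set set \<Rightarrow> bool" where
  "critical_chains lt X S \<longleftrightarrow>
    finite X \<and> (\<forall>c\<in>S. max_chain lt X c) \<and> collapsible (order_complex lt X - S)"

definition chains_through :: "'a set set \<Rightarrow> 'a \<Rightarrow> 'a set set \<Rightarrow> 'a set set" where
  "chains_through A x T = {s \<union> insert x t | s t. s \<in> A \<and> t \<in> T}"

lemma comparable_commute: "comparable lt x y \<longleftrightarrow> comparable lt y x"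
  unfolding comparable_def by auto

lemma comparable_psubset: "comparable (\<subset>) X Y \<longleftrightarrow> X \<subseteq> Y \<or> Y \<subseteq> X"
  unfolding comparable_def by auto

lemma comparable_converse: "comparable (\<lambda>x y. lt y x) = comparable lt"
  by (auto simp: comparable_def fun_eq_iff)

lemma order_complex_converse: "order_complex (\<lambda>x y. lt y x) = order_complex lt"
  unfolding order_complex_def comparable_converse[of lt] ..

lemma max_chain_converse: "max_chain (\<lambda>x y. lt y x) = max_chain lt"
  unfolding max_chain_def comparable_converse[of lt] order_complex_converse[of lt] ..

lemma critical_chains_converse: "critical_chains (\<lambda>x y. lt y x) = critical_chains lt"
  unfolding critical_chains_def order_complex_converse[of lt] max_chain_converse[of lt] ..

lemma
  assumes "c \<in> order_complex lt X"
  shows order_complex_subset: "c \<subseteq> X"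
    and order_complex_finite: "finite c"
    and order_complex_comparable: "x \<in> c \<Longrightarrow> y \<in> c \<Longrightarrow> comparable lt x y"
  using assms unfolding order_complex_def by auto

lemma order_complexI:
  assumes "c \<subseteq> X" "finite c" "\<And>x y. x \<in> c \<Longrightarrow> y \<in> c \<Longrightarrow> comparable lt x y"
  shows "c \<in> order_complex lt X"
  using assms unfolding order_complex_def by auto

lemma order_complex_void [simp]: "order_complex lt {} = {{}}"
  unfolding order_complex_def by auto

lemma empty_order_complex: "{} \<in> order_complex lt X"
  unfolding order_complex_def by simp

lemma simplicial_complex_order_complex: "simplicial_complex (order_complex lt X)"
  unfolding simplicial_complex_def order_complex_def by (auto intro: finite_subset)

lemma finite_order_complex: "finite X \<Longrightarrow> finite (order_complex lt X)"
  by (rule finite_subset[of _ "Pow X"]) (auto dest: order_complex_subset)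

lemma max_chain_order_complex: "max_chain lt X c \<Longrightarrow> c \<in> order_complex lt X"
  unfolding max_chain_def by simp

lemma max_chain_mem: "max_chain lt X c \<Longrightarrow> x \<in> X \<Longrightarrow> (\<And>y. y \<in> c \<Longrightarrow> comparable lt x y) \<Longrightarrow> x \<in> c"
  unfolding max_chain_def by simp

lemma max_chain_subset: "max_chain lt X c \<Longrightarrow> c \<subseteq> X"
  by (rule order_complex_subset[OF max_chain_order_complex])

lemma max_chain_facet:
  assumes c: "max_chain lt X c"
  shows "c \<in> facets (order_complex lt X)"
proof -
  have "d = c" if d: "d \<in> order_complex lt X" "c \<subseteq> d" for d
  proof -
    have "x \<in> c" if "x \<in> d" for x
      using d(2) that by (intro max_chain_mem[OF c] subsetD[OF order_complex_subset[OF d(1)]]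
          order_complex_comparable[OF d(1)]) auto
    then show ?thesis using d(2) by auto
  qed
  then show ?thesis using max_chain_order_complex[OF c] unfolding facets_def by auto
qed

lemma max_chain_restrict: "max_chain lt X c \<Longrightarrow> c \<subseteq> Y \<Longrightarrow> Y \<subseteq> X \<Longrightarrow> max_chain lt Y c"
  unfolding max_chain_def order_complex_def by (simp add: subset_iff)

lemma
  assumes "critical_chains lt X S"
  shows critical_chains_finite: "finite X"
    and critical_chains_max: "c \<in> S \<Longrightarrow> max_chain lt X c"
    and critical_chains_collapsible: "collapsible (order_complex lt X - S)"
  using assms unfolding critical_chains_def by auto

lemma
  assumes "critical_chains lt X S"
  shows critical_chains_facets: "S \<subseteq> facets (order_complex lt X)"
    and critical_chains_order_complex: "S \<subseteq> order_complex lt X"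
    and critical_chains_subset: "c \<in> S \<Longrightarrow> c \<subseteq> X"
  using critical_chains_max[OF assms] max_chain_facet max_chain_order_complex max_chain_subset
  by fast+

lemma critical_chains_void: "critical_chains lt {} {{}}"
  unfolding critical_chains_def max_chain_def by (simp add: collapses.refl)

lemma critical_chains_empty: "critical_chains lt X {} \<longleftrightarrow> finite X \<and> collapsible (order_complex lt X)"
  unfolding critical_chains_def by simp

lemma collapsible_order_complex_cone:
  assumes "finite X" "a \<in> X" "\<And>x. x \<in> X \<Longrightarrow> comparable lt a x"
  shows "collapsible (order_complex lt X)"
proof (rule collapsible_cone[OF finite_order_complex[OF assms(1)] simplicial_complex_order_complex], rule ballI)
  fix s assume s: "s \<in> order_complex lt X"
  have a: "comparable lt a x" "comparable lt x a" if "x \<in> insert a s" for x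
    using assms(2,3) order_complex_subset[OF s] that comparable_commute[of lt x a] by auto
  show "insert a s \<in> order_complex lt X"
  proof (rule order_complexI)
    show "insert a s \<subseteq> X" "finite (insert a s)"
      using assms(2) order_complex_subset[OF s] order_complex_finite[OF s] by auto
    show "comparable lt x y" if "x \<in> insert a s" "y \<in> insert a s" for x y
      using that a[of x] a[of y] order_complex_comparable[OF s, of x y] by blast
  qed
qed

lemma chains_through_empty [simp]: "chains_through {} x T = {}" "chains_through A x {} = {}"
  unfolding chains_through_def by simp_all

lemma chains_through_bottom: "chains_through {{}} x T = insert x ` T"
  unfolding chains_through_def by auto

lemma chains_through_eq_join: "chains_through A x T = (\<union>) {x} ` complex_join A T"
  unfolding chains_through_def complex_join_def by (auto simp: image_iff)

locale strict_poset =
  fixes lt :: "'a \<Rightarrow> 'a \<Rightarrow> bool"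
  assumes irrefl: "\<not> lt x x" and trans: "lt x y \<Longrightarrow> lt y z \<Longrightarrow> lt x z"
begin

lemma asym: "lt x y \<Longrightarrow> \<not> lt y x"
  using irrefl trans by metis

lemma strict_poset_converse: "strict_poset (\<lambda>x y. lt y x)"
  using irrefl trans by unfold_locales

lemma chain_through_order_complex:
  assumes s: "s \<in> order_complex lt X" "\<And>y. y \<in> s \<Longrightarrow> lt y x"
    and t: "t \<in> order_complex lt X" "\<And>y. y \<in> t \<Longrightarrow> lt x y" and x: "x \<in> X"
  shows "s \<union> insert x t \<in> order_complex lt X"
proof (rule order_complexI)
  show "s \<union> insert x t \<subseteq> X" "finite (s \<union> insert x t)"
    using s(1) t(1) x order_complex_subset order_complex_finite by auto
  show "comparable lt u v" if "u \<in> s \<union> insert x t" "v \<in> s \<union> insert x t" for u v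
    using that s(2) t(2) order_complex_comparable[OF s(1), of u v] order_complex_comparable[OF t(1), of u v]
      trans[of u x v] trans[of v x u]
    unfolding comparable_def by blast
qed

lemma order_complex_through:
  "{c \<in> order_complex lt (insert x X). x \<in> c}
    = chains_through (order_complex lt {y\<in>X. lt y x}) x (order_complex lt {z\<in>X. lt x z})"
proof (intro equalityI subsetI)
  fix c assume c: "c \<in> {c \<in> order_complex lt (insert x X). x \<in> c}"
  let ?s = "{y\<in>c. lt y x}" and ?t = "{y\<in>c. lt x y}"
  have "c = ?s \<union> insert x ?t" using c unfolding order_complex_def comparable_def by auto
  moreover have "?s \<in> order_complex lt {y\<in>X. lt y x}" "?t \<in> order_complex lt {y\<in>X. lt x y}"
    using c irrefl unfolding order_complex_def by auto
  ultimately show "c \<in> chains_through (order_complex lt {y\<in>X. lt y x}) x (order_complex lt {z\<in>X. lt x z})"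
    unfolding chains_through_def by blast
next
  fix c assume "c \<in> chains_through (order_complex lt {y\<in>X. lt y x}) x (order_complex lt {z\<in>X. lt x z})"
  then obtain s t where st: "c = s \<union> insert x t"
    "s \<in> order_complex lt {y\<in>X. lt y x}" "t \<in> order_complex lt {z\<in>X. lt x z}"
    unfolding chains_through_def by auto
  have "s \<in> order_complex lt (insert x X)" "t \<in> order_complex lt (insert x X)"
    using st(2,3) unfolding order_complex_def by auto
  then have "c \<in> order_complex lt (insert x X)" unfolding st(1)
    using order_complex_subset[OF st(2)] order_complex_subset[OF st(3)]
    by (intro chain_through_order_complex) auto
  then show "c \<in> {c \<in> order_complex lt (insert x X). x \<in> c}" using st(1) by simp
qed

lemma chain_through_unique:
  assumes eq: "s \<union> insert x t = s' \<union> insert x' t'" and "x \<notin> Y" "x' \<notin> Y"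
    and s: "s \<subseteq> {y\<in>Y. lt y x}" "s' \<subseteq> {y\<in>Y. lt y x'}" and t: "t \<subseteq> {z. lt x z}" "t' \<subseteq> {z. lt x' z}"
  shows "x = x' \<and> s = s' \<and> t = t'"
proof -
  have "x = x'"
  proof (rule ccontr)
    assume "x \<noteq> x'"
    then have "x' \<in> t" "x \<in> t'" using assms by auto
    then show False using t asym by blast
  qed
  moreover have "s = {y\<in>s \<union> insert x t. lt y x}" "s' = {y\<in>s' \<union> insert x' t'. lt y x'}"
    "t = {y\<in>s \<union> insert x t. lt x y}" "t' = {y\<in>s' \<union> insert x' t'. lt x' y}"
    using s t asym irrefl by auto
  ultimately show ?thesis using eq by metis
qed

lemma order_complex_below_above_disjoint:
  "\<Union>(order_complex lt {y\<in>Y. lt y x}) \<inter> \<Union>(order_complex lt {z\<in>X. lt x z}) = {}"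
proof (rule equals0I)
  fix u assume "u \<in> \<Union>(order_complex lt {y\<in>Y. lt y x}) \<inter> \<Union>(order_complex lt {z\<in>X. lt x z})"
  then have "lt u x" "lt x u" using order_complex_subset by blast+
  then show False using asym by blast
qed

subsection \<open>Adding elements to a poset\<close>

lemma collapses_order_complex_remove:
  assumes x: "x \<notin> X" and S: "\<And>c. c \<in> S \<Longrightarrow> c \<subseteq> X"
    and A: "A \<subseteq> order_complex lt {y\<in>X. lt y x}" and T: "T \<subseteq> order_complex lt {z\<in>X. lt x z}"
    and col: "collapsible (complex_join (order_complex lt {y\<in>X. lt y x}) (order_complex lt {z\<in>X. lt x z})
      - complex_join A T)"
  shows "collapses (order_complex lt (insert x X) - (S \<union> chains_through A x T)) (order_complex lt X - S)"
proof -
  let ?K = "order_complex lt {y\<in>X. lt y x}" and ?L = "order_complex lt {z\<in>X. lt x z}"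
  let ?N = "complex_join ?K ?L - complex_join A T"
  have x_notin: "x \<notin> m" if "m \<in> complex_join ?K ?L" for m
    using that x order_complex_subset unfolding complex_join_def by blast
  then have "inj_on ((\<union>) {x}) (complex_join ?K ?L)"
    by (intro inj_on_inverseI[of _ "\<lambda>m. m - {x}"]) auto
  moreover have "complex_join A T \<subseteq> complex_join ?K ?L" using A T unfolding complex_join_def by auto
  ultimately have link_eq: "(\<union>) {x} ` ?N = chains_through ?K x ?L - chains_through A x T"
    unfolding chains_through_eq_join by (intro inj_on_image_set_diff) auto
  have "c \<in> order_complex lt (insert x X) - (S \<union> chains_through A x T)
    \<longleftrightarrow> c \<in> (order_complex lt X - S) \<union> (chains_through ?K x ?L - chains_through A x T)" for c
  proof (cases "x \<in> c")
    case False
    then show ?thesis unfolding chains_through_def order_complex_def by auto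
  next
    case True
    then have "c \<notin> order_complex lt X" "c \<notin> S" using x S order_complex_subset by blast+
    then show ?thesis using True unfolding order_complex_through[symmetric] by auto
  qed
  then have decomposition: "order_complex lt (insert x X) - (S \<union> chains_through A x T)
    = (order_complex lt X - S) \<union> (\<union>) {x} ` ?N" unfolding link_eq by blast
  show ?thesis unfolding decomposition
    using x x_notin order_complex_subset by (intro collapses_star_collapsible[OF col]) blast+
qed

context
  fixes X Y :: "'a set" and S :: "'a set set" and A T :: "'a \<Rightarrow> 'a set set" and x :: 'a
  assumes YX: "Y \<subseteq> X" and S: "\<And>c. c \<in> S \<Longrightarrow> c \<subseteq> Y"
    and A: "\<And>y. y \<in> X - Y \<Longrightarrow> A y \<subseteq> order_complex lt {z\<in>Y. lt z y}"
    and T: "\<And>y. y \<in> X - Y \<Longrightarrow> T y \<subseteq> order_complex lt {z\<in>X. lt y z}"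
    and x: "x \<in> X - Y" and minimal: "\<And>y. y \<in> X - Y \<Longrightarrow> \<not> lt y x"
begin

lemma above_remove_minimal: "y \<in> X - Y \<Longrightarrow> {z\<in>X-{x}. lt y z} = {z\<in>X. lt y z}"
  using minimal by auto

lemma chains_through_remove_minimal:
  assumes y: "y \<in> X - {x} - Y" and c: "c \<in> chains_through (A y) y (T y)"
  shows "c \<subseteq> X - {x}"
proof -
  have y': "y \<in> X - Y" using y by auto
  obtain s t where st: "s \<in> A y" "t \<in> T y" "c = s \<union> insert y t"
    using c unfolding chains_through_def by auto
  have "s \<subseteq> Y" "t \<subseteq> X - {x}"
    using order_complex_subset[OF subsetD[OF A[OF y'] st(1)]] order_complex_subset[OF subsetD[OF T[OF y'] st(2)]]
      above_remove_minimal[OF y'] by blast+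
  then show ?thesis using st y x YX by auto
qed

lemma collapses_order_complex_remove_minimal:
  assumes "collapsible (complex_join (order_complex lt {z\<in>Y. lt z x}) (order_complex lt {z\<in>X. lt x z})
    - complex_join (A x) (T x))"
  shows "collapses (order_complex lt X - (S \<union> (\<Union>y\<in>X-Y. chains_through (A y) y (T y))))
    (order_complex lt (X - {x}) - (S \<union> (\<Union>y\<in>X-{x}-Y. chains_through (A y) y (T y))))"
proof -
  let ?S = "S \<union> (\<Union>y\<in>X-{x}-Y. chains_through (A y) y (T y))"
  have below: "{z\<in>X-{x}. lt z x} = {z\<in>Y. lt z x}" using minimal x YX irrefl by auto
  have "collapses (order_complex lt (insert x (X - {x})) - (?S \<union> chains_through (A x) x (T x)))
    (order_complex lt (X - {x}) - ?S)"
  proof (rule collapses_order_complex_remove)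
    fix c assume "c \<in> ?S"
    then consider "c \<in> S" | y where "y \<in> X - {x} - Y" "c \<in> chains_through (A y) y (T y)" by auto
    then show "c \<subseteq> X - {x}"
    proof cases
      case 1
      then show ?thesis using S[of c] YX x by auto
    qed (rule chains_through_remove_minimal)
  qed (use A[OF x] T[OF x] assms in \<open>simp_all only: above_remove_minimal[OF x] below, simp\<close>)
  moreover have "insert x (X - {x}) = X" using x by auto
  moreover have "?S \<union> chains_through (A x) x (T x) = S \<union> (\<Union>y\<in>X-Y. chains_through (A y) y (T y))"
    using x by auto
  ultimately show ?thesis by (simp only:)
qed

end

lemma collapses_order_complex_remove_set:
  assumes "finite X" "Y \<subseteq> X" and "\<And>c. c \<in> S \<Longrightarrow> c \<subseteq> Y"
    and "\<And>x. x \<in> X - Y \<Longrightarrow> A x \<subseteq> order_complex lt {y\<in>Y. lt y x}"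
    and "\<And>x. x \<in> X - Y \<Longrightarrow> T x \<subseteq> order_complex lt {z\<in>X. lt x z}"
    and "\<And>x. x \<in> X - Y \<Longrightarrow> collapsible (complex_join (order_complex lt {y\<in>Y. lt y x})
      (order_complex lt {z\<in>X. lt x z}) - complex_join (A x) (T x))"
  shows "collapses (order_complex lt X - (S \<union> (\<Union>x\<in>X-Y. chains_through (A x) x (T x)))) (order_complex lt Y - S)"
  using assms
proof (induction "card (X - Y)" arbitrary: X)
  case 0
  then have "X = Y" by auto
  then show ?case by (simp add: collapses.refl)
next
  case (Suc n)
  then have fin: "finite (X - Y)" "X - Y \<noteq> {}" by auto
  have "asymp_on (X - Y) lt" by (rule asymp_onI) (rule asym)
  moreover have "transp_on (X - Y) lt" by (rule transp_onI) (rule trans)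
  ultimately obtain x where x: "x \<in> X - Y" and minimal: "\<And>y. y \<in> X - Y \<Longrightarrow> \<not> lt y x"
    using Finite_Set.bex_min_element[OF fin(1) _ _ fin(2)] irrefl by metis
  have above: "{z\<in>X-{x}. lt y z} = {z\<in>X. lt y z}" if "y \<in> X - Y" for y using minimal that by auto
  have "collapses (order_complex lt (X - {x}) - (S \<union> (\<Union>y\<in>X-{x}-Y. chains_through (A y) y (T y))))
    (order_complex lt Y - S)"
  proof (rule Suc.hyps(1))
    have "X - {x} - Y = (X - Y) - {x}" by auto
    then show "n = card (X - {x} - Y)" using Suc.hyps(2) x fin(1) by simp
    show "finite (X - {x})" "Y \<subseteq> X - {x}" using Suc.prems(1,2) x by auto
    fix y assume "y \<in> X - {x} - Y"
    then have y: "y \<in> X - Y" by auto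
    show "A y \<subseteq> order_complex lt {z\<in>Y. lt z y}" by (rule Suc.prems(4)[OF y])
    show "T y \<subseteq> order_complex lt {z\<in>X-{x}. lt y z}"
      "collapsible (complex_join (order_complex lt {z\<in>Y. lt z y}) (order_complex lt {z\<in>X-{x}. lt y z})
        - complex_join (A y) (T y))"
      unfolding above[OF y] by (rule Suc.prems(5,6)[OF y])+
  qed (rule Suc.prems(3))
  from collapses_trans[OF collapses_order_complex_remove_minimal[OF Suc.prems(2-5) x minimal Suc.prems(6)[OF x]] this]
  show ?case .
qed

lemma collapses_order_complex_subset:
  assumes fin: "finite X" and YX: "Y \<subseteq> X" and S: "\<And>c. c \<in> S \<Longrightarrow> c \<subseteq> Y"
    and below: "\<And>x. x \<in> X - Y \<Longrightarrow> collapsible (order_complex lt {y\<in>Y. lt y x})"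
  shows "collapses (order_complex lt X - S) (order_complex lt Y - S)"
proof -
  have "collapsible (complex_join (order_complex lt {y\<in>Y. lt y x}) (order_complex lt {z\<in>X. lt x z}))"
    if "x \<in> X - Y" for x
    using below[OF that] fin order_complex_below_above_disjoint
    by (intro collapsible_complex_join simplicial_complex_order_complex finite_order_complex) auto
  then have "collapses (order_complex lt X - (S \<union> (\<Union>x\<in>X-Y. chains_through {} x {}))) (order_complex lt Y - S)"
    by (intro collapses_order_complex_remove_set[OF fin YX S]) simp_all
  then show ?thesis by simp
qed

lemma critical_chains_superset:
  assumes "finite X" "Y \<subseteq> X" "critical_chains lt Y S" "\<And>c. c \<in> S \<Longrightarrow> max_chain lt X c"
    "\<And>x. x \<in> X - Y \<Longrightarrow> collapsible (order_complex lt {y\<in>Y. lt y x})"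
  shows "critical_chains lt X S"
proof -
  have "collapses (order_complex lt X - S) (order_complex lt Y - S)"
    by (rule collapses_order_complex_subset[OF assms(1,2) critical_chains_subset[OF assms(3)] assms(5)])
  then have "collapsible (order_complex lt X - S)"
    using critical_chains_collapsible[OF assms(3)] by (rule collapses_trans)
  then show ?thesis using assms(1,4) unfolding critical_chains_def by auto
qed

lemma critical_chains_superset_above:
  assumes "finite X" "Y \<subseteq> X" "critical_chains lt Y S" "\<And>c. c \<in> S \<Longrightarrow> max_chain lt X c"
    "\<And>x. x \<in> X - Y \<Longrightarrow> collapsible (order_complex lt {y\<in>Y. lt x y})"
  shows "critical_chains lt X S"
proof -
  interpret converse: strict_poset "\<lambda>x y. lt y x" by (rule strict_poset_converse)
  show ?thesis
    using converse.critical_chains_superset[OF assms(1,2), of S] assms(3-5)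
    unfolding critical_chains_converse[of lt] max_chain_converse[of lt] order_complex_converse[of lt] by blast
qed

lemma critical_chains_insert_elements:
  assumes fin: "finite X" and YX: "Y \<subseteq> X"
    and Y: "critical_chains lt Y S"
    and max: "\<And>c. c \<in> S \<Longrightarrow> max_chain lt X c"
    and below: "\<And>x. x \<in> X - Y \<Longrightarrow> critical_chains lt {y\<in>Y. lt y x} (A x)"
    and above: "\<And>x. x \<in> X - Y \<Longrightarrow> critical_chains lt {z\<in>X. lt x z} (T x)"
    and max_through: "\<And>x c. x \<in> X - Y \<Longrightarrow> c \<in> chains_through (A x) x (T x) \<Longrightarrow> max_chain lt X c"
  shows "critical_chains lt X (S \<union> (\<Union>x\<in>X-Y. chains_through (A x) x (T x)))"
proof -
  have "collapsible (complex_join (order_complex lt {y\<in>Y. lt y x}) (order_complex lt {z\<in>X. lt x z})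
    - complex_join (A x) (T x))" if x: "x \<in> X - Y" for x
    using fin finite_subset[OF YX fin] critical_chains_facets[OF below[OF x]]
      critical_chains_order_complex[OF above[OF x]]
      critical_chains_collapsible[OF below[OF x]] critical_chains_collapsible[OF above[OF x]]
    by (intro collapsible_complex_join_diff order_complex_below_above_disjoint
        simplicial_complex_order_complex finite_order_complex) auto
  then have "collapses (order_complex lt X - (S \<union> (\<Union>x\<in>X-Y. chains_through (A x) x (T x)))) (order_complex lt Y - S)"
    by (intro collapses_order_complex_remove_set[OF fin YX critical_chains_subset[OF Y]]
        critical_chains_order_complex[OF below] critical_chains_order_complex[OF above])
  then have "collapsible (order_complex lt X - (S \<union> (\<Union>x\<in>X-Y. chains_through (A x) x (T x))))"
    using critical_chains_collapsible[OF Y] by (rule collapses_trans)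
  then show ?thesis using fin max max_through unfolding critical_chains_def by auto
qed

lemma critical_chains_insert:
  assumes fin: "finite X" and x: "x \<notin> X"
    and S: "critical_chains lt X S" "\<And>c. c \<in> S \<Longrightarrow> max_chain lt (insert x X) c"
    and below: "critical_chains lt {y\<in>X. lt y x} A"
    and above: "critical_chains lt {z\<in>X. lt x z} T"
    and max_through: "\<And>c. c \<in> chains_through A x T \<Longrightarrow> max_chain lt (insert x X) c"
  shows "critical_chains lt (insert x X) (S \<union> chains_through A x T)"
proof -
  have diff: "insert x X - X = {x}" using x by auto
  have above_eq: "{z\<in>insert x X. lt x z} = {z\<in>X. lt x z}" using irrefl by auto
  have "critical_chains lt (insert x X) (S \<union> (\<Union>x'\<in>insert x X - X. chains_through A x' T))"
  proof (rule critical_chains_insert_elements[OF _ _ S], unfold diff)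
    show "critical_chains lt {y\<in>X. lt y x'} A" "critical_chains lt {z\<in>insert x X. lt x' z} T"
      if "x' \<in> {x}" for x'
      using that below above above_eq by simp_all
    show "max_chain lt (insert x X) c" if "x' \<in> {x}" "c \<in> chains_through A x' T" for x' c
      using that max_through by simp
  qed (use fin in auto)
  then show ?thesis unfolding diff by simp
qed

lemma collapsible_order_complex_meet:
  assumes fin: "finite X" and a: "a \<in> X"
    and m: "\<And>x. x \<in> X \<Longrightarrow> m x \<in> X \<and> (m x = x \<or> lt (m x) x) \<and> (m x = a \<or> lt (m x) a)"
    and glb: "\<And>x y. x \<in> X \<Longrightarrow> y \<in> X \<Longrightarrow> lt y x \<Longrightarrow> y = a \<or> lt y a \<Longrightarrow> y = m x \<or> lt y (m x)"
  shows "collapsible (order_complex lt X)"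
proof -
  let ?Y = "{x\<in>X. x = a \<or> lt x a}"
  have "critical_chains lt X {}"
  proof (rule critical_chains_superset[OF fin])
    show "critical_chains lt ?Y {}" unfolding critical_chains_empty
      using fin a by (auto intro!: collapsible_order_complex_cone[of _ a] simp: comparable_def)
    fix x assume x: "x \<in> X - ?Y"
    then have "m x \<in> ?Y" "lt (m x) x" using m[of x] by auto
    moreover have "comparable lt (m x) y" if "y \<in> ?Y" "lt y x" for y
      using glb[of x y] that x unfolding comparable_def by blast
    ultimately show "collapsible (order_complex lt {y\<in>?Y. lt y x})"
      using fin by (intro collapsible_order_complex_cone[of _ "m x"]) auto
  qed auto
  then show ?thesis unfolding critical_chains_empty by simp
qed

lemma collapsible_order_complex_join:
  assumes fin: "finite X" and a: "a \<in> X"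
    and m: "\<And>x. x \<in> X \<Longrightarrow> m x \<in> X \<and> (m x = x \<or> lt x (m x)) \<and> (m x = a \<or> lt a (m x))"
    and lub: "\<And>x y. x \<in> X \<Longrightarrow> y \<in> X \<Longrightarrow> lt x y \<Longrightarrow> y = a \<or> lt a y \<Longrightarrow> y = m x \<or> lt (m x) y"
  shows "collapsible (order_complex lt X)"
proof -
  interpret converse: strict_poset "\<lambda>x y. lt y x" by (rule strict_poset_converse)
  show ?thesis
    using converse.collapsible_order_complex_meet[OF fin a m lub] unfolding order_complex_converse[of lt] .
qed

subsection \<open>Saturated chains\<close>

abbreviation between :: "'a set \<Rightarrow> 'a \<Rightarrow> 'a \<Rightarrow> 'a set" where
  "between T a b \<equiv> {z\<in>T. lt a z \<and> lt z b}"

text \<open>The chain \<open>c\<close> does not contain its end points \<open>a\<close> and \<open>b\<close>.\<close>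
definition saturated :: "'a set \<Rightarrow> 'a \<Rightarrow> 'a set \<Rightarrow> 'a \<Rightarrow> bool" where
  "saturated T a c b \<longleftrightarrow> lt a b \<and> max_chain lt (between T a b) c"

lemma
  assumes "saturated T a c b"
  shows saturated_less: "lt a b"
    and saturated_max_chain: "max_chain lt (between T a b) c"
  using assms unfolding saturated_def by auto

lemma saturated_cover:
  assumes "lt a b" "\<And>z. z \<in> T \<Longrightarrow> lt a z \<Longrightarrow> lt z b \<Longrightarrow> False"
  shows "saturated T a {} b"
  using assms unfolding saturated_def max_chain_def order_complex_def by auto

lemma saturated_compose:
  assumes c: "saturated T a c x" and d: "saturated T x d b" and x: "x \<in> T"
  shows "saturated T a (c \<union> insert x d) b"
proof -
  let ?I = "between T a b"
  note less = saturated_less[OF c] saturated_less[OF d]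
    and mc = saturated_max_chain[OF c] and md = saturated_max_chain[OF d]
  have "max_chain lt ?I (c \<union> insert x d)"
    unfolding max_chain_def
  proof (intro conjI ballI impI)
    have "c \<in> order_complex lt ?I" "d \<in> order_complex lt ?I"
      using max_chain_order_complex[OF mc] max_chain_order_complex[OF md] less trans
      unfolding order_complex_def by blast+
    then show "c \<union> insert x d \<in> order_complex lt ?I"
      using max_chain_subset[OF mc] max_chain_subset[OF md] less x
      by (intro chain_through_order_complex) auto
    fix z assume z: "z \<in> ?I" "\<forall>y\<in>c \<union> insert x d. comparable lt z y"
    then consider "z = x" | "lt z x" | "lt x z" unfolding comparable_def by auto
    then show "z \<in> c \<union> insert x d"
      using z by cases (auto intro: max_chain_mem[OF mc] max_chain_mem[OF md])
  qed
  then show ?thesis using trans[OF less] unfolding saturated_def by simp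
qed

end

subsection \<open>Embeddings of posets\<close>

lemma comparable_embedding:
  assumes "inj_on f X" "\<And>x y. x \<in> X \<Longrightarrow> y \<in> X \<Longrightarrow> lt' (f x) (f y) \<longleftrightarrow> lt x y" "x \<in> X" "y \<in> X"
  shows "comparable lt' (f x) (f y) \<longleftrightarrow> comparable lt x y"
  using inj_on_eq_iff[OF assms(1,3,4)] assms(2)[OF assms(3,4)] assms(2)[OF assms(4,3)]
  by (simp add: comparable_def)

context
  fixes f :: "'a \<Rightarrow> 'b" and X :: "'a set" and lt lt'
  assumes inj: "inj_on f X"
    and emb: "\<And>x y. x \<in> X \<Longrightarrow> y \<in> X \<Longrightarrow> comparable lt' (f x) (f y) \<longleftrightarrow> comparable lt x y"
begin

lemma order_complex_image_iff:
  assumes "c \<subseteq> X"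
  shows "f ` c \<in> order_complex lt' (f ` X) \<longleftrightarrow> c \<in> order_complex lt X"
proof -
  have "finite (f ` c) \<longleftrightarrow> finite c"
    by (rule finite_image_iff[OF inj_on_subset[OF inj assms]])
  moreover have "comparable lt' (f x) (f y) \<longleftrightarrow> comparable lt x y" if "x \<in> c" "y \<in> c" for x y
    using emb assms that by blast
  ultimately show ?thesis using assms unfolding order_complex_def by auto
qed

lemma order_complex_image: "order_complex lt' (f ` X) = (`) f ` order_complex lt X"
proof (intro equalityI subsetI)
  fix c assume c: "c \<in> order_complex lt' (f ` X)"
  obtain d where d: "d \<subseteq> X" "c = f ` d" by (rule subset_imageE[OF order_complex_subset[OF c]])
  then show "c \<in> (`) f ` order_complex lt X" using c order_complex_image_iff[OF d(1)] by simp
next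
  fix c assume "c \<in> (`) f ` order_complex lt X"
  then obtain d where d: "d \<in> order_complex lt X" "c = f ` d" by auto
  then show "c \<in> order_complex lt' (f ` X)"
    using order_complex_image_iff[OF order_complex_subset[OF d(1)]] by simp
qed

lemma order_complex_image_diff:
  assumes "S \<subseteq> order_complex lt X"
  shows "(`) f ` (order_complex lt X - S) = order_complex lt' (f ` X) - (`) f ` S"
  unfolding order_complex_image
proof (rule inj_on_image_set_diff[OF inj_on_image_Pow[OF inj]])
  have "order_complex lt X \<subseteq> Pow X" using order_complex_subset by blast
  then show "order_complex lt X - S \<subseteq> Pow X" "S \<subseteq> Pow X" using assms by blast+
qed

lemma max_chain_image:
  assumes c: "c \<subseteq> X"
  shows "max_chain lt' (f ` X) (f ` c) \<longleftrightarrow> max_chain lt X c"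
proof -
  have "f x \<in> f ` c \<longleftrightarrow> x \<in> c" if "x \<in> X" for x
    using that c inj by (simp add: inj_on_image_mem_iff)
  moreover have "(\<forall>y\<in>f ` c. comparable lt' (f x) y) \<longleftrightarrow> (\<forall>y\<in>c. comparable lt x y)" if "x \<in> X" for x
    using emb that c by auto
  ultimately show ?thesis unfolding max_chain_def order_complex_image_iff[OF c] by auto
qed

lemma critical_chains_image:
  assumes S: "critical_chains lt X S"
  shows "critical_chains lt' (f ` X) ((`) f ` S)"
proof -
  have "collapses ((`) f ` (order_complex lt X - S)) ((`) f ` {})"
  proof (rule collapses_image[OF critical_chains_collapsible[OF S]])
    have "\<Union>(order_complex lt X - S) \<subseteq> X" using order_complex_subset by fast
    then show "inj_on f (\<Union>(order_complex lt X - S))" by (rule inj_on_subset[OF inj])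
  qed
  then have "collapsible (order_complex lt' (f ` X) - (`) f ` S)"
    unfolding order_complex_image_diff[OF critical_chains_order_complex[OF S]] by simp
  moreover have "max_chain lt' (f ` X) (f ` c)" if "c \<in> S" for c
    using max_chain_image[OF critical_chains_subset[OF S that]] critical_chains_max[OF S that] by simp
  ultimately show ?thesis using critical_chains_finite[OF S] unfolding critical_chains_def by auto
qed

end

section \<open>Collapses and homotopy type\<close>

abbreviation support :: "('v \<Rightarrow> real) \<Rightarrow> 'v set" where
  "support x \<equiv> {v. x v \<noteq> 0}"

definition points :: "'v set set \<Rightarrow> ('v \<Rightarrow> real) set" where
  "points K = {x. (\<forall>v. 0 \<le> x v) \<and> support x \<in> K \<and> sum x (support x) = 1}"

lemma geom_realization_points: "geom_realization K = top_of_set (points K)"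
  unfolding geom_realization_def points_def ..

lemma
  assumes "x \<in> points K"
  shows points_nonneg: "0 \<le> x v"
    and points_support: "support x \<in> K"
  using assms unfolding points_def by auto

lemma points_diff_iff: "x \<in> points (K - S) \<longleftrightarrow> x \<in> points K \<and> support x \<notin> S"
  unfolding points_def by auto

lemma points_mono: "K \<subseteq> L \<Longrightarrow> points K \<subseteq> points L"
  unfolding points_def by auto

lemma points_sum:
  assumes "x \<in> points K" "finite s" "support x \<subseteq> s"
  shows "sum x s = 1"
proof -
  have "sum x s = sum x (support x)" using assms(2,3) by (intro sum.mono_neutral_right) auto
  then show ?thesis using assms(1) unfolding points_def by auto
qed

lemma pointsI:
  assumes K: "simplicial_complex K" "s \<in> K" and x: "\<And>v. 0 \<le> x v" "\<And>v. v \<notin> s \<Longrightarrow> x v = 0" "sum x s = 1"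
  shows "x \<in> points K"
proof -
  have sub: "support x \<subseteq> s" using x(2) by auto
  then have "sum x s = sum x (support x)"
    using simplicial_complex_finite[OF K] by (intro sum.mono_neutral_right) auto
  then show ?thesis using x simplicial_complex_subset[OF K sub] unfolding points_def by auto
qed

lemma points_support_nonempty:
  assumes "x \<in> points K"
  shows "support x \<noteq> {}"
proof
  assume "support x = {}"
  then have "sum x (support x) = 0" by simp
  then show False using assms unfolding points_def by simp
qed

lemma points_void: "points {} = {}" "points {{}} = {}"
  using points_support_nonempty points_support by fastforce+

lemma points_single_vertex: "points {{}, {v}} = {\<lambda>w. if w = v then 1 else 0}"
proof (intro equalityI subsetI)
  fix x assume x: "x \<in> points {{}, {v}}"
  have supp: "support x = {v}" using points_support[OF x] points_support_nonempty[OF x] by blast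
  then have "x v = 1" using points_sum[OF x, of "{v}"] by simp
  then have "x = (\<lambda>w. if w = v then 1 else 0)" using supp by (auto simp: fun_eq_iff)
  then show "x \<in> {\<lambda>w. if w = v then 1 else 0}" by simp
next
  fix x assume "x \<in> {\<lambda>w. if w = v then 1 else (0::real)}"
  moreover have "simplicial_complex {{}, {v}}" unfolding simplicial_complex_def by auto
  ultimately show "x \<in> points {{}, {v}}" by (intro pointsI[of _ "{v}"]) auto
qed

definition min_weight :: "'v set \<Rightarrow> ('v \<Rightarrow> real) \<Rightarrow> real" where
  "min_weight t x = Min (x ` t)"

lemma min_weight_le: "finite t \<Longrightarrow> v \<in> t \<Longrightarrow> min_weight t x \<le> x v"
  unfolding min_weight_def by simp

lemma min_weight_attained:
  assumes "finite t" "t \<noteq> {}"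
  obtains v where "v \<in> t" "x v = min_weight t x"
proof -
  have "min_weight t x \<in> x ` t" unfolding min_weight_def using assms by (intro Min_in) auto
  then show thesis using that by auto
qed

lemma min_weight_nonneg:
  assumes "x \<in> points K" "finite t" "t \<noteq> {}"
  shows "0 \<le> min_weight t x"
  using min_weight_attained[OF assms(2,3), of x] points_nonneg[OF assms(1)] by metis

lemma min_weight_nonzero_iff:
  assumes "x \<in> points K" "finite t" "t \<noteq> {}"
  shows "min_weight t x \<noteq> 0 \<longleftrightarrow> t \<subseteq> support x"
proof
  assume "min_weight t x \<noteq> 0"
  then have "0 < min_weight t x" using min_weight_nonneg[OF assms] by simp
  then have "0 < x v" if "v \<in> t" for v using min_weight_le[OF assms(2) that, of x] by linarith
  then show "t \<subseteq> support x" by force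
next
  assume "t \<subseteq> support x"
  moreover obtain v where "v \<in> t" "x v = min_weight t x" by (rule min_weight_attained[OF assms(2,3)])
  ultimately show "min_weight t x \<noteq> 0" by auto
qed

lemma continuous_on_min_weight:
  fixes f :: "'a::topological_space \<Rightarrow> 'v \<Rightarrow> real"
  assumes "finite t" "t \<noteq> {}" "continuous_on S f"
  shows "continuous_on S (\<lambda>x. min_weight t (f x))"
  unfolding min_weight_def using assms
proof (induction rule: finite_ne_induct)
  case (singleton u)
  then show ?case by (simp add: continuous_on_product_then_coordinatewise)
next
  case (insert u t)
  have "Min (f x ` insert u t) = min (f x u) (Min (f x ` t))" for x
    using insert.hyps by simp
  then show ?case using insert by (simp add: continuous_on_min continuous_on_product_then_coordinatewise)
qed

lemma homotopic_with_top_of_setI: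
  assumes "continuous_on ({0..1::real} \<times> A) h" "h ` ({0..1} \<times> A) \<subseteq> B"
    "\<And>x. x \<in> A \<Longrightarrow> h (0, x) = p x" "\<And>x. x \<in> A \<Longrightarrow> h (1, x) = q x"
  shows "homotopic_with (\<lambda>_. True) (top_of_set A) (top_of_set B) p q"
proof -
  have "continuous_map (prod_topology (top_of_set {0..1::real}) (top_of_set A)) (top_of_set B) h"
    using assms(1,2) by (auto simp: image_subset_iff_funcset)
  then show ?thesis using assms(3,4) by (subst homotopic_with) auto
qed

lemma homotopy_equivalent_deformation_retract:
  assumes h: "continuous_on ({0..1::real} \<times> A) h" "h ` ({0..1} \<times> A) \<subseteq> A" and BA: "B \<subseteq> A"
    and h0: "\<And>x. x \<in> A \<Longrightarrow> h (0, x) = x"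
    and h1: "\<And>x. x \<in> A \<Longrightarrow> h (1, x) \<in> B" "\<And>x. x \<in> B \<Longrightarrow> h (1, x) = x"
  shows "top_of_set A homotopy_equivalent_space top_of_set B"
proof (rule deformation_retract_imp_homotopy_equivalent_space)
  let ?r = "\<lambda>x. h (1, x)"
  have "homotopic_with (\<lambda>_. True) (top_of_set A) (top_of_set A) id ?r"
    by (rule homotopic_with_top_of_setI[OF h]) (use h0 in auto)
  then show "homotopic_with (\<lambda>_. True) (top_of_set A) (top_of_set A) ?r id"
    by (rule homotopic_with_symD)
  have "continuous_on A ?r"
    by (rule continuous_on_compose2[OF h(1)]) (auto intro: continuous_intros)
  then show "retraction_maps (top_of_set A) (top_of_set B) ?r id"
    using BA h1 unfolding retraction_maps_def by auto
qed

text \<open>At time 1 no face containing \<open>t\<close> supports the moved point, so the flow ends in the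
  complex without the free pair.\<close>
definition free_face_flow :: "'v set \<Rightarrow> 'v \<Rightarrow> real \<times> ('v \<Rightarrow> real) \<Rightarrow> 'v \<Rightarrow> real" where
  "free_face_flow t v = (\<lambda>(c, x) w. if w \<in> t then x w - c * min_weight t x
     else if w = v then x w + c * min_weight t x * card t else x w)"

lemma free_face_flow_trivial: "c * min_weight t x = 0 \<Longrightarrow> free_face_flow t v (c, x) = x"
  unfolding free_face_flow_def by auto

lemma continuous_on_free_face_flow:
  assumes "finite t" "t \<noteq> {}"
  shows "continuous_on S (free_face_flow t v)"
proof (rule continuous_on_coordinatewise_then_product)
  fix w
  have coord: "continuous_on S (\<lambda>p. snd p w)"
    by (rule continuous_on_product_then_coordinatewise) (rule continuous_on_snd[OF continuous_on_id])
  have min: "continuous_on S (\<lambda>p. min_weight t (snd p))"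
    by (rule continuous_on_min_weight[OF assms continuous_on_snd[OF continuous_on_id]])
  have "continuous_on S (\<lambda>p. snd p w - fst p * min_weight t (snd p))"
    "continuous_on S (\<lambda>p. snd p w + fst p * min_weight t (snd p) * card t)"
    by (intro continuous_intros coord min)+
  then show "continuous_on S (\<lambda>p. free_face_flow t v p w)"
    unfolding free_face_flow_def case_prod_unfold using coord by (cases "w \<in> t"; cases "w = v"; simp)
qed

context
  fixes K :: "'v set set" and t :: "'v set" and v :: 'v
  assumes K: "simplicial_complex K" and t: "free_face K t v" "t \<noteq> {}"
begin

lemma free_face_finite: "finite t"
  by (rule simplicial_complex_finite[OF K free_face_mem(1)[OF t(1)]])

lemma free_face_flow_points:
  assumes x: "x \<in> points K" and c: "c \<in> {0..1}"
  shows "free_face_flow t v (c, x) \<in> points K"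
proof (cases "min_weight t x = 0")
  case True
  then show ?thesis using x by (simp add: free_face_flow_trivial)
next
  case False
  let ?m = "min_weight t x" and ?h = "free_face_flow t v (c, x)"
  have "t \<subseteq> support x" using False min_weight_nonzero_iff[OF x free_face_finite t(2)] by simp
  then have supp: "support x \<subseteq> insert v t"
    using free_face_cases[OF t(1) points_support[OF x]] by blast
  have min_bounds: "0 \<le> ?m" "c * ?m \<le> ?m"
    using min_weight_nonneg[OF x free_face_finite t(2)] c by (auto simp: mult_left_le_one_le)
  show ?thesis
  proof (rule pointsI[OF K free_face_mem(2)[OF t(1)]])
    show "0 \<le> ?h w" for w
      using points_nonneg[OF x, of w] min_bounds c min_weight_le[OF free_face_finite, of w x]
      unfolding free_face_flow_def by auto
    show "?h w = 0" if "w \<notin> insert v t" for w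
      using that supp unfolding free_face_flow_def by auto
    have "sum ?h (insert v t) = (x v + c * ?m * card t) + (\<Sum>w\<in>t. x w - c * ?m)"
      using free_face_finite free_face_notin[OF t(1)] unfolding free_face_flow_def by (simp cong: sum.cong)
    also have "\<dots> = sum x (insert v t)"
      using free_face_finite free_face_notin[OF t(1)] by (simp add: sum_subtractf)
    also have "\<dots> = 1" using free_face_finite by (intro points_sum[OF x _ supp]) simp
    finally show "sum ?h (insert v t) = 1" .
  qed
qed

lemma free_face_flow_end:
  assumes x: "x \<in> points K"
  shows "free_face_flow t v (1, x) \<in> points (K - {t, insert v t})"
proof -
  obtain w where "w \<in> t" "x w = min_weight t x" by (rule min_weight_attained[OF free_face_finite t(2)])
  then have "w \<in> t" "free_face_flow t v (1, x) w = 0" unfolding free_face_flow_def by auto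
  then have "support (free_face_flow t v (1, x)) \<notin> {t, insert v t}" by auto
  then show ?thesis using free_face_flow_points[OF x, of 1] unfolding points_diff_iff by simp
qed

lemma homotopy_equivalent_free_face:
  "geom_realization K homotopy_equivalent_space geom_realization (K - {t, insert v t})"
  unfolding geom_realization_points
proof (rule homotopy_equivalent_deformation_retract)
  show "continuous_on ({0..1} \<times> points K) (free_face_flow t v)"
    by (rule continuous_on_free_face_flow[OF free_face_finite t(2)])
  show "free_face_flow t v ` ({0..1} \<times> points K) \<subseteq> points K"
    using free_face_flow_points by auto
  show "points (K - {t, insert v t}) \<subseteq> points K" by (rule points_mono) auto
  show "free_face_flow t v (0, x) = x" for x by (simp add: free_face_flow_trivial)
  show "free_face_flow t v (1, x) = x" if x: "x \<in> points (K - {t, insert v t})" for x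
  proof -
    have x_points: "x \<in> points K" "support x \<notin> {t, insert v t}"
      using x unfolding points_diff_iff by auto
    then have "\<not> t \<subseteq> support x"
      using free_face_cases[OF t(1) points_support[OF x_points(1)]] by blast
    then have "min_weight t x = 0" using min_weight_nonzero_iff[OF x_points(1) free_face_finite t(2)] by blast
    then show ?thesis by (simp add: free_face_flow_trivial)
  qed
qed (rule free_face_flow_end)

end

lemma homotopy_equivalent_collapses:
  assumes "collapses K L" "simplicial_complex K" "{} \<in> L"
  shows "geom_realization K homotopy_equivalent_space geom_realization L"
  using assms
proof (induction rule: collapses.induct)
  case (refl K)
  then show ?case by (simp add: homotopy_equivalent_space_refl)
next
  case (step K t v L)
  have "t \<noteq> {}" using collapses_subset[OF step.hyps(2)] step.prems(2) by auto
  then have "geom_realization K homotopy_equivalent_space geom_realization (K - {t, insert v t})"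
    by (rule homotopy_equivalent_free_face[OF step.prems(1) step.hyps(1)])
  moreover have "geom_realization (K - {t, insert v t}) homotopy_equivalent_space geom_realization L"
    using step.IH step.prems simplicial_complex_remove_free_face[OF step.prems(1) step.hyps(1)] by auto
  ultimately show ?case by (rule homotopy_eqv_trans)
qed

lemma contractible_space_collapsible:
  assumes "collapsible K" "simplicial_complex K" "K \<noteq> {}"
  shows "contractible_space (geom_realization K) \<and> points K \<noteq> {}"
  using assms
proof (induction K "{} :: 'a set set" rule: collapses.induct)
  case refl
  then show ?case by simp
next
  case (step K t v)
  let ?K' = "K - {t, insert v t}"
  note K' = simplicial_complex_remove_free_face[OF step.prems(1) step.hyps(1)]
  show ?case
  proof (cases "?K' = {}")
    case True
    then have "t = {}" "K = {{}, {v}}"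
      using simplicial_complex_empty[OF step.prems(1)] free_face_mem[OF step.hyps(1)] by auto
    then show ?thesis unfolding geom_realization_points by (simp add: points_single_vertex)
  next
    case False
    then have "{} \<in> ?K'" using simplicial_complex_empty[OF K'] by blast
    then have "t \<noteq> {}" by auto
    have "contractible_space (geom_realization ?K')" "points ?K' \<noteq> {}"
      using step.hyps(3)[OF K' False] by auto
    moreover have "points ?K' \<subseteq> points K" by (rule points_mono) auto
    ultimately show ?thesis
      using homotopy_equivalent_space_contractibility
        [OF homotopy_equivalent_free_face[OF step.prems(1) step.hyps(1) \<open>t \<noteq> {}\<close>]] by auto
  qed
qed

lemma contractible_space_collapses:
  assumes K: "collapsible K" "simplicial_complex K" and L: "collapses K L" "{} \<in> L"
  shows "contractible_space (geom_realization L) \<and> points L \<noteq> {}"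
proof -
  have "K \<noteq> {}" using collapses_subset[OF L(1)] L(2) by auto
  note contractible = contractible_space_collapsible[OF K this]
  note equiv = homotopy_equivalent_collapses[OF L(1) K(2) L(2)]
  then obtain f where "continuous_map (geom_realization K) (geom_realization L) f"
    unfolding homotopy_equivalent_space_def by blast
  then have "f ` points K \<subseteq> points L"
    unfolding geom_realization_points by (simp add: continuous_map_in_subtopology image_subset_iff_funcset)
  then show ?thesis using contractible homotopy_equivalent_space_contractibility[OF equiv] by auto
qed

section \<open>Attaching simplices to a contractible complex\<close>

lemma Hausdorff_space_euclidean_fun: "Hausdorff_space (euclidean :: ('a \<Rightarrow> real) topology)"
  using Hausdorff_space_product_topology[of "\<lambda>_. euclideanreal" "UNIV :: 'a set"]
  by (simp add: euclidean_product_topology)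

definition cell :: "'v set \<Rightarrow> ('v \<Rightarrow> real) set" where
  "cell s = {x. (\<forall>v. 0 \<le> x v) \<and> (\<forall>v\<in>-s. x v = 0) \<and> sum x s = 1}"

lemma closed_cell: "closed (cell s :: ('v \<Rightarrow> real) set)"
proof -
  have continuous_coordinate: "continuous_on UNIV (\<lambda>x :: 'v \<Rightarrow> real. x v)" for v by simp
  have "closed (\<Inter>v. {x :: 'v \<Rightarrow> real. 0 \<le> x v})"
    by (intro closed_INT ballI closed_Collect_le continuous_coordinate continuous_on_const)
  moreover have "closed (\<Inter>v\<in>-s. {x :: 'v \<Rightarrow> real. x v = 0})"
    by (intro closed_INT ballI closed_Collect_eq continuous_coordinate continuous_on_const)
  moreover have "closed {x :: 'v \<Rightarrow> real. sum x s = 1}"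
    by (intro closed_Collect_eq continuous_on_sum continuous_coordinate continuous_on_const)
  ultimately have "closed ((\<Inter>v. {x :: 'v \<Rightarrow> real. 0 \<le> x v}) \<inter> (\<Inter>v\<in>-s. {x. x v = 0}) \<inter> {x. sum x s = 1})"
    by (intro closed_Int)
  moreover have "cell s = (\<Inter>v. {x. 0 \<le> x v}) \<inter> (\<Inter>v\<in>-s. {x. x v = 0}) \<inter> {x. sum x s = 1}"
    unfolding cell_def by auto
  ultimately show ?thesis by simp
qed

lemma cell_subset_cube:
  assumes "finite s"
  shows "cell s \<subseteq> PiE UNIV (\<lambda>_. {0..1})"
proof
  fix x assume x: "x \<in> cell s"
  have "x v \<le> 1" for v
  proof (cases "v \<in> s")
    case True
    then have "x v \<le> sum x s" using x assms by (intro member_le_sum) (auto simp: cell_def)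
    then show ?thesis using x by (simp add: cell_def)
  next
    case False
    then show ?thesis using x by (auto simp: cell_def)
  qed
  then show "x \<in> PiE UNIV (\<lambda>_. {0..1})" using x by (auto simp: cell_def)
qed

lemma compact_cell:
  fixes s :: "'v set"
  assumes "finite s"
  shows "compact (cell s)"
proof -
  let ?Q = "PiE UNIV (\<lambda>_. {0..1}) :: ('v \<Rightarrow> real) set"
  have "compactin (product_topology (\<lambda>_. euclideanreal) UNIV) ?Q"
    by (subst compactin_PiE) auto
  then have "compact ?Q" by (simp add: euclidean_product_topology)
  then have "compact (?Q \<inter> cell s)" using closed_cell by (rule compact_Int_closed)
  then show ?thesis using cell_subset_cube[OF assms] by (simp add: Int_absorb1)
qed

lemma points_eq_cells:
  assumes "simplicial_complex K"
  shows "points K = (\<Union>s\<in>K. cell s)"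
proof
  show "points K \<subseteq> (\<Union>s\<in>K. cell s)" unfolding points_def cell_def by auto
  show "(\<Union>s\<in>K. cell s) \<subseteq> points K"
    using pointsI[OF assms] unfolding cell_def by auto
qed

lemma compact_points: "finite K \<Longrightarrow> simplicial_complex K \<Longrightarrow> compact (points K)"
  unfolding points_eq_cells by (intro compact_UN compact_cell) (auto dest: simplicial_complex_finite)

subsection \<open>Collapsing a contractible subspace\<close>

lemma continuous_on_lift_compact:
  assumes "compact A" "continuous_on A g" "g ` A = W" "Hausdorff_space (top_of_set W)"
    "continuous_on A (f \<circ> g)"
  shows "continuous_on W f"
proof -
  have "quotient_map (top_of_set A) (top_of_set W) g"
    using assms by (intro T1_Spaces.continuous_imp_quotient_map) (auto simp: compact_space_subtopology)
  then show ?thesis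
    using continuous_compose_quotient_map[of "top_of_set A" "top_of_set W" g euclidean f] assms(5) by auto
qed

lemma continuous_on_lift_compact_homotopy:
  fixes g :: "'a::topological_space \<Rightarrow> 'b::topological_space"
  assumes A: "compact A" and g: "continuous_on A g" "g ` A = W" and W: "Hausdorff_space (top_of_set W)"
    and f: "continuous_on ({0..1::real} \<times> A) (\<lambda>p. f (fst p, g (snd p)))"
  shows "continuous_on ({0..1} \<times> W) f"
proof (rule continuous_on_lift_compact)
  let ?g = "\<lambda>p :: real \<times> 'a. (fst p, g (snd p))"
  show "compact ({0..1::real} \<times> A)" using A by (intro compact_Times) auto
  have "continuous_on ({0..1} \<times> A) (\<lambda>p. g (snd p))"
    by (rule continuous_on_compose2[OF g(1) continuous_on_snd[OF continuous_on_id]]) auto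
  then show "continuous_on ({0..1} \<times> A) ?g"
    by (intro continuous_on_Pair continuous_on_fst continuous_on_id)
  show "?g ` ({0..1} \<times> A) = {0..1} \<times> W" using g(2) by (force simp: image_iff)
  have "Hausdorff_space (prod_topology (top_of_set {0..1::real}) (top_of_set W))"
    using W by (subst Hausdorff_space_prod_topology) (auto intro: Hausdorff_space_subtopology)
  then show "Hausdorff_space (top_of_set ({0..1::real} \<times> W))" by simp
  show "continuous_on ({0..1} \<times> A) (f \<circ> ?g)" using f unfolding comp_def .
qed

lemma contractible_space_contraction:
  assumes "contractible_space (top_of_set A)"
  obtains h a where "continuous_on ({0..1::real} \<times> A) h" "\<And>t x. t \<in> {0..1} \<Longrightarrow> x \<in> A \<Longrightarrow> h (t, x) \<in> A"
    "\<And>x. h (0, x) = x" "\<And>x. h (1, x) = a"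
proof -
  obtain a h where "continuous_map (prod_topology (top_of_set {0..1::real}) (top_of_set A)) (top_of_set A) h"
    "\<forall>x. h (0, x) = id x" "\<forall>x. h (1, x) = a"
    using assms unfolding contractible_space_def homotopic_with_def by blast
  then show thesis by (intro that[of h a]) auto
qed

text \<open>Both \<open>H (1, _)\<close> and \<open>g \<circ> H\<close> factor through the quotient map \<open>g\<close>.\<close>
lemma homotopy_equivalent_collapse_contractible:
  fixes A :: "'a::topological_space set" and g :: "'a \<Rightarrow> 'b::topological_space"
  assumes A: "compact A" and g: "continuous_on A g" "g ` A = W"
    and Hausdorff: "Hausdorff_space (euclidean :: 'b topology)"
    and fibre: "\<And>x y. x \<in> A \<Longrightarrow> y \<in> A \<Longrightarrow> g x = g y \<Longrightarrow> x = y \<or> (x \<in> A' \<and> y \<in> A')"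
    and collapse: "\<And>x y. x \<in> A' \<Longrightarrow> y \<in> A' \<Longrightarrow> g x = g y"
    and H: "continuous_on ({0..1::real} \<times> A) H" "\<And>t x. t \<in> {0..1} \<Longrightarrow> x \<in> A \<Longrightarrow> H (t, x) \<in> A"
      "\<And>t x. t \<in> {0..1} \<Longrightarrow> x \<in> A' \<Longrightarrow> H (t, x) \<in> A'"
      "\<And>x. x \<in> A \<Longrightarrow> H (0, x) = x" "\<And>x. x \<in> A' \<Longrightarrow> H (1, x) = a"
  shows "top_of_set A homotopy_equivalent_space top_of_set W"
proof -
  have Hausdorff_W: "Hausdorff_space (top_of_set W)" by (rule Hausdorff_space_subtopology[OF Hausdorff])
  define lift where "lift = inv_into A g"
  have lift: "lift w \<in> A" "g (lift w) = w" if "w \<in> W" for w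
    using that g(2) inv_into_into[of w g A] f_inv_into_f[of w g A] unfolding lift_def by auto
  define f where "f = (\<lambda>w. H (1, lift w))"
  define G where "G = (\<lambda>(t, w). g (H (t, lift w)))"
  have lift_g: "lift (g x) = x \<or> lift (g x) \<in> A' \<and> x \<in> A'" if x: "x \<in> A" for x
    using fibre[of "lift (g x)" x] lift[of "g x"] x g(2) by auto
  have f_g: "f (g x) = H (1, x)" if "x \<in> A" for x
    using lift_g[OF that] H(5) unfolding f_def by auto
  have G_g: "G (t, g x) = g (H (t, x))" if "x \<in> A" "t \<in> {0..1}" for x t
    using lift_g[OF that(1)] collapse[OF H(3)[OF that(2)] H(3)[OF that(2)]] unfolding G_def by auto
  have "continuous_on A (\<lambda>x. H (1, x))"
    by (rule continuous_on_compose2[OF H(1)])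
      (auto intro: continuous_on_Pair[OF continuous_on_const continuous_on_id])
  then have "continuous_on A (f \<circ> g)" using f_g by (simp cong: continuous_on_cong)
  then have continuous_f: "continuous_on W f" by (rule continuous_on_lift_compact[OF A g Hausdorff_W])
  have "continuous_on ({0..1} \<times> A) (\<lambda>p. g (H p))"
    by (rule continuous_on_compose2[OF g(1) H(1)]) (use H(2) in auto)
  moreover have "G (fst p, g (snd p)) = g (H p)" if "p \<in> {0..1} \<times> A" for p
    using that G_g by (cases p) auto
  ultimately have "continuous_on ({0..1} \<times> A) (\<lambda>p. G (fst p, g (snd p)))"
    by (simp cong: continuous_on_cong)
  then have continuous_G: "continuous_on ({0..1} \<times> W) G"
    by (rule continuous_on_lift_compact_homotopy[OF A g Hausdorff_W])
  have "homotopic_with (\<lambda>_. True) (top_of_set A) (top_of_set A) id (f \<circ> g)"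
    by (rule homotopic_with_top_of_setI[OF H(1)]) (use H(2,4) f_g in auto)
  moreover have "homotopic_with (\<lambda>_. True) (top_of_set W) (top_of_set W) id (g \<circ> f)"
    by (rule homotopic_with_top_of_setI[OF continuous_G]) (use H(2,4) lift g(2) in \<open>auto simp: G_def f_def\<close>)
  moreover have "continuous_map (top_of_set A) (top_of_set W) g" using g by auto
  moreover have "continuous_map (top_of_set W) (top_of_set A) f"
    using continuous_f H(2)[OF _ lift(1)] unfolding f_def by auto
  ultimately show ?thesis unfolding homotopy_equivalent_space_def by (blast dest: homotopic_with_symD)
qed

subsection \<open>Homotopy extension\<close>

locale cells_attached =
  fixes K S :: "'v set set"
  assumes finite_complex: "finite K" and complex: "simplicial_complex K"
    and attached_facets: "S \<subseteq> facets K" and attached_nonvoid: "{} \<notin> S"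
begin

lemma finite_attached: "finite S"
  using attached_facets finite_complex unfolding facets_def by (auto intro: finite_subset)

lemma
  assumes "s \<in> S"
  shows attached_mem: "s \<in> K" and attached_finite: "finite s" and attached_nonempty: "s \<noteq> {}"
    and attached_card: "0 < card s" and attached_maximal: "t \<in> K \<Longrightarrow> s \<subseteq> t \<Longrightarrow> t = s"
proof -
  show "s \<in> K" "t \<in> K \<Longrightarrow> s \<subseteq> t \<Longrightarrow> t = s"
    using assms attached_facets unfolding facets_def by auto
  then show "finite s" using simplicial_complex_finite[OF complex] by auto
  show "s \<noteq> {}" using assms attached_nonvoid by auto
  then show "0 < card s" using \<open>finite s\<close> by (simp add: card_gt_0_iff)
qed

lemma simplicial_complex_remaining: "simplicial_complex (K - S)"
  by (rule simplicial_complex_diff_facets[OF complex attached_facets])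

text \<open>A point of the closed cell of \<open>s\<close> is the sum of \<open>weight s x\<close> times the barycentre and a
  vector supported on a proper face.\<close>
definition weight :: "'v set \<Rightarrow> ('v \<Rightarrow> real) \<Rightarrow> real" where
  "weight s x = real (card s) * min_weight s x"

lemma weight_div_card: "s \<in> S \<Longrightarrow> weight s x / card s = min_weight s x"
  unfolding weight_def using attached_card by simp

lemma weight_nonneg: "s \<in> S \<Longrightarrow> x \<in> points K \<Longrightarrow> 0 \<le> weight s x"
  unfolding weight_def using min_weight_nonneg[OF _ attached_finite attached_nonempty] by simp

lemma weight_nonzero_iff:
  assumes "s \<in> S" "x \<in> points K"
  shows "weight s x \<noteq> 0 \<longleftrightarrow> support x = s"
proof -
  have "weight s x \<noteq> 0 \<longleftrightarrow> s \<subseteq> support x"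
    using min_weight_nonzero_iff[OF assms(2) attached_finite attached_nonempty] attached_card assms(1)
    unfolding weight_def by auto
  then show ?thesis using attached_maximal[OF assms(1) points_support[OF assms(2)]] by auto
qed

lemma points_remaining_iff:
  assumes "x \<in> points K"
  shows "x \<in> points (K - S) \<longleftrightarrow> (\<forall>s\<in>S. weight s x = 0)"
  unfolding points_diff_iff using weight_nonzero_iff[OF _ assms] assms by metis

lemma points_cases:
  assumes "x \<in> points K"
  obtains "x \<in> points (K - S)" "\<And>s. s \<in> S \<Longrightarrow> weight s x = 0"
  | s where "s \<in> S" "support x = s" "0 < weight s x" "\<And>s'. s' \<in> S \<Longrightarrow> s' \<noteq> s \<Longrightarrow> weight s' x = 0"
proof (cases "x \<in> points (K - S)")
  case True
  then show ?thesis using that(1) points_remaining_iff[OF assms] by auto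
next
  case False
  then obtain s where s: "s \<in> S" "weight s x \<noteq> 0" using points_remaining_iff[OF assms] by auto
  then have supp: "support x = s" using weight_nonzero_iff[OF _ assms] by auto
  have "weight s' x = 0" if "s' \<in> S" "s' \<noteq> s" for s'
    using weight_nonzero_iff[OF that(1) assms] supp that(2) by auto
  moreover have "0 < weight s x" using s weight_nonneg[OF s(1) assms] by auto
  ultimately show ?thesis using that(2)[OF s(1) supp] by auto
qed

lemma weight_le_1:
  assumes s: "s \<in> S" and x: "x \<in> points K"
  shows "weight s x \<le> 1"
proof (cases "weight s x = 0")
  case False
  then have supp: "support x = s" using weight_nonzero_iff[OF s x] by auto
  have "weight s x = (\<Sum>v\<in>s. min_weight s x)" unfolding weight_def by simp
  also have "\<dots> \<le> sum x s" using min_weight_le[OF attached_finite[OF s]] by (intro sum_mono) auto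
  also have "\<dots> = 1" using supp by (intro points_sum[OF x attached_finite[OF s]]) simp
  finally show ?thesis .
qed auto

lemma continuous_on_weight: "s \<in> S \<Longrightarrow> continuous_on D f \<Longrightarrow> continuous_on D (\<lambda>p. weight s (f p))"
  unfolding weight_def
  by (intro continuous_on_mult continuous_on_const continuous_on_min_weight attached_finite attached_nonempty)

lemma sum_attached_single:
  assumes "s \<in> S" "\<And>s'. s' \<in> S \<Longrightarrow> s' \<noteq> s \<Longrightarrow> F s' = (0::real)"
  shows "sum F S = F s"
proof -
  have "sum F S = sum F {s}" by (rule sum.mono_neutral_right) (use finite_attached assms in auto)
  then show ?thesis by simp
qed

definition total_weight :: "('v \<Rightarrow> real) \<Rightarrow> real" where
  "total_weight x = (\<Sum>s\<in>S. weight s x)"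

definition boundary_part :: "('v \<Rightarrow> real) \<Rightarrow> 'v \<Rightarrow> real" where
  "boundary_part x v = x v - (\<Sum>s\<in>S. if v \<in> s then weight s x / card s else 0)"

text \<open>Radial projection from the barycentre (undefined only at the barycentre itself).\<close>
definition boundary_proj :: "('v \<Rightarrow> real) \<Rightarrow> 'v \<Rightarrow> real" where
  "boundary_proj x v = boundary_part x v / (1 - total_weight x)"

text \<open>Moves \<open>x\<close> radially away from the barycentre by the factor \<open>1 + t\<close>; this stays inside the cell as
  long as \<open>(1 - total_weight x) * (1 + t) \<le> 1\<close>.\<close>
definition push :: "real \<Rightarrow> ('v \<Rightarrow> real) \<Rightarrow> 'v \<Rightarrow> real" where
  "push t x v = (1 + t) * boundary_part x v +
     (\<Sum>s\<in>S. if v \<in> s then max 0 (weight s x - t * (1 - weight s x)) / card s else 0)"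

lemma continuous_on_total_weight: "continuous_on D f \<Longrightarrow> continuous_on D (\<lambda>p. total_weight (f p))"
  unfolding total_weight_def by (intro continuous_on_sum continuous_on_weight)

lemma continuous_on_boundary_part:
  assumes "continuous_on D f"
  shows "continuous_on D (\<lambda>p. boundary_part (f p) v)"
proof -
  have "continuous_on D (\<lambda>p. if v \<in> s then weight s (f p) / card s else 0)" if "s \<in> S" for s
    using continuous_on_weight[OF that assms] attached_card[OF that]
    by (cases "v \<in> s") (auto intro!: continuous_intros)
  then show ?thesis unfolding boundary_part_def
    by (intro continuous_on_diff continuous_on_sum continuous_on_product_then_coordinatewise[OF assms])
qed

lemma continuous_on_boundary_proj:
  assumes "continuous_on D f" "\<And>p. p \<in> D \<Longrightarrow> total_weight (f p) \<noteq> 1"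
  shows "continuous_on D (\<lambda>p. boundary_proj (f p))"
proof (rule continuous_on_coordinatewise_then_product)
  show "continuous_on D (\<lambda>p. boundary_proj (f p) v)" for v
    unfolding boundary_proj_def using assms
    by (intro continuous_on_divide continuous_on_boundary_part continuous_on_diff continuous_on_const
        continuous_on_total_weight) auto
qed

lemma continuous_on_push:
  assumes "continuous_on D f" "continuous_on D \<tau>"
  shows "continuous_on D (\<lambda>p. push (\<tau> p) (f p))"
proof (rule continuous_on_coordinatewise_then_product)
  fix v
  have "continuous_on D (\<lambda>p. if v \<in> s then max 0 (weight s (f p) - \<tau> p * (1 - weight s (f p))) / card s else 0)"
    if "s \<in> S" for s
    using continuous_on_weight[OF that assms(1)] attached_card[OF that] assms(2)
    by (cases "v \<in> s") (auto intro!: continuous_intros)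
  then show "continuous_on D (\<lambda>p. push (\<tau> p) (f p) v)" unfolding push_def
    by (intro continuous_on_add continuous_on_mult continuous_on_sum continuous_on_boundary_part
        continuous_on_const assms) auto
qed

lemma
  assumes "\<And>s. s \<in> S \<Longrightarrow> weight s x = 0"
  shows total_weight_outside: "total_weight x = 0"
    and boundary_proj_outside: "boundary_proj x = x"
    and push_outside: "0 \<le> t \<Longrightarrow> push t x v = (1 + t) * x v"
proof -
  show total: "total_weight x = 0" unfolding total_weight_def using assms by simp
  have "(\<Sum>s\<in>S. if v \<in> s then weight s x / card s else 0) = 0" for v
    by (rule sum.neutral) (use assms in auto)
  then have part: "boundary_part x = x" unfolding boundary_part_def by (auto simp: fun_eq_iff)
  show "boundary_proj x = x" unfolding boundary_proj_def total part by auto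
  assume "0 \<le> t"
  then have "(\<Sum>s\<in>S. if v \<in> s then max 0 (weight s x - t * (1 - weight s x)) / card s else 0) = 0"
    by (intro sum.neutral) (use assms in auto)
  then show "push t x v = (1 + t) * x v" unfolding push_def part by simp
qed

lemma
  assumes "s \<in> S" "\<And>s'. s' \<in> S \<Longrightarrow> s' \<noteq> s \<Longrightarrow> weight s' x = 0"
  shows total_weight_inside: "total_weight x = weight s x"
    and boundary_part_inside: "boundary_part x v = x v - (if v \<in> s then weight s x / card s else 0)"
    and push_inside: "0 \<le> t \<Longrightarrow> push t x v = (1 + t) * boundary_part x v
      + (if v \<in> s then max 0 (weight s x - t * (1 - weight s x)) / card s else 0)"
proof -
  show "total_weight x = weight s x" unfolding total_weight_def by (rule sum_attached_single[OF assms])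
  show "boundary_part x v = x v - (if v \<in> s then weight s x / card s else 0)"
    unfolding boundary_part_def by (subst sum_attached_single[OF assms(1)]) (use assms(2) in auto)
  show "push t x v = (1 + t) * boundary_part x v
    + (if v \<in> s then max 0 (weight s x - t * (1 - weight s x)) / card s else 0)" if "0 \<le> t"
    unfolding push_def by (subst sum_attached_single[OF assms(1)]) (use assms(2) that in auto)
qed

lemma total_weight_bounds:
  assumes x: "x \<in> points K"
  shows "0 \<le> total_weight x" "total_weight x \<le> 1"
proof -
  show "0 \<le> total_weight x" unfolding total_weight_def by (intro sum_nonneg weight_nonneg[OF _ x])
  from x show "total_weight x \<le> 1"
  proof (cases rule: points_cases)
    case 1
    show ?thesis using total_weight_outside[OF 1(2)] by simp
  next
    case (2 s)
    show ?thesis using total_weight_inside[OF 2(1,4)] weight_le_1[OF 2(1) x] by simp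
  qed
qed

lemma
  assumes x: "x \<in> points K" and s: "s \<in> S" "support x = s" "\<And>s'. s' \<in> S \<Longrightarrow> s' \<noteq> s \<Longrightarrow> weight s' x = 0"
  shows sum_boundary_part: "sum (boundary_part x) s = 1 - weight s x"
    and boundary_part_nonneg: "0 \<le> boundary_part x v"
    and boundary_part_support: "v \<notin> s \<Longrightarrow> boundary_part x v = 0"
proof -
  note part = boundary_part_inside[OF s(1,3)]
  have "sum (boundary_part x) s = sum x s - (\<Sum>v\<in>s. weight s x / card s)"
    unfolding sum_subtractf[symmetric] by (rule sum.cong) (auto simp: part)
  also have "\<dots> = 1 - weight s x"
    using points_sum[OF x attached_finite[OF s(1)]] s(2) attached_card[OF s(1)] by simp
  finally show "sum (boundary_part x) s = 1 - weight s x" .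
  show "boundary_part x v = 0" if "v \<notin> s" using part[of v] that s(2) by auto
  show "0 \<le> boundary_part x v"
    using part[of v] min_weight_le[OF attached_finite[OF s(1)], of v x] points_nonneg[OF x, of v]
    by (auto simp: weight_div_card[OF s(1)])
qed

lemma boundary_proj_points:
  assumes x: "x \<in> points K" and inner: "total_weight x < 1"
  shows "boundary_proj x \<in> points (K - S)"
  using x
proof (cases rule: points_cases)
  case 1
  then show ?thesis using boundary_proj_outside[OF 1(2)] by simp
next
  case (2 s)
  note sum_part = sum_boundary_part[OF x 2(1,2,4)] and nonneg = boundary_part_nonneg[OF x 2(1,2,4)]
    and supp = boundary_part_support[OF x 2(1,2,4)]
  obtain w where w: "w \<in> s" "x w = min_weight s x"
    by (rule min_weight_attained[OF attached_finite[OF 2(1)] attached_nonempty[OF 2(1)]])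
  let ?s' = "s - {w}"
  have vanish: "boundary_part x w = 0"
    using boundary_part_inside[OF 2(1,4), of w] w by (simp add: weight_div_card[OF 2(1)])
  have "?s' \<in> K" using simplicial_complex_subset[OF complex attached_mem[OF 2(1)]] by auto
  moreover have "?s' \<notin> S" using attached_maximal[of ?s' s] attached_mem[OF 2(1)] w by auto
  ultimately have s': "?s' \<in> K - S" by auto
  show ?thesis
  proof (rule pointsI[OF simplicial_complex_remaining s'])
    show "0 \<le> boundary_proj x v" for v unfolding boundary_proj_def using nonneg[of v] inner by simp
    show "boundary_proj x v = 0" if "v \<notin> ?s'" for v
      unfolding boundary_proj_def using supp[of v] vanish that by (cases "v = w") auto
    have "sum (boundary_part x) s = boundary_part x w + sum (boundary_part x) ?s'"
      using attached_finite[OF 2(1)] w(1) by (simp add: sum.remove)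
    then have "sum (boundary_part x) ?s' = 1 - total_weight x"
      using sum_part vanish total_weight_inside[OF 2(1,4)] by simp
    then show "sum (boundary_proj x) ?s' = 1"
      unfolding boundary_proj_def sum_divide_distrib[symmetric] using inner by simp
  qed
qed

lemma push_points:
  assumes x: "x \<in> points K" and t: "0 \<le> t" and inner: "(1 - total_weight x) * (1 + t) \<le> 1"
  shows "push t x \<in> points K"
  using x
proof (cases rule: points_cases)
  case 1
  then have "t = 0" using total_weight_outside[OF 1(2)] inner t by simp
  then have "push t x = x" using push_outside[OF 1(2) t] by auto
  then show ?thesis using x by simp
next
  case (2 s)
  let ?w = "weight s x"
  have weight_eq: "max 0 (?w - t * (1 - ?w)) = ?w - t * (1 - ?w)"
    using inner total_weight_inside[OF 2(1,4)] by (simp add: algebra_simps)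
  have push_eq: "push t x v = (1 + t) * boundary_part x v + (if v \<in> s then max 0 (?w - t * (1 - ?w)) / card s else 0)" for v
    by (rule push_inside[OF 2(1,4) t])
  show ?thesis
  proof (rule pointsI[OF complex attached_mem[OF 2(1)]])
    show "0 \<le> push t x v" for v
      unfolding push_eq using boundary_part_nonneg[OF x 2(1,2,4), of v] t by auto
    show "push t x v = 0" if "v \<notin> s" for v
      unfolding push_eq using boundary_part_support[OF x 2(1,2,4)] that by simp
    have "sum (push t x) s = (1 + t) * sum (boundary_part x) s + (\<Sum>v\<in>s. max 0 (?w - t * (1 - ?w)) / card s)"
      unfolding sum_distrib_left sum.distrib[symmetric] by (rule sum.cong) (auto simp: push_eq)
    also have "\<dots> = (1 + t) * (1 - ?w) + (?w - t * (1 - ?w))"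
      unfolding weight_eq using sum_boundary_part[OF x 2(1,2,4)] attached_card[OF 2(1)] by simp
    also have "\<dots> = 1" by (simp add: algebra_simps)
    finally show "sum (push t x) s = 1" .
  qed
qed

lemma push_zero:
  assumes "x \<in> points K"
  shows "push 0 x = x"
  using assms
proof (cases rule: points_cases)
  case 1
  then show ?thesis using push_outside[OF 1(2), of 0] by auto
next
  case (2 s)
  then show ?thesis
    using push_inside[OF 2(1,4), of 0] boundary_part_inside[OF 2(1,4)] by (auto simp: fun_eq_iff)
qed

lemma push_eq_boundary_proj:
  assumes x: "x \<in> points K" and t: "0 \<le> t" and boundary: "(1 - total_weight x) * (1 + t) = 1"
  shows "push t x = boundary_proj x"
  using x
proof (cases rule: points_cases)
  case 1
  then have "t = 0" using total_weight_outside[OF 1(2)] boundary by simp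
  then show ?thesis using push_zero[OF x] boundary_proj_outside[OF 1(2)] by simp
next
  case (2 s)
  have "weight s x - t * (1 - weight s x) = 0"
    using boundary total_weight_inside[OF 2(1,4)] by (simp add: algebra_simps)
  then have "push t x v = (1 + t) * boundary_part x v" for v using push_inside[OF 2(1,4) t, of v] by simp
  moreover have "1 - total_weight x \<noteq> 0" using boundary by auto
  then have "1 + t = 1 / (1 - total_weight x)" using boundary by (simp add: field_simps)
  ultimately show ?thesis unfolding boundary_proj_def by (auto simp: fun_eq_iff)
qed

definition push_radius :: "real \<times> ('v \<Rightarrow> real) \<Rightarrow> real" where
  "push_radius p = (1 - total_weight (snd p)) * (1 + fst p)"

definition extend_homotopy ::
  "(real \<times> ('v \<Rightarrow> real) \<Rightarrow> 'v \<Rightarrow> real) \<Rightarrow> real \<times> ('v \<Rightarrow> real) \<Rightarrow> 'v \<Rightarrow> real" where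
  "extend_homotopy h p =
    (if push_radius p \<le> 1 then push (fst p) (snd p) else h (push_radius p - 1, boundary_proj (snd p)))"

lemma continuous_on_push_radius: "continuous_on D push_radius"
  unfolding push_radius_def
  by (intro continuous_on_mult continuous_on_diff continuous_on_add continuous_on_const
      continuous_on_total_weight continuous_on_fst continuous_on_snd continuous_on_id)

lemma
  assumes p: "p \<in> {0..1} \<times> points K" and outer: "1 \<le> push_radius p"
  shows push_radius_range: "push_radius p - 1 \<in> {0..1}"
    and total_weight_less_1: "total_weight (snd p) < 1"
proof -
  have t: "0 \<le> fst p" "fst p \<le> 1" and w: "0 \<le> total_weight (snd p)" "total_weight (snd p) \<le> 1"
    using p total_weight_bounds[of "snd p"] by auto
  have "push_radius p \<le> 1 * 2" unfolding push_radius_def using t w by (intro mult_mono) auto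
  then show "push_radius p - 1 \<in> {0..1}" using outer by auto
  have "total_weight (snd p) \<noteq> 1" using outer unfolding push_radius_def by auto
  then show "total_weight (snd p) < 1" using w by auto
qed

context
  fixes h :: "real \<times> ('v \<Rightarrow> real) \<Rightarrow> ('v \<Rightarrow> real)"
  assumes h: "continuous_on ({0..1} \<times> points (K - S)) h"
    "\<And>t x. t \<in> {0..1} \<Longrightarrow> x \<in> points (K - S) \<Longrightarrow> h (t, x) \<in> points (K - S)"
    "\<And>x. x \<in> points (K - S) \<Longrightarrow> h (0, x) = x"
begin

lemma continuous_on_extend_homotopy: "continuous_on ({0..1} \<times> points K) (extend_homotopy h)"
  unfolding extend_homotopy_def
proof (rule continuous_on_cases_le[OF _ _ continuous_on_push_radius])
  let ?D = "{0..1} \<times> points K"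
  let ?E = "{p \<in> ?D. 1 \<le> push_radius p}"
  show "continuous_on {p \<in> ?D. push_radius p \<le> 1} (\<lambda>p. push (fst p) (snd p))"
    by (intro continuous_on_push continuous_on_fst continuous_on_snd continuous_on_id)
  have "continuous_on ?E (\<lambda>p. boundary_proj (snd p))"
  proof (rule continuous_on_boundary_proj[OF continuous_on_snd[OF continuous_on_id]])
    show "total_weight (snd p) \<noteq> 1" if "p \<in> ?E" for p using total_weight_less_1[of p] that by auto
  qed
  then have "continuous_on ?E (\<lambda>p. (push_radius p - 1, boundary_proj (snd p)))"
    by (intro continuous_on_Pair continuous_on_diff continuous_on_push_radius continuous_on_const)
  moreover have "(push_radius p - 1, boundary_proj (snd p)) \<in> {0..1} \<times> points (K - S)" if "p \<in> ?E" for p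
  proof -
    have p: "p \<in> ?D" "1 \<le> push_radius p" "snd p \<in> points K" using that by auto
    show ?thesis
      using push_radius_range[OF p(1,2)] boundary_proj_points[OF p(3) total_weight_less_1[OF p(1,2)]] by simp
  qed
  ultimately show "continuous_on ?E (\<lambda>p. h (push_radius p - 1, boundary_proj (snd p)))"
    by (intro continuous_on_compose2[OF h(1)]) auto
  fix p assume p: "p \<in> ?D" "push_radius p = 1"
  then have inner: "total_weight (snd p) < 1" and x: "snd p \<in> points K" "0 \<le> fst p"
    using total_weight_less_1[OF p(1)] by auto
  then show "push (fst p) (snd p) = h (push_radius p - 1, boundary_proj (snd p))"
    using push_eq_boundary_proj[OF x] h(3)[OF boundary_proj_points[OF x(1) inner]] p(2)
    unfolding push_radius_def by simp
qed

lemma extend_homotopy_points: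
  assumes t: "t \<in> {0..1}" and x: "x \<in> points K"
  shows "extend_homotopy h (t, x) \<in> points K"
proof (cases "push_radius (t, x) \<le> 1")
  case True
  then show ?thesis using push_points[OF x, of t] t unfolding extend_homotopy_def push_radius_def by auto
next
  case False
  then have "push_radius (t, x) - 1 \<in> {0..1}" "total_weight x < 1"
    using push_radius_range[of "(t, x)"] total_weight_less_1[of "(t, x)"] t x by auto
  then have "h (push_radius (t, x) - 1, boundary_proj x) \<in> points (K - S)"
    by (rule h(2)[OF _ boundary_proj_points[OF x]])
  then show ?thesis using False unfolding extend_homotopy_def points_diff_iff by auto
qed

lemma extend_homotopy_start: "x \<in> points K \<Longrightarrow> extend_homotopy h (0, x) = x"
  using total_weight_bounds[of x] push_zero[of x] unfolding extend_homotopy_def push_radius_def by simp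

lemma extend_homotopy_extends:
  assumes t: "t \<in> {0..1}" and x: "x \<in> points (K - S)"
  shows "extend_homotopy h (t, x) = h (t, x)"
proof -
  have x_points: "x \<in> points K" using x unfolding points_diff_iff by simp
  then have outside: "\<And>s. s \<in> S \<Longrightarrow> weight s x = 0"
    using points_remaining_iff x by auto
  show ?thesis
    using t push_zero[OF x_points] h(3)[OF x] total_weight_outside[OF outside] boundary_proj_outside[OF outside]
    unfolding extend_homotopy_def push_radius_def by auto
qed

end

end

subsection \<open>The map to the wedge of spheres\<close>

definition wedge_points :: "int list \<Rightarrow> (nat \<times> nat \<Rightarrow> real) set" where
  "wedge_points ds = (if ds = [] then {\<lambda>_. 0} else {}) \<union> (\<Union>k<length ds. wedge_sphere k (ds ! k))"

lemma wedge_of_spheres_points: "wedge_of_spheres ds = top_of_set (wedge_points ds)"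
  unfolding wedge_of_spheres_def wedge_points_def ..

lemma sum_lessThan_Suc_0:
  fixes f :: "nat \<Rightarrow> real"
  assumes "0 < c"
  shows "sum f {..<c} = f 0 + sum f {1..<c}"
  using sum.atLeast_Suc_lessThan[OF assms, of f] by (simp add: atLeast0LessThan)

lemma wedge_sphere_iff:
  assumes "0 < c"
  shows "w \<in> wedge_sphere k (int c - 1) \<longleftrightarrow> (\<forall>a i. (a \<noteq> k \<or> i \<ge> c) \<longrightarrow> w (a, i) = 0) \<and>
    (w (k, 0) - 1)\<^sup>2 + (\<Sum>i\<in>{1..<c}. (w (k, i))\<^sup>2) = 1"
proof -
  have "{i. int i \<le> int c - 1} = {..<c}" by auto
  moreover have "(\<Sum>i\<in>{..<c}. (w (k, i) - (if i = 0 then 1 else 0))\<^sup>2) =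
    (w (k, 0) - 1)\<^sup>2 + (\<Sum>i\<in>{1..<c}. (w (k, i))\<^sup>2)"
    unfolding sum_lessThan_Suc_0[OF assms] by (auto intro!: sum.cong)
  moreover have "int i > int c - 1 \<longleftrightarrow> i \<ge> c" for i by auto
  ultimately show ?thesis using assms unfolding wedge_sphere_def by simp
qed

lemma zero_in_wedge_sphere: "0 < c \<Longrightarrow> (\<lambda>_. 0) \<in> wedge_sphere k (int c - 1)"
  by (simp add: wedge_sphere_iff)

text \<open>Inverse stereographic projection from the origin.\<close>
lemma wedge_sphere_stereographic:
  assumes c: "0 < c" and supp: "\<And>a i. a \<noteq> k \<or> i \<ge> c \<Longrightarrow> w (a, i) = 0"
    and w0: "w (k, 0) = 2 / (1 + (\<Sum>i\<in>{1..<c}. (u i)\<^sup>2))"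
    and wi: "\<And>i. i \<in> {1..<c} \<Longrightarrow> w (k, i) = w (k, 0) * u i"
  shows "w \<in> wedge_sphere k (int c - 1)"
proof -
  let ?N = "\<Sum>i\<in>{1..<c}. (u i)\<^sup>2"
  have norm_nonneg: "0 \<le> ?N" by (intro sum_nonneg) auto
  have "(\<Sum>i\<in>{1..<c}. (w (k, i))\<^sup>2) = (w (k, 0))\<^sup>2 * ?N"
    unfolding sum_distrib_left by (rule sum.cong) (auto simp: wi power_mult_distrib)
  moreover have "(2 / d - 1)\<^sup>2 + (2 / d)\<^sup>2 * (d - 1) = 1" if "0 < d" for d :: real
    using that by (simp add: field_simps power2_eq_square)
  from this[of "1 + ?N"] have "(2 / (1 + ?N) - 1)\<^sup>2 + (2 / (1 + ?N))\<^sup>2 * ?N = 1"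
    using norm_nonneg by simp
  ultimately show ?thesis using supp unfolding wedge_sphere_iff[OF c] w0 by simp
qed

lemma
  assumes c: "0 < c" and w: "w \<in> wedge_sphere k (int c - 1)" "w \<noteq> (\<lambda>_. 0)"
  shows wedge_sphere_pos: "0 < w (k, 0)"
    and wedge_sphere_height: "w (k, 0) = 2 / (1 + (\<Sum>i\<in>{1..<c}. (w (k, i) / w (k, 0))\<^sup>2))"
proof -
  let ?a = "w (k, 0)" and ?T = "\<Sum>i\<in>{1..<c}. (w (k, i))\<^sup>2"
  have supp: "\<And>a i. a \<noteq> k \<or> i \<ge> c \<Longrightarrow> w (a, i) = 0" and sphere: "(?a - 1)\<^sup>2 + ?T = 1"
    using w(1) wedge_sphere_iff[OF c, of w k] by auto
  have tail_eq: "?T = 2 * ?a - ?a\<^sup>2" using sphere by (simp add: power2_eq_square algebra_simps)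
  have tail_nonneg: "0 \<le> ?T" by (intro sum_nonneg) auto
  show pos: "0 < ?a"
  proof (rule ccontr)
    assume "\<not> 0 < ?a"
    then have "?a\<^sup>2 \<le> 0" using tail_eq tail_nonneg by linarith
    then have "?a = 0" by simp
    then have "?T = 0" using tail_eq by simp
    then have "w (k, i) = 0" if "i < c" for i
      using that \<open>?a = 0\<close> by (cases "i = 0") (auto simp: sum_nonneg_eq_0_iff)
    then have "w (a, i) = 0" for a i using supp[of a i] by (cases "a = k \<and> i < c") auto
    then show False using w(2) by auto
  qed
  have "(\<Sum>i\<in>{1..<c}. (w (k, i) / ?a)\<^sup>2) = ?T / ?a\<^sup>2"
    by (simp add: power_divide sum_divide_distrib)
  also have "\<dots> = 2 / ?a - 1" unfolding tail_eq using pos by (simp add: field_simps power2_eq_square)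
  finally show "?a = 2 / (1 + (\<Sum>i\<in>{1..<c}. (w (k, i) / ?a)\<^sup>2))" using pos by simp
qed

lemma min_weight_affine:
  assumes t: "finite t" "t \<noteq> {}" and b: "0 \<le> b" and y: "\<And>v. v \<in> t \<Longrightarrow> y v = a + b * x v"
  shows "min_weight t y = a + b * min_weight t x"
proof -
  obtain u where "u \<in> t" "x u = min_weight t x" by (rule min_weight_attained[OF t])
  then have "a + b * min_weight t x \<in> y ` t" using y[of u] by (metis image_eqI)
  moreover have "a + b * min_weight t x \<le> y v" if "v \<in> t" for v
    using y[OF that] min_weight_le[OF t(1) that] b by (simp add: mult_left_mono)
  ultimately show ?thesis unfolding min_weight_def[of t y] using t(1) by (intro Min_eqI) auto
qed

locale cells_attached_list = cells_attached K S for K S :: "'v set set" +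
  fixes ss :: "'v set list"
  assumes distinct_ss: "distinct ss" and set_ss: "set ss = S"
begin

definition nth_vertex :: "'v set \<Rightarrow> nat \<Rightarrow> 'v" where
  "nth_vertex s = (SOME f. bij_betw f {..<card s} s)"

lemma bij_betw_nth_vertex: "s \<in> S \<Longrightarrow> bij_betw (nth_vertex s) {..<card s} s"
  unfolding nth_vertex_def using attached_finite[of s] ex_bij_betw_nat_finite[of s]
  by (intro someI_ex[of "\<lambda>f. bij_betw f {..<card s} s"]) (auto simp: atLeast0LessThan)

lemma nth_attached: "k < length ss \<Longrightarrow> ss ! k \<in> S"
  using set_ss by auto

lemma attached_nth: "s \<in> S \<Longrightarrow> \<exists>k<length ss. s = ss ! k"
  using set_ss by (metis in_set_conv_nth)

lemma sum_nth_vertex: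
  fixes f :: "'v \<Rightarrow> real"
  assumes "s \<in> S"
  shows "sum f s = f (nth_vertex s 0) + (\<Sum>i\<in>{1..<card s}. f (nth_vertex s i))"
  using sum.reindex_bij_betw[OF bij_betw_nth_vertex[OF assms], of f]
    sum_lessThan_Suc_0[OF attached_card[OF assms], of "\<lambda>i. f (nth_vertex s i)"]
  by simp

lemma nth_vertex_cases:
  assumes "s \<in> S" "v \<in> s"
  obtains "v = nth_vertex s 0" | i where "i \<in> {1..<card s}" "v = nth_vertex s i"
proof -
  obtain i where i: "i < card s" "v = nth_vertex s i"
    using bij_betw_imp_surj_on[OF bij_betw_nth_vertex[OF assms(1)]] assms(2) by force
  show thesis using that(1) that(2)[of i] i by (cases "i = 0") auto
qed

text \<open>On the open cell of \<open>s\<close>, \<open>direction s\<close> is a homeomorphism onto the vectors on \<open>s\<close> with sum zero.\<close>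
definition direction :: "'v set \<Rightarrow> ('v \<Rightarrow> real) \<Rightarrow> 'v \<Rightarrow> real" where
  "direction s x v = (x v - 1 / card s) / weight s x"

lemma sum_direction:
  assumes "s \<in> S" "sum x s = 1"
  shows "sum (direction s x) s = 0"
  using assms(2) attached_card[OF assms(1)]
  unfolding direction_def sum_divide_distrib[symmetric] by (simp add: sum_subtractf)

lemma min_weight_direction:
  assumes s: "s \<in> S" and pos: "0 < weight s x"
  shows "min_weight s (direction s x) = (1 - 1 / weight s x) / card s"
proof -
  have "min_weight s (direction s x)
    = - 1 / (card s * weight s x) + 1 / weight s x * min_weight s x"
    using pos attached_card[OF s]
    by (intro min_weight_affine attached_finite[OF s] attached_nonempty[OF s])
      (auto simp: direction_def field_simps)
  also have "min_weight s x = weight s x / card s" by (rule weight_div_card[OF s, symmetric])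
  finally show ?thesis using pos attached_card[OF s] by (simp add: field_simps)
qed

lemma direction_inj:
  assumes s: "s \<in> S" and x: "support x = s" "0 < weight s x" and y: "support y = s" "0 < weight s y"
    and eq: "\<And>v. v \<in> s \<Longrightarrow> direction s x v = direction s y v"
  shows "x = y"
proof
  fix v
  have "min_weight s (direction s x) = min_weight s (direction s y)"
    unfolding min_weight_def using eq by (simp cong: image_cong)
  then have weight: "weight s x = weight s y"
    using x(2) y(2) attached_card[OF s]
    unfolding min_weight_direction[OF s x(2)] min_weight_direction[OF s y(2)] by simp
  show "x v = y v"
  proof (cases "v \<in> s")
    case True
    then show ?thesis using eq[OF True] weight x(2) unfolding direction_def by simp
  next
    case False
    then have "v \<notin> support x" "v \<notin> support y" unfolding x(1) y(1) by simp_all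
    then show ?thesis by simp
  qed
qed

lemma direction_surj:
  assumes s: "s \<in> S" and u: "sum u s = 0"
  shows "\<exists>x\<in>points K. support x = s \<and> (\<forall>v\<in>s. direction s x v = u v)"
proof -
  define c where "c = real (card s)"
  define L where "L = 1 / (1 - c * min_weight s u)"
  define x where "x = (\<lambda>v. if v \<in> s then 1 / c + L * u v else 0)"
  note s' = attached_finite[OF s] attached_nonempty[OF s]
  have c: "0 < c" using attached_card[OF s] unfolding c_def by simp
  have "c * min_weight s u = (\<Sum>v\<in>s. min_weight s u)" unfolding c_def by simp
  also have "\<dots> \<le> 0" unfolding u[symmetric] using min_weight_le[OF s'(1)] by (intro sum_mono) auto
  finally have scale_pos: "0 < 1 - c * min_weight s u" by simp
  then have L: "0 < L" unfolding L_def by simp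
  have "min_weight s x = 1 / c + L * min_weight s u"
    using L by (intro min_weight_affine s') (auto simp: x_def)
  also have "\<dots> = L / c" unfolding L_def using c scale_pos by (simp add: field_simps)
  finally have min: "min_weight s x = L / c" .
  then have weight: "weight s x = L" unfolding weight_def c_def[symmetric] using c by simp
  have pos: "0 < x v" if "v \<in> s" for v
    using min_weight_le[OF s'(1) that, of x] divide_pos_pos[OF L c] unfolding min by linarith
  have "sum x s = (\<Sum>v\<in>s. 1 / c + L * u v)" by (rule sum.cong) (auto simp: x_def)
  also have "\<dots> = 1" using u c unfolding c_def by (simp add: sum.distrib sum_distrib_left[symmetric])
  finally have "sum x s = 1" .
  moreover have "0 \<le> x v" for v using pos[of v] by (cases "v \<in> s") (auto simp: x_def)
  ultimately have "x \<in> points K" by (intro pointsI[OF complex attached_mem[OF s]]) (auto simp: x_def)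
  moreover have "support x = s" using pos by (force simp: x_def)
  moreover have "direction s x v = u v" if "v \<in> s" for v
    using that L unfolding direction_def weight c_def[symmetric] by (simp add: x_def)
  ultimately show ?thesis by blast
qed

definition sqdist :: "'v set \<Rightarrow> ('v \<Rightarrow> real) \<Rightarrow> real" where
  "sqdist s x = (\<Sum>i\<in>{1..<card s}. (x (nth_vertex s i) - 1 / card s)\<^sup>2)"

text \<open>The last summand vanishes on the cell of \<open>s\<close>; it keeps the denominator positive elsewhere.\<close>
definition denom :: "'v set \<Rightarrow> ('v \<Rightarrow> real) \<Rightarrow> real" where
  "denom s x = (weight s x)\<^sup>2 + sqdist s x + (1 - sum x s)"

text \<open>On the cell of \<open>s\<close> this is \<open>direction s\<close>, in the coordinates given by all but one vertex, followed
  by inverse stereographic projection.\<close>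
definition wedge_map :: "('v \<Rightarrow> real) \<Rightarrow> nat \<times> nat \<Rightarrow> real" where
  "wedge_map x = (\<lambda>(k, i). if k < length ss \<and> i < card (ss ! k)
     then 2 * weight (ss ! k) x *
       (if i = 0 then weight (ss ! k) x else x (nth_vertex (ss ! k) i) - 1 / card (ss ! k)) / denom (ss ! k) x
     else 0)"

lemma sum_le_1:
  assumes "s \<in> S" "x \<in> points K"
  shows "sum x s \<le> 1"
proof -
  have fin: "finite (support x)" by (rule simplicial_complex_finite[OF complex points_support[OF assms(2)]])
  have "sum x s \<le> sum x (s \<union> support x)"
    using points_nonneg[OF assms(2)] attached_finite[OF assms(1)] fin by (intro sum_mono2) auto
  then show ?thesis
    using points_sum[OF assms(2), of "s \<union> support x"] attached_finite[OF assms(1)] fin by auto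
qed

lemma barycentre_weight:
  assumes s: "s \<in> S" and x: "sqdist s x = 0" "sum x s = 1"
  shows "weight s x = 1"
proof -
  have card_pos: "real (card s) > 0" using attached_card[OF s] by simp
  have others: "x (nth_vertex s i) = 1 / card s" if "i \<in> {1..<card s}" for i
    using x(1) that unfolding sqdist_def by (subst (asm) sum_nonneg_eq_0_iff) auto
  have "x (nth_vertex s 0) = 1 - (\<Sum>i\<in>{1..<card s}. x (nth_vertex s i))"
    using x(2) sum_nth_vertex[OF s, of x] by simp
  also have "\<dots> = 1 - (real (card s) - 1) / card s"
    using others attached_card[OF s] by (simp add: of_nat_diff)
  also have "\<dots> = 1 / card s" using card_pos by (simp add: field_simps)
  finally have first: "x (nth_vertex s 0) = 1 / card s" .
  have const: "x v = 1 / card s" if "v \<in> s" for v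
    using s that by (cases rule: nth_vertex_cases) (auto simp: first others)
  obtain v where "v \<in> s" "x v = min_weight s x"
    by (rule min_weight_attained[OF attached_finite[OF s] attached_nonempty[OF s]])
  then have "min_weight s x = 1 / card s" using const by simp
  then show ?thesis using card_pos unfolding weight_def by simp
qed

lemma denom_pos:
  assumes "s \<in> S" "x \<in> points K"
  shows "0 < denom s x"
proof (rule ccontr)
  assume "\<not> 0 < denom s x"
  moreover have "0 \<le> sqdist s x" unfolding sqdist_def by (intro sum_nonneg) auto
  ultimately have "(weight s x)\<^sup>2 = 0" "sqdist s x = 0" "sum x s = 1"
    using sum_le_1[OF assms] zero_le_power2[of "weight s x"] unfolding denom_def by linarith+
  then show False using barycentre_weight[OF assms(1)] by simp
qed

lemma continuous_on_wedge_map: "continuous_on (points K) wedge_map"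
proof (rule continuous_on_coordinatewise_then_product)
  fix p :: "nat \<times> nat"
  obtain k i where p: "p = (k, i)" by (cases p)
  show "continuous_on (points K) (\<lambda>x. wedge_map x p)"
  proof (cases "k < length ss \<and> i < card (ss ! k)")
    case False
    then have "wedge_map x p = 0" for x unfolding wedge_map_def p by auto
    then show ?thesis by simp
  next
    case True
    let ?s = "ss ! k"
    have s: "?s \<in> S" using True nth_attached by simp
    have coord: "continuous_on (points K) (\<lambda>x. x v)" for v
      by (rule continuous_on_subset[OF continuous_on_product_coordinates]) auto
    have weight: "continuous_on (points K) (weight ?s)" by (rule continuous_on_weight[OF s continuous_on_id])
    have "continuous_on (points K) (denom ?s)"
      unfolding denom_def sqdist_def
      by (intro continuous_on_add continuous_on_diff continuous_on_sum continuous_on_power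
          continuous_on_const weight coord)
    moreover have "\<forall>x\<in>points K. denom ?s x \<noteq> 0" using denom_pos[OF s] by force
    moreover have "continuous_on (points K) (\<lambda>x. if i = 0 then weight ?s x else x (nth_vertex ?s i) - 1 / card ?s)"
      using weight coord by (cases "i = 0") (auto intro!: continuous_intros)
    ultimately have "continuous_on (points K) (\<lambda>x. 2 * weight ?s x *
        (if i = 0 then weight ?s x else x (nth_vertex ?s i) - 1 / card ?s) / denom ?s x)"
      using weight by (intro continuous_on_divide continuous_on_mult continuous_on_const)
    then show ?thesis unfolding wedge_map_def p using True by simp
  qed
qed

lemma wedge_map_remaining:
  assumes "x \<in> points (K - S)"
  shows "wedge_map x = (\<lambda>_. 0)"
proof -
  have "x \<in> points K" using assms unfolding points_diff_iff by simp
  then have "\<forall>s\<in>S. weight s x = 0" using points_remaining_iff assms by auto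
  then show ?thesis using nth_attached unfolding wedge_map_def by (auto simp: fun_eq_iff)
qed

lemma
  assumes x: "x \<in> points K" and k: "k < length ss" and supp: "support x = ss ! k"
  shows wedge_map_height: "wedge_map x (k, 0)
      = 2 / (1 + (\<Sum>i\<in>{1..<card (ss ! k)}. (direction (ss ! k) x (nth_vertex (ss ! k) i))\<^sup>2))"
    and wedge_map_coordinate: "i \<in> {1..<card (ss ! k)} \<Longrightarrow>
      wedge_map x (k, i) = wedge_map x (k, 0) * direction (ss ! k) x (nth_vertex (ss ! k) i)"
    and wedge_map_other: "a \<noteq> k \<or> i \<ge> card (ss ! k) \<Longrightarrow> wedge_map x (a, i) = 0"
    and wedge_map_weight: "0 < weight (ss ! k) x"
proof -
  let ?s = "ss ! k"
  have s: "?s \<in> S" by (rule nth_attached[OF k])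
  let ?N = "\<Sum>i\<in>{1..<card ?s}. (direction ?s x (nth_vertex ?s i))\<^sup>2"
  have "weight ?s x \<noteq> 0" using weight_nonzero_iff[OF s x] supp by auto
  then show pos: "0 < weight ?s x" using weight_nonneg[OF s x] by auto
  have "sqdist ?s x = (\<Sum>i\<in>{1..<card ?s}. (weight ?s x)\<^sup>2 * (direction ?s x (nth_vertex ?s i))\<^sup>2)"
    unfolding sqdist_def direction_def using pos by (intro sum.cong) (auto simp: power_divide)
  moreover have "sum x ?s = 1" using points_sum[OF x attached_finite[OF s]] supp by auto
  ultimately have denom: "denom ?s x = (weight ?s x)\<^sup>2 * (1 + ?N)"
    unfolding denom_def by (simp add: sum_distrib_left distrib_left)
  show height: "wedge_map x (k, 0) = 2 / (1 + ?N)"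
    using k attached_card[OF s] pos denom unfolding wedge_map_def by (simp add: power2_eq_square)
  show "wedge_map x (k, i) = wedge_map x (k, 0) * direction ?s x (nth_vertex ?s i)" if "i \<in> {1..<card ?s}"
    using k pos denom that unfolding height unfolding wedge_map_def direction_def
    by (simp add: power2_eq_square)
  have "weight (ss ! a) x = 0" if "a < length ss" "a \<noteq> k" for a
  proof -
    have "ss ! a \<noteq> ?s" using that k distinct_ss nth_eq_iff_index_eq by blast
    then show ?thesis using weight_nonzero_iff[OF nth_attached[OF that(1)] x] supp by auto
  qed
  then show "a \<noteq> k \<or> i \<ge> card ?s \<Longrightarrow> wedge_map x (a, i) = 0"
    unfolding wedge_map_def by (cases "a = k") auto
qed

lemma wedge_map_height_pos:
  assumes "x \<in> points K" "k < length ss" "support x = ss ! k"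
  shows "0 < wedge_map x (k, 0)"
  unfolding wedge_map_height[OF assms] by (intro divide_pos_pos add_pos_nonneg sum_nonneg) auto

lemma wedge_map_sphere:
  assumes x: "x \<in> points K" "k < length ss" "support x = ss ! k"
  shows "wedge_map x \<in> wedge_sphere k (int (card (ss ! k)) - 1)"
  by (rule wedge_sphere_stereographic[OF attached_card[OF nth_attached[OF x(2)]]
        wedge_map_other[OF x] wedge_map_height[OF x] wedge_map_coordinate[OF x]])

lemma wedge_map_inj:
  assumes x: "x \<in> points K" and y: "y \<in> points K" and eq: "wedge_map x = wedge_map y"
    and nx: "x \<notin> points (K - S)"
  shows "x = y"
proof -
  obtain k where k: "k < length ss" "support x = ss ! k"
    using points_cases[OF x] nx attached_nth by metis
  note height = wedge_map_height_pos[OF x k]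
  then have "y \<notin> points (K - S)" using eq wedge_map_remaining[of y] by auto
  then obtain k' where k': "k' < length ss" "support y = ss ! k'"
    using points_cases[OF y] attached_nth by metis
  have "k' = k" using wedge_map_other[OF y k', of k 0] height eq by auto
  then have supp: "support y = ss ! k" using k' by simp
  let ?s = "ss ! k"
  have s: "?s \<in> S" by (rule nth_attached[OF k(1)])
  have others: "direction ?s x (nth_vertex ?s i) = direction ?s y (nth_vertex ?s i)" if "i \<in> {1..<card ?s}" for i
    using wedge_map_coordinate[OF x k that] wedge_map_coordinate[OF y k(1) supp that] height eq by simp
  have "sum x ?s = 1" "sum y ?s = 1"
    using points_sum[OF x attached_finite[OF s]] points_sum[OF y attached_finite[OF s]] k(2) supp by auto
  then have first: "direction ?s x (nth_vertex ?s 0) = direction ?s y (nth_vertex ?s 0)"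
    using sum_direction[OF s, of x] sum_direction[OF s, of y] others unfolding sum_nth_vertex[OF s] by simp
  have "direction ?s x v = direction ?s y v" if "v \<in> ?s" for v
    using s that by (cases rule: nth_vertex_cases) (auto simp: first others)
  then show "x = y"
    by (rule direction_inj[OF s k(2) wedge_map_weight[OF x k] supp wedge_map_weight[OF y k(1) supp]])
qed

lemma wedge_map_surj:
  assumes k: "k < length ss" and w: "w \<in> wedge_sphere k (int (card (ss ! k)) - 1)" "w \<noteq> (\<lambda>_. 0)"
  shows "w \<in> wedge_map ` points K"
proof -
  let ?s = "ss ! k"
  have s: "?s \<in> S" by (rule nth_attached[OF k])
  note pos = wedge_sphere_pos[OF attached_card[OF s] w]
  define coords where "coords = (\<lambda>i. if i = 0 then - (\<Sum>j\<in>{1..<card ?s}. w (k, j) / w (k, 0)) else w (k, i) / w (k, 0))"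
  define u where "u = (\<lambda>v. coords (inv_into {..<card ?s} (nth_vertex ?s) v))"
  have u: "u (nth_vertex ?s i) = coords i" if "i < card ?s" for i
    using bij_betw_inv_into_left[OF bij_betw_nth_vertex[OF s], of i] that unfolding u_def by simp
  have sum0: "sum u ?s = 0"
    unfolding sum_nth_vertex[OF s] using u attached_card[OF s] by (simp add: coords_def)
  obtain x where x: "x \<in> points K" "support x = ?s" and dir: "\<forall>v\<in>?s. direction ?s x v = u v"
    using direction_surj[OF s sum0] by blast
  have ratio: "direction ?s x (nth_vertex ?s i) = w (k, i) / w (k, 0)" if "i \<in> {1..<card ?s}" for i
    using that u[of i] dir bij_betwE[OF bij_betw_nth_vertex[OF s]] by (auto simp: coords_def)
  have "wedge_map x (k, 0) = 2 / (1 + (\<Sum>i\<in>{1..<card ?s}. (w (k, i) / w (k, 0))\<^sup>2))"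
    unfolding wedge_map_height[OF x(1) k x(2)] by (simp only: ratio cong: sum.cong)
  also have "\<dots> = w (k, 0)" by (rule wedge_sphere_height[OF attached_card[OF s] w, symmetric])
  finally have height: "wedge_map x (k, 0) = w (k, 0)" .
  have "wedge_map x (a, i) = w (a, i)" for a i
  proof -
    consider "a \<noteq> k \<or> i \<ge> card ?s" | "a = k" "i = 0" | "a = k" "i \<in> {1..<card ?s}"
      by (cases "i = 0"; cases "a = k \<and> i < card ?s") auto
    then show ?thesis
    proof cases
      case 1
      then show ?thesis
        using w(1) wedge_map_other[OF x(1) k x(2) 1] unfolding wedge_sphere_iff[OF attached_card[OF s]]
        by simp
    next
      case 2
      then show ?thesis using height by simp
    next
      case 3
      then show ?thesis using wedge_map_coordinate[OF x(1) k x(2) 3(2)] ratio[OF 3(2)] height pos by simp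
    qed
  qed
  then have "w = wedge_map x" by (auto simp: fun_eq_iff)
  then show ?thesis using x(1) by auto
qed

lemma image_wedge_map:
  assumes "points (K - S) \<noteq> {}"
  shows "wedge_map ` points K = wedge_points (map (\<lambda>s. int (card s) - 1) ss)"
proof (intro equalityI subsetI)
  fix w assume "w \<in> wedge_map ` points K"
  then obtain x where x: "x \<in> points K" "w = wedge_map x" by auto
  from x(1) show "w \<in> wedge_points (map (\<lambda>s. int (card s) - 1) ss)"
  proof (cases rule: points_cases)
    case 1
    then have "w = (\<lambda>_. 0)" using wedge_map_remaining x by auto
    then show ?thesis using zero_in_wedge_sphere[OF attached_card[OF nth_attached], of 0]
      unfolding wedge_points_def by (cases "ss = []") auto
  next
    case (2 s)
    then obtain k where k: "k < length ss" "support x = ss ! k" using attached_nth by metis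
    then show ?thesis using wedge_map_sphere[OF x(1) k] x(2) unfolding wedge_points_def by auto
  qed
next
  fix w assume w: "w \<in> wedge_points (map (\<lambda>s. int (card s) - 1) ss)"
  show "w \<in> wedge_map ` points K"
  proof (cases "w = (\<lambda>_. 0)")
    case True
    obtain x where "x \<in> points (K - S)" using assms by auto
    then have "x \<in> points K" "wedge_map x = w"
      using True wedge_map_remaining unfolding points_diff_iff by auto
    then show ?thesis by auto
  next
    case False
    then obtain k where "k < length ss" "w \<in> wedge_sphere k (int (card (ss ! k)) - 1)"
      using w unfolding wedge_points_def by (auto split: if_splits)
    then show ?thesis using wedge_map_surj False by auto
  qed
qed

theorem homotopy_equivalent_wedge:
  assumes contractible: "contractible_space (geom_realization (K - S))" and nonempty: "points (K - S) \<noteq> {}"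
  shows "geom_realization K homotopy_equivalent_space wedge_of_spheres (map (\<lambda>s. int (card s) - 1) ss)"
  unfolding geom_realization_points wedge_of_spheres_points
proof -
  let ?A = "points K" and ?A' = "points (K - S)"
  obtain h a where h: "continuous_on ({0..1::real} \<times> ?A') h" "\<And>t x. t \<in> {0..1} \<Longrightarrow> x \<in> ?A' \<Longrightarrow> h (t, x) \<in> ?A'"
    "\<And>x. h (0, x) = x" "\<And>x. h (1, x) = a"
    using contractible_space_contraction contractible unfolding geom_realization_points by blast
  have H: "extend_homotopy h (t, x) = h (t, x)" if "t \<in> {0..1}" "x \<in> ?A'" for t x
    using that by (intro extend_homotopy_extends[OF h(1-3)])
  show "top_of_set ?A homotopy_equivalent_space top_of_set (wedge_points (map (\<lambda>s. int (card s) - 1) ss))"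
  proof (rule homotopy_equivalent_collapse_contractible[OF compact_points[OF finite_complex complex]
        continuous_on_wedge_map image_wedge_map[OF nonempty] Hausdorff_space_euclidean_fun])
    show "x = y \<or> x \<in> ?A' \<and> y \<in> ?A'" if "x \<in> ?A" "y \<in> ?A" "wedge_map x = wedge_map y" for x y
      using wedge_map_inj[OF that] wedge_map_inj[OF that(2,1) that(3)[symmetric]] by auto
    show "wedge_map x = wedge_map y" if "x \<in> ?A'" "y \<in> ?A'" for x y
      using that wedge_map_remaining by simp
    show "extend_homotopy h (t, x) \<in> ?A'" if "t \<in> {0..1}" "x \<in> ?A'" for t x
      using H[OF that] h(2)[OF that] by simp
    show "extend_homotopy h (1, x) = a" if "x \<in> ?A'" for x using H[OF _ that, of 1] h(4) by simp
  qed (use continuous_on_extend_homotopy extend_homotopy_points extend_homotopy_start h in auto)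
qed

end

section \<open>Disjoint families ordered by refinement\<close>

definition finer :: "'a set set \<Rightarrow> 'a set set \<Rightarrow> bool" where
  "finer P Q \<longleftrightarrow> (\<forall>X\<in>P. \<exists>Y\<in>Q. X \<subseteq> Y)"

definition strictly_finer :: "'a set set \<Rightarrow> 'a set set \<Rightarrow> bool" where
  "strictly_finer P Q \<longleftrightarrow> finer P Q \<and> \<not> finer Q P"

lemma finerI: "(\<And>X. X \<in> P \<Longrightarrow> \<exists>Y\<in>Q. X \<subseteq> Y) \<Longrightarrow> finer P Q"
  unfolding finer_def by blast

lemma finerE:
  assumes "finer P Q" "X \<in> P"
  obtains Y where "Y \<in> Q" "X \<subseteq> Y"
  using assms unfolding finer_def by blast

lemma finer_refl: "finer P P"
  unfolding finer_def by auto

lemma finer_trans: "finer P Q \<Longrightarrow> finer Q S \<Longrightarrow> finer P S"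
  unfolding finer_def by (meson order_trans)

lemma finer_Union: "finer P Q \<Longrightarrow> \<Union>P \<subseteq> \<Union>Q"
  unfolding finer_def by fast

lemma finer_singleton: "finer Q {B} \<longleftrightarrow> \<Union>Q \<subseteq> B"
  unfolding finer_def by auto

lemma strictly_finer_imp_finer: "strictly_finer P Q \<Longrightarrow> finer P Q"
  unfolding strictly_finer_def by simp

interpretation refinement: strict_poset "strictly_finer :: 'a set set \<Rightarrow> 'a set set \<Rightarrow> bool"
proof
  show "\<not> strictly_finer x x" for x :: "'a set set" unfolding strictly_finer_def by auto
  show "strictly_finer x z" if "strictly_finer x y" "strictly_finer y z" for x y z :: "'a set set"
    using that finer_trans unfolding strictly_finer_def by metis
qed

interpretation inclusion: strict_poset "(\<subset>) :: 'a set \<Rightarrow> 'a set \<Rightarrow> bool"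
  by standard auto

lemma strictly_finer_singleton: "strictly_finer {X} {Y} \<longleftrightarrow> X \<subset> Y"
  unfolding strictly_finer_def finer_def by auto

lemma comparable_singleton: "comparable strictly_finer {X} {Y} \<longleftrightarrow> comparable (\<subset>) X Y"
  unfolding comparable_def strictly_finer_singleton by auto

locale block_system =
  fixes blocks :: "'n::finite set set"
  assumes block_mono: "X \<in> blocks \<Longrightarrow> X \<subseteq> Y \<Longrightarrow> Y \<in> blocks"
    and block_card: "X \<in> blocks \<Longrightarrow> 2 \<le> card X"
begin

definition families :: "'n set set set" where
  "families = {Q. Q \<subseteq> blocks \<and> disjoint Q}"

abbreviation interval :: "'n set set \<Rightarrow> 'n set set \<Rightarrow> 'n set set set" where
  "interval \<equiv> refinement.between families"

lemma block_nonempty: "X \<in> blocks \<Longrightarrow> X \<noteq> {}"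
  using block_card by fastforce

lemma block_not_subset_singleton:
  assumes "X \<in> blocks"
  shows "\<not> X \<subseteq> {a}"
proof
  assume "X \<subseteq> {a}"
  then have "card X \<le> 1" using card_mono[of "{a}" X] by simp
  then show False using block_card[OF assms] by simp
qed

lemma
  assumes "Q \<in> families" "X \<in> Q"
  shows families_block: "X \<in> blocks"
    and families_nonempty: "X \<noteq> {}"
    and families_unique: "Y \<in> Q \<Longrightarrow> x \<in> X \<Longrightarrow> x \<in> Y \<Longrightarrow> X = Y"
proof -
  show "X \<in> blocks" using assms unfolding families_def by auto
  then show "X \<noteq> {}" by (rule block_nonempty)
  show "X = Y" if "Y \<in> Q" "x \<in> X" "x \<in> Y"
    using assms that disjointD[of Q X Y] unfolding families_def by auto
qed

lemma familiesI:
  "(\<And>X. X \<in> Q \<Longrightarrow> X \<in> blocks) \<Longrightarrow> (\<And>X Y x. X \<in> Q \<Longrightarrow> Y \<in> Q \<Longrightarrow> x \<in> X \<Longrightarrow> x \<in> Y \<Longrightarrow> X = Y)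
    \<Longrightarrow> Q \<in> families"
  unfolding families_def disjoint_def by blast

lemma families_subset: "Q \<in> families \<Longrightarrow> P \<subseteq> Q \<Longrightarrow> P \<in> families"
  unfolding families_def by (auto intro: pairwise_subset)

lemma singleton_families: "{X} \<in> families \<longleftrightarrow> X \<in> blocks"
  unfolding families_def disjoint_def by auto

lemma empty_families: "{} \<in> families"
  unfolding families_def disjoint_def by auto

lemma Un_families:
  assumes P: "P \<in> families" and Q: "Q \<in> families" and dis: "\<Union>P \<inter> \<Union>Q = {}"
  shows "P \<union> Q \<in> families"
proof (rule familiesI)
  show "X \<in> blocks" if "X \<in> P \<union> Q" for X
    using that families_block[OF P] families_block[OF Q] by auto
  show "X = Y" if "X \<in> P \<union> Q" "Y \<in> P \<union> Q" "x \<in> X" "x \<in> Y" for X Y x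
    using that dis families_unique[OF P, of X Y x] families_unique[OF Q, of X Y x] by blast
qed

lemma insert_families:
  assumes "P \<in> families" "B \<in> blocks" "B \<inter> \<Union>P = {}"
  shows "insert B P \<in> families"
  using Un_families[of "{B}" P] assms by (simp add: singleton_families)

lemma Union_block:
  assumes "P \<in> families" "P \<noteq> {}"
  shows "\<Union>P \<in> blocks"
proof -
  obtain A where "A \<in> P" using assms(2) by auto
  then show ?thesis using block_mono[OF families_block[OF assms(1)], of A "\<Union>P"] by auto
qed

lemma finer_squeeze:
  assumes Q: "Q \<in> families" and PZ: "finer P Z" and ZQ: "finer Z Q" and X: "X \<in> P" "X \<in> Q"
  shows "X \<in> Z"
proof -
  obtain Y where Y: "Y \<in> Z" "X \<subseteq> Y" using finerE[OF PZ X(1)] by metis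
  obtain X' where X': "X' \<in> Q" "Y \<subseteq> X'" using finerE[OF ZQ Y(1)] by metis
  obtain x where "x \<in> X" using families_nonempty[OF Q X(2)] by auto
  then have "X = X'" using families_unique[OF Q X(2) X'(1), of x] Y(2) X'(2) by auto
  then show ?thesis using Y X'(2) by auto
qed

lemma finer_antisym:
  assumes "P \<in> families" "Q \<in> families" "finer P Q" "finer Q P"
  shows "P = Q"
  using finer_squeeze[OF assms(1,3,4)] finer_squeeze[OF assms(2,4,3)] by blast

lemma strictly_finer_iff: "P \<in> families \<Longrightarrow> Q \<in> families \<Longrightarrow> strictly_finer P Q \<longleftrightarrow> finer P Q \<and> P \<noteq> Q"
  using finer_antisym[of P Q] finer_refl unfolding strictly_finer_def by auto

lemma finer_iff: "P \<in> families \<Longrightarrow> Q \<in> families \<Longrightarrow> finer P Q \<longleftrightarrow> P = Q \<or> strictly_finer P Q"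
  using strictly_finer_iff[of P Q] finer_refl by auto

lemma empty_strictly_finer: "strictly_finer {} Q \<longleftrightarrow> Q \<noteq> {}"
  unfolding strictly_finer_def finer_def by auto

lemma interval_iff:
  assumes "P \<in> families" "Q \<in> families"
  shows "Z \<in> interval P Q \<longleftrightarrow> Z \<in> families \<and> finer P Z \<and> Z \<noteq> P \<and> finer Z Q \<and> Z \<noteq> Q"
  using strictly_finer_iff[OF assms(1)] strictly_finer_iff[OF _ assms(2)] by auto

lemma interval_empty_singleton:
  assumes "B \<in> blocks"
  shows "Q \<in> interval {} {B} \<longleftrightarrow> Q \<in> families \<and> Q \<noteq> {} \<and> \<Union>Q \<subseteq> B \<and> Q \<noteq> {B}"
proof -
  have "{B} \<in> families" using assms singleton_families by simp
  then show ?thesis using interval_iff[OF empty_families, of "{B}" Q] unfolding finer_singleton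
    by (auto simp: finer_def)
qed

lemma saturated_minimal_block:
  assumes E: "E \<in> blocks" "\<And>X. X \<in> blocks \<Longrightarrow> X \<subseteq> E \<Longrightarrow> X = E"
  shows "refinement.saturated families {} {} {E}"
proof (rule refinement.saturated_cover)
  show "strictly_finer {} {E}" using empty_strictly_finer by auto
  fix Z assume "Z \<in> families" "strictly_finer {} Z" "strictly_finer Z {E}"
  then have "Z \<in> interval {} {E}" by simp
  then have Z: "Z \<in> families" "Z \<noteq> {}" "\<Union>Z \<subseteq> E" "Z \<noteq> {E}"
    unfolding interval_empty_singleton[OF E(1)] by simp_all
  have "X = E" if "X \<in> Z" for X using E(2)[OF families_block[OF Z(1) that]] Z(3) that by auto
  then have "Z \<subseteq> {E}" by blast
  then have "Z = {E}" using Z(2) by auto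
  then show False using Z(4) by simp
qed

lemma saturated_insert_point:
  assumes X: "X \<in> blocks" "a \<notin> X"
  shows "refinement.saturated families {X} {} {insert a X}"
proof (rule refinement.saturated_cover)
  show "strictly_finer {X} {insert a X}" using X by (auto simp: strictly_finer_singleton)
  fix Z assume Z: "Z \<in> families" "strictly_finer {X} Z" "strictly_finer Z {insert a X}"
  obtain C where C: "C \<in> Z" "X \<subseteq> C"
    using finerE[OF strictly_finer_imp_finer[OF Z(2)], of X] by auto
  have Union_Z: "\<Union>Z \<subseteq> insert a X"
    using strictly_finer_imp_finer[OF Z(3)] unfolding finer_singleton .
  have "D = C" if D: "D \<in> Z" for D
  proof (rule ccontr)
    assume "D \<noteq> C"
    then have "D \<inter> X = {}" using families_unique[OF Z(1) D C(1)] C(2) by auto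
    then have "D \<subseteq> {a}" using Union_Z D by auto
    then show False using block_not_subset_singleton[OF families_block[OF Z(1) D]] by simp
  qed
  then have "Z \<subseteq> {C}" by blast
  then have "Z = {C}" using C(1) by auto
  moreover have "C = X \<or> C = insert a X" using Union_Z C by auto
  ultimately show False using Z(2,3) refinement.irrefl by metis
qed

lemma finer_Un_iff:
  assumes "Q \<in> families" "\<Union>P \<inter> \<Union>Q = {}"
  shows "finer (P \<union> Q) (P \<union> Q') \<longleftrightarrow> finer Q Q'"
proof
  assume r: "finer (P \<union> Q) (P \<union> Q')"
  show "finer Q Q'"
  proof (rule finerI)
    fix X assume X: "X \<in> Q"
    then obtain Y where Y: "Y \<in> P \<union> Q'" "X \<subseteq> Y" using finerE[OF r, of X] by auto
    have "Y \<notin> P" using assms(2) families_nonempty[OF assms(1) X] X Y(2) by blast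
    then show "\<exists>Y\<in>Q'. X \<subseteq> Y" using Y by auto
  qed
qed (auto simp: finer_def)

lemma interval_insert:
  assumes P: "P \<in> families" and B: "B \<in> blocks" "B \<inter> \<Union>P = {}"
  shows "interval P (insert B P) = (\<union>) P ` interval {} {B}"
proof (intro equalityI subsetI)
  note insert_P = insert_families[OF P B]
  fix Z assume "Z \<in> interval P (insert B P)"
  then have Z: "Z \<in> families" "finer P Z" "Z \<noteq> P" "finer Z (insert B P)" "Z \<noteq> insert B P"
    unfolding interval_iff[OF P insert_P] by simp_all
  have P_subset: "P \<subseteq> Z" using finer_squeeze[OF insert_P Z(2,4)] by auto
  have "X \<subseteq> B" if X: "X \<in> Z - P" for X
  proof -
    obtain Y where Y: "Y \<in> insert B P" "X \<subseteq> Y" using finerE[OF Z(4)] X by blast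
    obtain x where x: "x \<in> X" using families_nonempty[OF Z(1)] X by blast
    have "Y \<notin> P" using families_unique[OF Z(1), of X Y x] P_subset X Y x by auto
    then show ?thesis using Y by auto
  qed
  then have "Z - P \<in> interval {} {B}"
    unfolding interval_empty_singleton[OF B(1)] using families_subset[OF Z(1)] P_subset Z(3,5) by auto
  then show "Z \<in> (\<union>) P ` interval {} {B}" using P_subset by (intro image_eqI[of _ _ "Z - P"]) auto
next
  fix Z assume "Z \<in> (\<union>) P ` interval {} {B}"
  then obtain Q where Q: "Q \<in> interval {} {B}" "Z = P \<union> Q" by auto
  have QI: "Q \<in> families" "Q \<noteq> {}" "\<Union>Q \<subseteq> B" "Q \<noteq> {B}"
    using Q(1) unfolding interval_empty_singleton[OF B(1)] by simp_all
  have dis: "\<Union>P \<inter> \<Union>Q = {}" using QI(3) B(2) by auto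
  have "Q \<inter> P = {}" using dis families_nonempty[OF QI(1)] by blast
  then have "Z \<noteq> P" "Z \<noteq> insert B P" using Q(2) QI(2,4) B(2) block_nonempty[OF B(1)] by auto
  moreover have "finer P Z" "finer Z (insert B P)" using Q(2) QI(3) unfolding finer_def by auto
  moreover have "Z \<in> families" unfolding Q(2) by (rule Un_families[OF P QI(1) dis])
  ultimately show "Z \<in> interval P (insert B P)"
    unfolding interval_iff[OF P insert_families[OF P B]] by simp
qed

lemma saturated_Un:
  assumes P: "P \<in> families" and B: "B \<in> blocks" "B \<inter> \<Union>P = {}"
    and saturated: "refinement.saturated families {} c {B}"
  shows "refinement.saturated families P ((\<union>) P ` c) (insert B P)"
proof -
  let ?I = "interval {} {B}"
  have dis: "Q \<in> families" "\<Union>P \<inter> \<Union>Q = {}" if "Q \<in> ?I" for Q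
    using that B unfolding interval_empty_singleton[OF B(1)] by auto
  have "Q \<inter> P = {}" if "Q \<in> ?I" for Q
    using dis[OF that] families_nonempty[of Q] by blast
  then have inj: "inj_on ((\<union>) P) ?I" by (intro inj_on_inverseI[of _ "\<lambda>Z. Z - P"]) auto
  have "comparable strictly_finer (P \<union> Q) (P \<union> Q') \<longleftrightarrow> comparable strictly_finer Q Q'"
    if "Q \<in> ?I" "Q' \<in> ?I" for Q Q'
    by (rule comparable_embedding[OF inj _ that]) (simp only: strictly_finer_def finer_Un_iff[OF dis])
  moreover note max_chain = refinement.saturated_max_chain[OF saturated]
  ultimately have "max_chain strictly_finer ((\<union>) P ` ?I) ((\<union>) P ` c)"
    using max_chain_image[OF inj _ max_chain_subset[OF max_chain]] by blast
  moreover have "strictly_finer P (insert B P)"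
    using strictly_finer_iff[OF P insert_families[OF P B]] B(2) block_nonempty[OF B(1)]
    unfolding finer_def by auto
  ultimately show ?thesis unfolding refinement.saturated_def interval_insert[OF P B] by simp
qed

definition merge :: "'n set \<Rightarrow> 'n set \<Rightarrow> 'n set set \<Rightarrow> 'n set set" where
  "merge a b P = insert (a \<union> b) (P - {a, b})"

lemma merge_families:
  assumes P: "P \<in> families" "a \<in> P" "b \<in> P"
  shows "merge a b P \<in> families"
  unfolding merge_def
proof (rule insert_families)
  show "P - {a, b} \<in> families" by (rule families_subset[OF P(1)]) auto
  show "a \<union> b \<in> blocks" using block_mono[OF families_block[OF P(1,2)]] by auto
  show "(a \<union> b) \<inter> \<Union>(P - {a, b}) = {}"
    using families_unique[OF P(1,2)] families_unique[OF P(1,3)] by blast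
qed

lemma Union_merge: "a \<in> P \<Longrightarrow> b \<in> P \<Longrightarrow> \<Union>(merge a b P) = \<Union>P"
  unfolding merge_def by auto

lemma merge_union_notin:
  assumes "P \<in> families" "a \<in> P" "b \<in> P" "a \<noteq> b"
  shows "a \<union> b \<notin> P"
proof
  assume "a \<union> b \<in> P"
  moreover obtain x y where "x \<in> a" "y \<in> b" using families_nonempty[OF assms(1)] assms(2,3) by blast
  ultimately have "a = a \<union> b" "b = a \<union> b"
    using families_unique[OF assms(1,2), of "a \<union> b" x] families_unique[OF assms(1,3), of "a \<union> b" y] by auto
  then show False using assms(4) by auto
qed

lemma finer_merge: "finer P (merge a b P)"
  unfolding finer_def merge_def by auto

lemma finer_merge_cases:
  assumes P: "P \<in> families" "a \<in> P" "b \<in> P"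
    and Z: "Z \<in> families" "finer P Z" "finer Z (merge a b P)"
  shows "Z = P \<or> Z = merge a b P"
proof (cases "\<exists>X\<in>Z. a \<union> b \<subseteq> X")
  case True
  have "finer (merge a b P) Z"
  proof (rule finerI)
    fix Y assume "Y \<in> merge a b P"
    then have "Y = a \<union> b \<or> Y \<in> P" unfolding merge_def by auto
    then show "\<exists>X\<in>Z. Y \<subseteq> X" using True Z(2) unfolding finer_def by blast
  qed
  then show ?thesis using finer_antisym[OF Z(1) merge_families[OF P] Z(3)] by simp
next
  case False
  have "finer Z P"
  proof (rule finerI, rule ccontr)
    fix X assume X: "X \<in> Z" and none: "\<not> (\<exists>Y\<in>P. X \<subseteq> Y)"
    obtain Y where "Y \<in> merge a b P" "X \<subseteq> Y" using finerE[OF Z(3) X] by metis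
    then have "X \<subseteq> a \<union> b" using none unfolding merge_def by auto
    moreover have "\<not> X \<subseteq> a" "\<not> X \<subseteq> b" using none P(2,3) by auto
    ultimately obtain x y where xy: "x \<in> X" "x \<in> a" "y \<in> X" "y \<in> b" by blast
    have "c \<subseteq> X" if c: "c \<in> P" and z: "z \<in> X" "z \<in> c" for c z
    proof -
      obtain C where C: "C \<in> Z" "c \<subseteq> C" using finerE[OF Z(2) c] by metis
      then have "X = C" using families_unique[OF Z(1) X C(1) z(1)] z(2) by auto
      then show ?thesis using C(2) by simp
    qed
    from this[OF P(2) xy(1,2)] this[OF P(3) xy(3,4)] show False using False X by blast
  qed
  then show ?thesis using finer_antisym[OF Z(1) P(1) _ Z(2)] by simp
qed

lemma saturated_merge:
  assumes P: "P \<in> families" "a \<in> P" "b \<in> P" "a \<noteq> b"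
  shows "refinement.saturated families P {} (merge a b P)"
proof (rule refinement.saturated_cover)
  note M = merge_families[OF P(1-3)]
  have "merge a b P \<noteq> P" using merge_union_notin[OF P] unfolding merge_def by auto
  then show "strictly_finer P (merge a b P)" using strictly_finer_iff[OF P(1) M] finer_merge by simp
  fix Z assume Z: "Z \<in> families" "strictly_finer P Z" "strictly_finer Z (merge a b P)"
  then have "Z = P \<or> Z = merge a b P"
    by (intro finer_merge_cases[OF P(1-3)] strictly_finer_imp_finer)
  then show False using Z(2,3) refinement.irrefl by metis
qed

end

text \<open>The interior of a chain from \<open>X\<close> to \<open>B\<close> that adds one point at a time.\<close>
inductive flag :: "'a set \<Rightarrow> 'a set \<Rightarrow> 'a set set \<Rightarrow> bool" where
  flag_base: "a \<notin> X \<Longrightarrow> flag X (insert a X) {}"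
| flag_step: "a \<notin> X \<Longrightarrow> flag (insert a X) B c \<Longrightarrow> flag X B (insert (insert a X) c)"

lemma flag_saturated: "flag X B c \<Longrightarrow> inclusion.saturated UNIV X c B"
proof (induction rule: flag.induct)
  case (flag_base a X)
  then show ?case by (intro inclusion.saturated_cover) auto
next
  case (flag_step a X B c)
  have "inclusion.saturated UNIV X {} (insert a X)" using flag_step by (intro inclusion.saturated_cover) auto
  from inclusion.saturated_compose[OF this flag_step.IH] show ?case by simp
qed

lemma flag_max_chain: "flag X B c \<Longrightarrow> max_chain (\<subset>) {Z. X \<subset> Z \<and> Z \<subset> B} c"
  using inclusion.saturated_max_chain[OF flag_saturated[of X B c]] by simp

lemma flag_subset: "flag X B c \<Longrightarrow> c \<subseteq> {Z. X \<subset> Z \<and> Z \<subset> B}"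
  by (rule max_chain_subset[OF flag_max_chain])

lemma flag_card:
  "flag X B c \<Longrightarrow> finite X \<Longrightarrow> finite c \<and> card B = card X + card c + 1"
proof (induction rule: flag.induct)
  case (flag_step a X B c)
  have "insert a X \<notin> c" using flag_subset[OF flag_step.hyps(2)] by auto
  then show ?case using flag_step by auto
qed auto

lemma (in block_system) flag_singletons_saturated:
  "flag X B c \<Longrightarrow> X \<in> blocks \<Longrightarrow> refinement.saturated families {X} ((\<lambda>Z. {Z}) ` c) {B}"
proof (induction rule: flag.induct)
  case (flag_base a X)
  then show ?case using saturated_insert_point by auto
next
  case (flag_step a X B c)
  have insert_block: "insert a X \<in> blocks" using block_mono[OF flag_step.prems] by auto
  have "refinement.saturated families {X} ({} \<union> insert {insert a X} ((\<lambda>Z. {Z}) ` c)) {B}"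
    using flag_step insert_block
    by (intro refinement.saturated_compose[OF saturated_insert_point]) (auto simp: singleton_families)
  then show ?case by simp
qed

lemma collapsible_proper_between_except_atom:
  assumes fin: "finite B" and XB: "X \<subseteq> B" and a: "a \<in> B" "a \<notin> X" and B: "B \<noteq> insert a X"
  shows "collapsible (order_complex (\<subset>) ({Z. X \<subset> Z \<and> Z \<subset> B} - {insert a X}))"
proof (rule inclusion.collapsible_order_complex_meet[where a = "B - {a}" and m = "\<lambda>Z. Z - {a}"])
  let ?Y = "{Z. X \<subset> Z \<and> Z \<subset> B} - {insert a X}"
  show "finite ?Y" by (rule finite_subset[of _ "Pow B"]) (use fin in auto)
  show "B - {a} \<in> ?Y" using a XB B by auto
  fix Z assume Z: "Z \<in> ?Y"
  then have "X \<subset> Z - {a}" using a(2) by auto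
  then show "Z - {a} \<in> ?Y \<and> (Z - {a} = Z \<or> Z - {a} \<subset> Z) \<and> (Z - {a} = B - {a} \<or> Z - {a} \<subset> B - {a})"
    using Z by auto
  fix Z' assume "Z' \<subset> Z" "Z' = B - {a} \<or> Z' \<subset> B - {a}"
  then show "Z' = Z - {a} \<or> Z' \<subset> Z - {a}" by auto
qed

lemma flag_critical_chains_exists:
  fixes X B :: "'a set"
  assumes "finite B" "X \<subset> B"
  shows "\<exists>c. flag X B c \<and> critical_chains (\<subset>) {Z. X \<subset> Z \<and> Z \<subset> B} {c}"
  using assms
proof (induction "card (B - X)" arbitrary: X rule: less_induct)
  case less
  obtain a where a: "a \<in> B" "a \<notin> X" using less.prems by auto
  let ?x = "insert a X" and ?Y = "{Z. X \<subset> Z \<and> Z \<subset> B} - {insert a X}"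
  show ?case
  proof (cases "B = ?x")
    case True
    have "{Z. X \<subset> Z \<and> Z \<subset> B} = {}" using True by auto
    then show ?thesis using flag_base[OF a(2)] True critical_chains_void by metis
  next
    case False
    have x_psubset: "?x \<subset> B" using False a less.prems by auto
    then have insert_Y: "insert ?x ?Y = {Z. X \<subset> Z \<and> Z \<subset> B}" using a by auto
    have "B - ?x \<subset> B - X" using a by auto
    then have "card (B - ?x) < card (B - X)" using less.prems(1) by (intro psubset_card_mono) auto
    then obtain c where c: "flag ?x B c" "critical_chains (\<subset>) {Z. ?x \<subset> Z \<and> Z \<subset> B} {c}"
      using less.hyps[of ?x] less.prems(1) x_psubset by auto
    have flag: "flag X B (insert ?x c)" by (rule flag_step[OF a(2) c(1)])
    have fin: "finite ?Y" by (rule finite_subset[of _ "Pow B"]) (use less.prems(1) in auto)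
    have "critical_chains (\<subset>) (insert ?x ?Y) ({} \<union> chains_through {{}} ?x {c})"
    proof (rule inclusion.critical_chains_insert[OF fin])
      show "critical_chains (\<subset>) ?Y {}"
        using fin collapsible_proper_between_except_atom[OF less.prems(1) _ a False] less.prems(2)
        unfolding critical_chains_empty by auto
      have "{y\<in>?Y. y \<subset> ?x} = {}" by auto
      then show "critical_chains (\<subset>) {y\<in>?Y. y \<subset> ?x} {{}}"
        using critical_chains_void by metis
      have "{z\<in>?Y. ?x \<subset> z} = {Z. ?x \<subset> Z \<and> Z \<subset> B}" by auto
      then show "critical_chains (\<subset>) {z\<in>?Y. ?x \<subset> z} {c}" using c(2) by simp
      show "max_chain (\<subset>) (insert ?x ?Y) d" if "d \<in> chains_through {{}} ?x {c}" for d
        using that flag_max_chain[OF flag] unfolding insert_Y chains_through_bottom by simp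
    qed auto
    then show ?thesis using flag unfolding insert_Y chains_through_bottom by auto
  qed
qed

section \<open>Shellings, and the sets below a given set\<close>

text \<open>The sets \<open>E i\<close> are the complements of the facets; the axiom \<open>shelling_exchange\<close> is the
  shelling condition read on complements.\<close>
locale shelled_edges =
  fixes E :: "nat \<Rightarrow> 'n::finite set" and q :: nat
  assumes edge_antichain: "i < q \<Longrightarrow> j < q \<Longrightarrow> E i \<subseteq> E j \<Longrightarrow> i = j"
    and edge_card: "i < q \<Longrightarrow> 2 \<le> card (E i)"
    and shelling_exchange: "i < j \<Longrightarrow> j < q \<Longrightarrow> \<exists>v\<in>E i. v \<notin> E j \<and> (\<exists>k<j. E k \<subseteq> insert v (E j))"
begin

text \<open>The complement of \<open>E i \<union> restriction i\<close> is the paper's \<open>G\<^sub>i\<close>.\<close>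
definition restriction :: "nat \<Rightarrow> 'n set" where
  "restriction i = {v. v \<notin> E i \<and> (\<exists>k<i. E k \<subseteq> insert v (E i))}"

definition blocks :: "'n set set" where
  "blocks = {X. \<exists>i<q. E i \<subseteq> X}"

sublocale block_system blocks
proof
  show "Y \<in> blocks" if "X \<in> blocks" "X \<subseteq> Y" for X Y
    using that order_trans unfolding blocks_def by blast
  show "2 \<le> card X" if X: "X \<in> blocks" for X
  proof -
    obtain i where "i < q" "E i \<subseteq> X" using X unfolding blocks_def by auto
    then show ?thesis using edge_card[of i] card_mono[of X "E i"] by auto
  qed
qed

lemma edge_block: "i < q \<Longrightarrow> E i \<in> blocks"
  unfolding blocks_def by auto

lemma edge_minimal: "i < q \<Longrightarrow> X \<in> blocks \<Longrightarrow> X \<subseteq> E i \<Longrightarrow> X = E i"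
  unfolding blocks_def using edge_antichain by blast

lemma restriction_edge: "v \<in> restriction j \<Longrightarrow> \<exists>k<j. E k \<subseteq> insert v (E j)"
  unfolding restriction_def by auto

lemma restriction_earlier: "v \<in> restriction j \<Longrightarrow> v \<in> X \<Longrightarrow> E j \<subseteq> X \<Longrightarrow> \<exists>i<j. E i \<subseteq> X"
  using restriction_edge[of v j] by blast

lemma edge_meets_restriction: "i < j \<Longrightarrow> j < q \<Longrightarrow> \<exists>v. v \<in> E i \<and> v \<in> restriction j"
  using shelling_exchange[of i j] unfolding restriction_def by auto

definition blocks_below :: "nat \<Rightarrow> 'n set \<Rightarrow> 'n set set" where
  "blocks_below m B = {X. X \<subset> B \<and> (\<exists>i<m. E i \<subseteq> X)}"

definition trapping_indices :: "nat \<Rightarrow> 'n set \<Rightarrow> nat set" where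
  "trapping_indices m B = {i. i < m \<and> E i \<subseteq> B \<and> B \<subseteq> E i \<union> restriction i}"

lemma
  assumes "i \<in> trapping_indices m B"
  shows trapping_less: "i < m" and trapping_subset: "E i \<subseteq> B" and trapping_cover: "B \<subseteq> E i \<union> restriction i"
  using assms unfolding trapping_indices_def by auto

definition flag_chain :: "nat \<Rightarrow> 'n set \<Rightarrow> 'n set set" where
  "flag_chain i B = (SOME c. flag (E i) B c \<and> critical_chains (\<subset>) {Z. E i \<subset> Z \<and> Z \<subset> B} {c})"

definition edge_chain :: "nat \<Rightarrow> 'n set \<Rightarrow> 'n set set" where
  "edge_chain i B = (if B = E i then {} else insert (E i) (flag_chain i B))"

lemma
  assumes "E i \<subset> B"
  shows flag_flag_chain: "flag (E i) B (flag_chain i B)"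
    and flag_chain_critical: "critical_chains (\<subset>) {Z. E i \<subset> Z \<and> Z \<subset> B} {flag_chain i B}"
  using someI_ex[OF flag_critical_chains_exists[OF finite assms]] unfolding flag_chain_def by auto

lemma edge_chain_saturated:
  assumes "i < q" "E i \<subseteq> B"
  shows "refinement.saturated families {} ((\<lambda>Z. {Z}) ` edge_chain i B) {B}"
proof -
  have bottom: "refinement.saturated families {} {} {E i}"
    using saturated_minimal_block[OF edge_block] edge_minimal assms by auto
  show ?thesis
  proof (cases "B = E i")
    case True
    then show ?thesis using bottom unfolding edge_chain_def by simp
  next
    case False
    then have "flag (E i) B (flag_chain i B)" using flag_flag_chain assms by auto
    from refinement.saturated_compose[OF bottom flag_singletons_saturated[OF this edge_block[OF assms(1)]]]
    show ?thesis
      using False edge_block[OF assms(1)] unfolding edge_chain_def by (simp add: singleton_families)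
  qed
qed

lemma
  assumes "E i \<subseteq> B" "X \<in> edge_chain i B"
  shows edge_chain_lower: "E i \<subseteq> X" and edge_chain_upper: "X \<subset> B"
proof -
  have B: "E i \<subset> B" "X = E i \<or> X \<in> flag_chain i B"
    using assms unfolding edge_chain_def by (auto split: if_splits)
  then show "E i \<subseteq> X" "X \<subset> B" using flag_subset[OF flag_flag_chain[OF B(1)]] by auto
qed

lemma edge_chain_blocks_below: "i < m \<Longrightarrow> E i \<subseteq> B \<Longrightarrow> edge_chain i B \<subseteq> blocks_below m B"
  using edge_chain_lower edge_chain_upper unfolding blocks_below_def by blast

lemma card_edge_chain:
  assumes "E i \<subseteq> B"
  shows "card (edge_chain i B) + card (E i) = card B"
proof (cases "B = E i")
  case False
  then have B: "E i \<subset> B" using assms by auto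
  have "E i \<notin> flag_chain i B" using flag_subset[OF flag_flag_chain[OF B]] by auto
  then show ?thesis using flag_card[OF flag_flag_chain[OF B]] False unfolding edge_chain_def by auto
qed (simp add: edge_chain_def)

lemma max_chain_edge_chain:
  assumes "i < m" "m \<le> q" "E i \<subseteq> B"
  shows "max_chain (\<subset>) (blocks_below m B) (edge_chain i B)"
proof -
  let ?f = "\<lambda>Z::'n set. {Z}"
  note sub = edge_chain_blocks_below[OF assms(1,3)]
  have image: "?f ` blocks_below m B \<subseteq> interval {} {B}"
  proof
    fix Z assume "Z \<in> ?f ` blocks_below m B"
    then obtain X where X: "Z = {X}" "X \<subset> B" "X \<in> blocks"
      using assms(2) unfolding blocks_below_def blocks_def by (auto intro: less_le_trans)
    then show "Z \<in> interval {} {B}"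
      by (simp add: singleton_families empty_strictly_finer strictly_finer_singleton)
  qed
  have "i < q" using assms(1,2) by simp
  note max_chain = refinement.saturated_max_chain[OF edge_chain_saturated[OF this assms(3)]]
  have "max_chain strictly_finer (?f ` blocks_below m B) (?f ` edge_chain i B)"
    by (rule max_chain_restrict[OF max_chain image_mono[OF sub] image])
  moreover have "inj_on ?f (blocks_below m B)" by (auto intro: inj_onI)
  ultimately show ?thesis
    using max_chain_image[of ?f "blocks_below m B" strictly_finer "(\<subset>)"] sub
    by (simp add: comparable_singleton)
qed

lemma inj_on_edge_chain: "inj_on (\<lambda>i. edge_chain i B) (trapping_indices q B)"
proof (rule inj_onI)
  fix i j assume ij: "i \<in> trapping_indices q B" "j \<in> trapping_indices q B" and eq: "edge_chain i B = edge_chain j B"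
  note i = trapping_less[OF ij(1)] trapping_subset[OF ij(1)] and j = trapping_less[OF ij(2)] trapping_subset[OF ij(2)]
  show "i = j"
  proof (cases "B = E i")
    case True
    then show ?thesis using edge_antichain[of j i] i j by auto
  next
    case False
    then have "E i \<in> edge_chain i B" unfolding edge_chain_def by auto
    then have "E i \<in> edge_chain j B" unfolding eq .
    then show ?thesis using edge_chain_lower[OF j(2)] edge_antichain[of j i] i j by auto
  qed
qed

subsection \<open>Adding one edge\<close>

abbreviation edge_chains :: "nat \<Rightarrow> 'n set \<Rightarrow> 'n set set set" where
  "edge_chains m B \<equiv> (\<lambda>i. edge_chain i B) ` trapping_indices m B"

lemma max_chain_edge_chains:
  assumes "c \<in> edge_chains m B" "m \<le> m'" "m' \<le> q"
  shows "max_chain (\<subset>) (blocks_below m' B) c"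
proof -
  obtain i where i: "i \<in> trapping_indices m B" "c = edge_chain i B" using assms(1) by auto
  then show ?thesis
    using max_chain_edge_chain[of i m' B] trapping_less[OF i(1)] trapping_subset[OF i(1)] assms(2,3) by simp
qed

lemma trapping_indices_Suc:
  "trapping_indices (Suc m) B =
    (if E m \<subseteq> B \<and> B \<subseteq> E m \<union> restriction m then insert m (trapping_indices m B) else trapping_indices m B)"
  unfolding trapping_indices_def by (auto simp: less_Suc_eq)

lemma blocks_below_not_subset_edge:
  assumes "m < q" "X \<in> blocks_below m B"
  shows "\<not> X \<subseteq> E m"
proof
  assume "X \<subseteq> E m"
  then obtain i where "i < m" "E i \<subseteq> E m" using assms(2) unfolding blocks_below_def by auto
  then show False using edge_antichain[of i m] assms(1) by auto
qed

lemma edge_chains_critical_skip: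
  assumes "\<not> E m \<subseteq> B" "critical_chains (\<subset>) (blocks_below m B) (edge_chains m B)"
  shows "critical_chains (\<subset>) (blocks_below (Suc m) B) (edge_chains (Suc m) B)"
proof -
  have "blocks_below (Suc m) B = blocks_below m B"
    using assms(1) unfolding blocks_below_def by (auto simp: less_Suc_eq)
  then show ?thesis using assms unfolding trapping_indices_Suc by simp
qed

lemma edge_chains_critical_first:
  assumes mB: "E m \<subseteq> B" and first: "\<not> (\<exists>i<m. E i \<subseteq> B)"
  shows "critical_chains (\<subset>) (blocks_below (Suc m) B) (edge_chains (Suc m) B)"
proof -
  have below: "blocks_below (Suc m) B = {X. X \<subset> B \<and> E m \<subseteq> X}"
    using first unfolding blocks_below_def by (auto simp: less_Suc_eq)
  have old: "trapping_indices m B = {}" using first unfolding trapping_indices_def by auto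
  show ?thesis
  proof (cases "B = E m")
    case True
    have "edge_chains (Suc m) B = {{}}" using True old by (simp add: trapping_indices_Suc edge_chain_def)
    moreover have "blocks_below (Suc m) B = {}" using below True by auto
    ultimately show ?thesis using critical_chains_void by simp
  next
    case False
    have "B \<inter> restriction m = {}" using restriction_earlier[of _ m B] mB first by auto
    then have "edge_chains (Suc m) B = {}" using False mB old unfolding trapping_indices_Suc by auto
    moreover have "collapsible (order_complex (\<subset>) (blocks_below (Suc m) B))"
      by (rule collapsible_order_complex_cone[of _ "E m"]) (use False mB in \<open>auto simp: below comparable_def\<close>)
    ultimately show ?thesis by (simp add: critical_chains_empty)
  qed
qed

context
  fixes m :: nat and B :: "'n set"
  assumes m: "m < q" and proper: "E m \<subset> B" and earlier: "\<exists>i<m. E i \<subseteq> B"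
    and critical: "critical_chains (\<subset>) (blocks_below m B) (edge_chains m B)"
begin

lemma new_edge_notin: "E m \<notin> blocks_below m B"
  using blocks_below_not_subset_edge[OF m] by blast

lemma below_new_edge: "{Y\<in>blocks_below m B. Y \<subset> E m} = {}"
  using blocks_below_not_subset_edge[OF m] by blast

lemma edge_chains_critical_trapped:
  assumes cover: "B \<subseteq> E m \<union> restriction m"
  shows "critical_chains (\<subset>) (blocks_below (Suc m) B) (edge_chains (Suc m) B)"
proof -
  have "X \<in> insert (E m) (blocks_below m B)" if X: "X \<in> blocks_below (Suc m) B" for X
  proof (cases "X = E m \<or> \<not> E m \<subseteq> X")
    case True
    then show ?thesis using X unfolding blocks_below_def by (auto simp: less_Suc_eq)
  next
    case False
    then obtain v where "v \<in> X" "v \<notin> E m" by auto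
    then have "v \<in> restriction m" using cover X unfolding blocks_below_def by auto
    then have "\<exists>i<m. E i \<subseteq> X"
      using restriction_earlier[of v m X] \<open>v \<in> X\<close> False by auto
    then show ?thesis using X unfolding blocks_below_def by auto
  qed
  moreover have "insert (E m) (blocks_below m B) \<subseteq> blocks_below (Suc m) B"
    using proper unfolding blocks_below_def by (auto simp: less_Suc_eq)
  ultimately have below: "blocks_below (Suc m) B = insert (E m) (blocks_below m B)" by blast
  have through: "chains_through {{}} (E m) {flag_chain m B} = {edge_chain m B}"
    using proper unfolding chains_through_bottom edge_chain_def by auto
  have "critical_chains (\<subset>) (insert (E m) (blocks_below m B))
    (edge_chains m B \<union> chains_through {{}} (E m) {flag_chain m B})"
  proof (rule inclusion.critical_chains_insert[OF _ new_edge_notin critical])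
    show "max_chain (\<subset>) (insert (E m) (blocks_below m B)) c" if "c \<in> edge_chains m B" for c
      using max_chain_edge_chains[OF that, of "Suc m"] m unfolding below by simp
    show "critical_chains (\<subset>) {Y\<in>blocks_below m B. Y \<subset> E m} {{}}"
      unfolding below_new_edge by (rule critical_chains_void)
    have "{Z\<in>blocks_below m B. E m \<subset> Z} = {Z. E m \<subset> Z \<and> Z \<subset> B}"
      using below unfolding blocks_below_def by (auto simp: less_Suc_eq set_eq_iff)
    then show "critical_chains (\<subset>) {Z\<in>blocks_below m B. E m \<subset> Z} {flag_chain m B}"
      using flag_chain_critical[OF proper] by simp
    show "max_chain (\<subset>) (insert (E m) (blocks_below m B)) c" if "c \<in> chains_through {{}} (E m) {flag_chain m B}" for c
      using that max_chain_edge_chain[of m "Suc m" B] m proper unfolding through below by auto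
  qed simp
  then show ?thesis
    using psubset_imp_subset[OF proper] cover unfolding below through trapping_indices_Suc by simp
qed

lemma collapsible_above_new_edge:
  assumes uncovered: "\<not> B \<subseteq> E m \<union> restriction m"
  shows "collapsible (order_complex (\<subset>) {Z\<in>blocks_below m B. E m \<subset> Z})"
proof -
  define a where "a = B \<inter> (E m \<union> restriction m)"
  let ?U = "{Z\<in>blocks_below m B. E m \<subset> Z}"
  have meet: "Z \<inter> a \<in> ?U" if Z: "E m \<subseteq> Z" "Z \<subseteq> B" "\<exists>i<m. E i \<subseteq> Z" for Z
  proof -
    obtain i where i: "i < m" "E i \<subseteq> Z" using Z by auto
    obtain v where v: "v \<in> E i" "v \<in> restriction m" using edge_meets_restriction[OF i(1) m] by auto
    have vZ: "v \<in> Z \<inter> a" and EZ: "E m \<subseteq> Z \<inter> a"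
      using v i Z proper unfolding a_def by auto
    have "v \<notin> E m" using v(2) unfolding restriction_def by auto
    then have "E m \<subset> Z \<inter> a" using vZ EZ by auto
    moreover have "Z \<inter> a \<subset> B" using uncovered unfolding a_def by auto
    ultimately show ?thesis using restriction_earlier[OF v(2) vZ EZ] unfolding blocks_below_def by auto
  qed
  show ?thesis
  proof (rule inclusion.collapsible_order_complex_meet[where a = a and m = "\<lambda>Z. Z \<inter> a"])
    have "B \<inter> a = a" unfolding a_def by auto
    then show "a \<in> ?U" using meet[of B] proper earlier by auto
    fix Z assume Z: "Z \<in> ?U"
    have "Z \<inter> a \<in> ?U" by (rule meet) (use Z in \<open>auto simp: blocks_below_def\<close>)
    then show "Z \<inter> a \<in> ?U \<and> (Z \<inter> a = Z \<or> Z \<inter> a \<subset> Z) \<and> (Z \<inter> a = a \<or> Z \<inter> a \<subset> a)" by auto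
    fix Y assume "Y \<subset> Z" "Y = a \<or> Y \<subset> a"
    then show "Y = Z \<inter> a \<or> Y \<subset> Z \<inter> a" by auto
  qed simp
qed

lemma edge_chains_critical_untrapped:
  assumes uncovered: "\<not> B \<subseteq> E m \<union> restriction m"
  shows "critical_chains (\<subset>) (blocks_below (Suc m) B) (edge_chains (Suc m) B)"
proof -
  let ?Y = "insert (E m) (blocks_below m B)"
  have Y_subset: "?Y \<subseteq> blocks_below (Suc m) B"
    using proper unfolding blocks_below_def by (auto simp: less_Suc_eq)
  have edge_chains_max: "max_chain (\<subset>) (blocks_below (Suc m) B) c" if "c \<in> edge_chains m B" for c
    using max_chain_edge_chains[OF that, of "Suc m"] m by simp
  have "critical_chains (\<subset>) ?Y (edge_chains m B \<union> chains_through {{}} (E m) {})"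
  proof (rule inclusion.critical_chains_insert[OF _ new_edge_notin critical])
    show "max_chain (\<subset>) ?Y c" if "c \<in> edge_chains m B" for c
      using max_chain_restrict[OF edge_chains_max[OF that] _ Y_subset] critical_chains_subset[OF critical that] by auto
    show "critical_chains (\<subset>) {Z\<in>blocks_below m B. Z \<subset> E m} {{}}"
      unfolding below_new_edge by (rule critical_chains_void)
    show "critical_chains (\<subset>) {Z\<in>blocks_below m B. E m \<subset> Z} {}"
      using collapsible_above_new_edge[OF uncovered] unfolding critical_chains_empty by simp
  qed simp_all
  then have crit: "critical_chains (\<subset>) ?Y (edge_chains m B)" by simp
  have "critical_chains (\<subset>) (blocks_below (Suc m) B) (edge_chains m B)"
  proof (rule inclusion.critical_chains_superset[OF _ Y_subset crit edge_chains_max])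
    fix X assume "X \<in> blocks_below (Suc m) B - ?Y"
    then have X: "E m \<subset> X" "\<not> (\<exists>i<m. E i \<subseteq> X)"
      unfolding blocks_below_def by (auto simp: less_Suc_eq)
    then have "Z \<notin> blocks_below m B" if "Z \<subset> X" for Z
      using that unfolding blocks_below_def by blast
    then have "{Z\<in>?Y. Z \<subset> X} = {E m}" using X(1) by auto
    then show "collapsible (order_complex (\<subset>) {Z\<in>?Y. Z \<subset> X})"
      using collapsible_order_complex_cone[of "{E m}" "E m" "(\<subset>)"] by (simp add: comparable_def)
  qed simp
  then show ?thesis using uncovered unfolding trapping_indices_Suc by simp
qed

end

theorem blocks_below_critical:
  "m \<le> q \<Longrightarrow> \<exists>i<m. E i \<subseteq> B \<Longrightarrow> critical_chains (\<subset>) (blocks_below m B) (edge_chains m B)"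
proof (induction m)
  case 0
  then show ?case by simp
next
  case (Suc m)
  have m: "m < q" using Suc.prems(1) by simp
  consider "\<not> E m \<subseteq> B" | "E m \<subseteq> B" "\<not> (\<exists>i<m. E i \<subseteq> B)" | "E m \<subseteq> B" "\<exists>i<m. E i \<subseteq> B" by auto
  then show ?case
  proof cases
    case 1
    then have "\<exists>i<m. E i \<subseteq> B" using Suc.prems(2) by (auto simp: less_Suc_eq)
    then show ?thesis using Suc.IH Suc.prems(1) edge_chains_critical_skip[OF 1] by simp
  next
    case 2
    then show ?thesis by (rule edge_chains_critical_first)
  next
    case 3
    obtain i where i: "i < m" "E i \<subseteq> B" using 3(2) by auto
    then have "E m \<noteq> B" using edge_antichain[of i m] m by auto
    then have proper: "E m \<subset> B" using 3(1) by auto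
    have "critical_chains (\<subset>) (blocks_below m B) (edge_chains m B)" using Suc.IH 3(2) m by simp
    then show ?thesis
      using edge_chains_critical_trapped[OF m proper 3(2)] edge_chains_critical_untrapped[OF m proper 3(2)]
      by blast
  qed
qed

end

section \<open>Sets meeting the blocks of a family\<close>

context shelled_edges
begin

definition edge_unions :: "'n set set" where
  "edge_unions = {X. \<forall>x\<in>X. \<exists>i<q. E i \<subseteq> X \<and> x \<in> E i}"

lemma edge_unionsI: "(\<And>x. x \<in> X \<Longrightarrow> \<exists>i<q. E i \<subseteq> X \<and> x \<in> E i) \<Longrightarrow> X \<in> edge_unions"
  unfolding edge_unions_def by simp

lemma edge_unionsE:
  assumes "X \<in> edge_unions" "x \<in> X"
  obtains i where "i < q" "E i \<subseteq> X" "x \<in> E i"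
  using assms unfolding edge_unions_def by auto

lemma empty_edge_unions: "{} \<in> edge_unions"
  unfolding edge_unions_def by auto

lemma trapping_edge_unions:
  assumes i: "i \<in> trapping_indices q B" and X: "E i \<subseteq> X" "X \<subseteq> B"
  shows "X \<in> edge_unions"
proof (rule edge_unionsI)
  fix x assume x: "x \<in> X"
  note i_less = trapping_less[OF i]
  show "\<exists>i<q. E i \<subseteq> X \<and> x \<in> E i"
  proof (cases "x \<in> E i")
    case True
    then show ?thesis using i_less X(1) by auto
  next
    case False
    then have "x \<in> restriction i" using trapping_cover[OF i] X(2) x by auto
    then obtain k where k: "k < i" "E k \<subseteq> insert x (E i)" using restriction_edge by metis
    have "\<not> E k \<subseteq> E i" using edge_antichain[of k i] k(1) i_less by auto
    then have "x \<in> E k" "E k \<subseteq> X" using k(2) x X(1) by auto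
    then show ?thesis using k(1) i_less by (intro exI[of _ k]) simp
  qed
qed

definition blockwise :: "'n set set \<Rightarrow> 'n set \<Rightarrow> bool" where
  "blockwise P X \<longleftrightarrow> (\<forall>A\<in>P. X \<inter> A = {} \<or> X \<inter> A \<in> blocks)"

definition traced_sets :: "'n set set \<Rightarrow> 'n set set" where
  "traced_sets P = {X. X \<noteq> {} \<and> X \<subset> \<Union>P \<and> blockwise P X}"

text \<open>A family strictly finer than \<open>P\<close> on a smaller ground set lies below \<open>traces P X\<close>, where \<open>X\<close> is
  its union; this closure reduces such families to \<open>traced_sets P\<close>.\<close>
definition traces :: "'n set set \<Rightarrow> 'n set \<Rightarrow> 'n set set" where
  "traces P X = (\<lambda>A. X \<inter> A) ` P - {{}}"

lemma Union_traces:
  assumes "X \<subseteq> \<Union>P"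
  shows "\<Union>(traces P X) = X"
proof
  show "\<Union>(traces P X) \<subseteq> X" unfolding traces_def by auto
  show "X \<subseteq> \<Union>(traces P X)"
  proof
    fix x assume x: "x \<in> X"
    then obtain A where A: "A \<in> P" "x \<in> A" using assms by auto
    then have "X \<inter> A \<in> traces P X" using x unfolding traces_def by auto
    then show "x \<in> \<Union>(traces P X)" using x A by blast
  qed
qed

lemma traces_mono:
  assumes "X \<subseteq> Y"
  shows "finer (traces P X) (traces P Y)"
proof (rule finerI)
  fix C assume "C \<in> traces P X"
  then obtain A where A: "A \<in> P" "C = X \<inter> A" "X \<inter> A \<noteq> {}"
    unfolding traces_def by auto
  then have "Y \<inter> A \<in> traces P Y" using assms unfolding traces_def by auto
  moreover have "C \<subseteq> Y \<inter> A" using A(2) assms by auto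
  ultimately show "\<exists>Z\<in>traces P Y. C \<subseteq> Z" by (rule bexI[rotated])
qed

lemma finer_traces_iff:
  assumes "X \<subseteq> \<Union>P" "Y \<subseteq> \<Union>P"
  shows "finer (traces P X) (traces P Y) \<longleftrightarrow> X \<subseteq> Y"
  using finer_Union[of "traces P X" "traces P Y"] traces_mono[of X Y P]
  unfolding Union_traces[OF assms(1)] Union_traces[OF assms(2)] by blast

lemma strictly_finer_traces_iff:
  "X \<subseteq> \<Union>P \<Longrightarrow> Y \<subseteq> \<Union>P \<Longrightarrow> strictly_finer (traces P X) (traces P Y) \<longleftrightarrow> X \<subset> Y"
  unfolding strictly_finer_def using finer_traces_iff[of X P Y] finer_traces_iff[of Y P X] by auto

lemma traces_families:
  assumes P: "P \<in> families" and X: "blockwise P X"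
  shows "traces P X \<in> families"
proof (rule familiesI)
  show "C \<in> blocks" if "C \<in> traces P X" for C using that X unfolding traces_def blockwise_def by auto
  show "C = C'" if C: "C \<in> traces P X" "C' \<in> traces P X" "x \<in> C" "x \<in> C'" for C C' x
  proof -
    obtain A A' where "A \<in> P" "A' \<in> P" "C = X \<inter> A" "C' = X \<inter> A'"
      using C unfolding traces_def by auto
    then show ?thesis using families_unique[OF P, of A A' x] C by auto
  qed
qed

lemma traces_finer: "finer (traces P X) P"
  unfolding traces_def finer_def by auto

lemma traces_Union:
  assumes "P \<in> families"
  shows "traces P (\<Union>P) = P"
proof -
  have "\<Union>P \<inter> A = A" if "A \<in> P" for A using that by auto
  then have "(\<lambda>A. \<Union>P \<inter> A) ` P = P" by (auto simp: image_iff)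
  then show ?thesis unfolding traces_def using families_nonempty[OF assms] by auto
qed

lemma inj_on_traces: "inj_on (traces P) {X. X \<subseteq> \<Union>P}"
  by (rule inj_on_inverseI[of _ "\<Union>"]) (auto simp: Union_traces)

lemma inj_on_traces_traced_sets: "inj_on (traces P) (traced_sets P)"
  by (rule inj_on_subset[OF inj_on_traces]) (auto simp: traced_sets_def)

lemma traces_interval:
  assumes P: "P \<in> families" and X: "X \<in> traced_sets P"
  shows "traces P X \<in> interval {} P"
proof -
  have X': "X \<noteq> {}" "X \<subset> \<Union>P" "blockwise P X" using X unfolding traced_sets_def by auto
  then have Union_traces_X: "\<Union>(traces P X) = X" by (intro Union_traces) auto
  have "traces P X \<noteq> {}" "traces P X \<noteq> P" using Union_traces_X X'(1,2) by auto
  then show ?thesis unfolding interval_iff[OF empty_families P]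
    using traces_families[OF P X'(3)] traces_finer by (simp add: finer_def)
qed

lemma comparable_traces:
  assumes "X \<in> traced_sets P" "Y \<in> traced_sets P"
  shows "comparable strictly_finer (traces P X) (traces P Y) \<longleftrightarrow> comparable (\<subset>) X Y"
  using assms
proof (rule comparable_embedding[OF inj_on_traces_traced_sets, rotated])
  show "strictly_finer (traces P X) (traces P Y) \<longleftrightarrow> X \<subset> Y" if "X \<in> traced_sets P" "Y \<in> traced_sets P" for X Y
    using that by (intro strictly_finer_traces_iff) (auto simp: traced_sets_def)
qed

lemma max_chain_traced_sets:
  assumes P: "P \<in> families" and c: "c \<subseteq> traced_sets P"
    and saturated: "refinement.saturated families {} (traces P ` c) P"
  shows "max_chain (\<subset>) (traced_sets P) c"
proof -
  have "traces P ` traced_sets P \<subseteq> interval {} P"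
    using traces_interval[OF P] by (rule image_subsetI)
  then have "max_chain strictly_finer (traces P ` traced_sets P) (traces P ` c)"
    by (rule max_chain_restrict[OF refinement.saturated_max_chain[OF saturated] image_mono[OF c]])
  then show ?thesis using max_chain_image[OF inj_on_traces_traced_sets comparable_traces c] by simp
qed

subsection \<open>Trapping every block of a family\<close>

definition trappings :: "'n set set \<Rightarrow> ('n set \<times> nat) set set" where
  "trappings P = {D. fst ` D = P \<and> inj_on fst D \<and> (\<forall>p\<in>D. snd p \<in> trapping_indices q (fst p))}"

definition trapping_size :: "('n set \<times> nat) set \<Rightarrow> nat" where
  "trapping_size D = (\<Sum>p\<in>D. card (fst p) - card (E (snd p)) + 1)"

lemma
  assumes "D \<in> trappings P"
  shows trappings_fst: "fst ` D = P"
    and trappings_inj: "inj_on fst D"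
    and trappings_index: "p \<in> D \<Longrightarrow> snd p \<in> trapping_indices q (fst p)"
  using assms unfolding trappings_def by auto

lemma trappings_finite: "D \<in> trappings P \<Longrightarrow> finite D"
  unfolding trappings_def using finite_imageD[of fst D] by simp

lemma trappings_block:
  assumes D: "D \<in> trappings P" and A: "A \<in> P"
  shows "A \<in> edge_unions"
proof -
  obtain p where p: "p \<in> D" "fst p = A" using A trappings_fst[OF D] by auto
  then have "snd p \<in> trapping_indices q A" using trappings_index[OF D] by auto
  then show ?thesis using trapping_edge_unions trapping_subset by blast
qed

lemma trappings_insertI:
  assumes "B \<notin> P" "D \<in> trappings P" "i \<in> trapping_indices q B"
  shows "insert (B, i) D \<in> trappings (insert B P)"
proof -
  have "fst p \<noteq> B" if "p \<in> D" for p using that assms(1) trappings_fst[OF assms(2)] by auto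
  then show ?thesis using assms(2,3) unfolding trappings_def by (auto simp: inj_on_def)
qed

lemma trappings_insertE:
  assumes "B \<notin> P" and D': "D' \<in> trappings (insert B P)"
  obtains D i where "D \<in> trappings P" "i \<in> trapping_indices q B" "D' = insert (B, i) D"
proof -
  obtain p where p: "p \<in> D'" "fst p = B" using trappings_fst[OF D'] by (metis imageE insertI1)
  let ?D = "D' - {p}"
  have "fst ` ?D = fst ` D' - {fst p}"
    using inj_on_image_set_diff[OF trappings_inj[OF D'], of D' "{p}"] p(1) by auto
  then have "fst ` ?D = P" using trappings_fst[OF D'] p(2) assms(1) by auto
  moreover have "inj_on fst ?D" using trappings_inj[OF D'] by (rule inj_on_subset) auto
  ultimately have "?D \<in> trappings P" using trappings_index[OF D'] unfolding trappings_def by auto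
  moreover have "snd p \<in> trapping_indices q B" using trappings_index[OF D' p(1)] p(2) by simp
  moreover have "D' = insert (B, snd p) ?D" using p by (cases p) auto
  ultimately show thesis by (rule that)
qed

lemma trappings_singleton: "trappings {B} = (\<lambda>i. {(B, i)}) ` trapping_indices q B"
proof (intro equalityI subsetI)
  fix D' assume "D' \<in> trappings {B}"
  then obtain D i where D: "D \<in> trappings {}" "i \<in> trapping_indices q B" "D' = insert (B, i) D"
    using trappings_insertE[of B "{}"] by auto
  moreover have "D = {}" using trappings_fst[OF D(1)] by simp
  ultimately show "D' \<in> (\<lambda>i. {(B, i)}) ` trapping_indices q B" by simp
qed (auto simp: trappings_def)

lemma trapping_size_insert:
  assumes D: "D \<in> trappings P" and B: "B \<notin> P"
  shows "trapping_size (insert (B, i) D) = (card B - card (E i) + 1) + trapping_size D"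
proof -
  have "(B, i) \<notin> D" using trappings_fst[OF D] B by (metis fst_conv imageI)
  then show ?thesis unfolding trapping_size_def by (simp add: sum.insert[OF trappings_finite[OF D]])
qed

definition traps :: "'n set set \<Rightarrow> ('n set \<times> nat) set \<Rightarrow> 'n set set \<Rightarrow> bool" where
  "traps P D c \<longleftrightarrow> c \<subseteq> traced_sets P \<and> refinement.saturated families {} (traces P ` c) P
    \<and> card c + 1 = trapping_size D \<and> (\<forall>X\<in>c. \<forall>A\<in>P. X \<inter> A \<in> edge_unions)"

definition trapping_chains :: "'n set set \<Rightarrow> (('n set \<times> nat) set \<Rightarrow> 'n set set) \<Rightarrow> bool" where
  "trapping_chains P C \<longleftrightarrow> inj_on C (trappings P)
    \<and> critical_chains (\<subset>) (traced_sets P) (C ` trappings P) \<and> (\<forall>D\<in>trappings P. traps P D (C D))"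

lemma
  assumes "traps P D c"
  shows traps_traced_sets: "c \<subseteq> traced_sets P"
    and traps_saturated: "refinement.saturated families {} (traces P ` c) P"
    and traps_card: "card c + 1 = trapping_size D"
    and traps_edge_unions: "X \<in> c \<Longrightarrow> A \<in> P \<Longrightarrow> X \<inter> A \<in> edge_unions"
  using assms unfolding traps_def by auto

lemma
  assumes "trapping_chains P C"
  shows trapping_chains_inj: "inj_on C (trappings P)"
    and trapping_chains_critical: "critical_chains (\<subset>) (traced_sets P) (C ` trappings P)"
    and trapping_chains_traps: "D \<in> trappings P \<Longrightarrow> traps P D (C D)"
  using assms unfolding trapping_chains_def by auto

subsubsection \<open>Trapping a single block\<close>

lemma traced_sets_singleton:
  assumes "B \<in> blocks"
  shows "traced_sets {B} = blocks_below q B"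
proof -
  have "X \<in> traced_sets {B} \<longleftrightarrow> X \<subset> B \<and> X \<in> blocks" for X
  proof (cases "X \<subset> B")
    case True
    then have "X \<inter> B = X" by auto
    then show ?thesis using True block_nonempty[of X] by (auto simp: traced_sets_def blockwise_def)
  qed (simp add: traced_sets_def)
  then show ?thesis unfolding blocks_below_def blocks_def by auto
qed

lemma traps_edge_chain:
  assumes B: "B \<in> blocks" and i: "i \<in> trapping_indices q B"
  shows "traps {B} {(B, i)} (edge_chain i B)"
  unfolding traps_def
proof (intro conjI ballI)
  note q = trapping_less[OF i] trapping_subset[OF i]
  show sub: "edge_chain i B \<subseteq> traced_sets {B}"
    unfolding traced_sets_singleton[OF B] by (rule edge_chain_blocks_below[OF q])
  have "traces {B} X = {X}" if "X \<in> edge_chain i B" for X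
    using subsetD[OF sub that] unfolding traced_sets_def traces_def by (auto simp: Int_absorb2)
  then have "traces {B} ` edge_chain i B = (\<lambda>Z. {Z}) ` edge_chain i B" by auto
  then show "refinement.saturated families {} (traces {B} ` edge_chain i B) {B}"
    using edge_chain_saturated[OF q] by simp
  show "card (edge_chain i B) + 1 = trapping_size {(B, i)}"
    using card_edge_chain[OF q(2)] by (simp add: trapping_size_def)
  fix X A assume X: "X \<in> edge_chain i B" and "A \<in> {B}"
  then have "X \<inter> A = X" using edge_chain_upper[OF q(2) X] by auto
  then show "X \<inter> A \<in> edge_unions"
    using trapping_edge_unions[OF i edge_chain_lower[OF q(2) X]] edge_chain_upper[OF q(2) X] by auto
qed

lemma trapping_chains_singleton:
  assumes B: "B \<in> blocks"
  shows "trapping_chains {B} (\<lambda>D. edge_chain (snd (the_elem D)) B)"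
  unfolding trapping_chains_def
proof (intro conjI ballI)
  let ?C = "\<lambda>D. edge_chain (snd (the_elem D)) B"
  show "inj_on ?C (trappings {B})"
    unfolding trappings_singleton using inj_on_edge_chain[of B] by (auto simp: inj_on_def)
  have "\<exists>i<q. E i \<subseteq> B" using B unfolding blocks_def by auto
  then show "critical_chains (\<subset>) (traced_sets {B}) (?C ` trappings {B})"
    using blocks_below_critical[of q B]
    unfolding traced_sets_singleton[OF B] trappings_singleton by (simp add: image_image)
  show "traps {B} D (?C D)" if "D \<in> trappings {B}" for D
    using that traps_edge_chain[OF B] unfolding trappings_singleton by auto
qed

subsubsection \<open>Trapping one more block\<close>

context
  fixes P :: "'n set set" and B :: "'n set"
  assumes BP: "insert B P \<in> families" "B \<notin> P" and nonempty: "P \<noteq> {}"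
begin

lemma new_block: "B \<in> blocks"
  by (rule families_block[OF BP(1)]) simp

lemma old_families: "P \<in> families"
  by (rule families_subset[OF BP(1)]) auto

lemma new_block_disjoint: "B \<inter> \<Union>P = {}"
  using families_unique[OF BP(1), of B] BP(2) by blast

lemma old_Union_nonempty: "\<Union>P \<noteq> {}"
  using nonempty families_nonempty[OF old_families] by auto

lemma blockwise_insert: "blockwise (insert B P) X \<longleftrightarrow> (X \<inter> B = {} \<or> X \<inter> B \<in> blocks) \<and> blockwise P X"
  unfolding blockwise_def by auto

lemma blockwise_Un: "Z \<subseteq> B \<Longrightarrow> blockwise P (X \<union> Z) \<longleftrightarrow> blockwise P X"
  unfolding blockwise_def
proof (rule ball_cong)
  fix A assume "Z \<subseteq> B" "A \<in> P"
  then have "(X \<union> Z) \<inter> A = X \<inter> A" using new_block_disjoint by auto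
  then show "(X \<union> Z) \<inter> A = {} \<or> (X \<union> Z) \<inter> A \<in> blocks \<longleftrightarrow> X \<inter> A = {} \<or> X \<inter> A \<in> blocks" by simp
qed simp

lemma Union_Int_block: "A \<in> P \<Longrightarrow> \<Union>P \<inter> A = A"
  by auto

lemma blockwise_Union: "blockwise P (\<Union>P)"
  unfolding blockwise_def using families_block[OF old_families] by (simp add: Union_Int_block)

lemma traced_sets_insert:
  "X \<in> traced_sets (insert B P) \<longleftrightarrow>
    X \<noteq> {} \<and> X \<subset> B \<union> \<Union>P \<and> (X \<inter> B = {} \<or> X \<inter> B \<in> blocks) \<and> blockwise P X"
  unfolding traced_sets_def blockwise_insert by simp

lemma old_Union_traced: "\<Union>P \<in> traced_sets (insert B P)"
  unfolding traced_sets_insert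
  using old_Union_nonempty new_block_disjoint block_nonempty[OF new_block] blockwise_Union by auto

lemma block_traced:
  assumes Z: "Z \<in> blocks" "Z \<subseteq> B"
  shows "Z \<in> {X\<in>traced_sets (insert B P). \<not> \<Union>P \<subseteq> X \<and> X \<inter> B \<subseteq> Z}"
proof -
  have "blockwise P {}" unfolding blockwise_def by simp
  then have "blockwise P Z" using blockwise_Un[OF Z(2), of "{}"] by simp
  moreover have "\<not> \<Union>P \<subseteq> Z" using new_block_disjoint old_Union_nonempty Z(2) by blast
  moreover have "Z \<inter> B = Z" using Z(2) by auto
  ultimately show ?thesis using Z block_nonempty[OF Z(1)] unfolding traced_sets_insert by auto
qed

lemma Un_block_traced:
  assumes Z: "Z \<in> blocks" "Z \<subseteq> B"
    and X: "X \<in> {X\<in>traced_sets (insert B P). \<not> \<Union>P \<subseteq> X \<and> X \<inter> B \<subseteq> Z}"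
  shows "X \<union> Z \<in> {X\<in>traced_sets (insert B P). \<not> \<Union>P \<subseteq> X \<and> X \<inter> B \<subseteq> Z}"
proof -
  have "(X \<union> Z) \<inter> B = Z" using X Z(2) by auto
  moreover have "\<not> \<Union>P \<subseteq> X \<union> Z" using X Z(2) new_block_disjoint by blast
  ultimately show ?thesis using X Z blockwise_Un[OF Z(2)] unfolding traced_sets_insert by auto
qed

lemma collapsible_traced_sets_block:
  assumes Z: "Z \<in> blocks" "Z \<subseteq> B"
  shows "collapsible (order_complex (\<subset>) {X\<in>traced_sets (insert B P). \<not> \<Union>P \<subseteq> X \<and> X \<inter> B \<subseteq> Z})"
proof (rule inclusion.collapsible_order_complex_join[OF _ block_traced[OF Z], where m = "\<lambda>X. X \<union> Z"])
  let ?L = "{X\<in>traced_sets (insert B P). \<not> \<Union>P \<subseteq> X \<and> X \<inter> B \<subseteq> Z}"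
  show "X \<union> Z \<in> ?L \<and> (X \<union> Z = X \<or> X \<subset> X \<union> Z) \<and> (X \<union> Z = Z \<or> Z \<subset> X \<union> Z)" if "X \<in> ?L" for X
    using Un_block_traced[OF Z that] by blast
  show "Y = X \<union> Z \<or> X \<union> Z \<subset> Y" if "X \<subset> Y" "Y = Z \<or> Z \<subset> Y" for X Y
    using that by blast
qed simp

lemma collapsible_traced_sets_except_Union:
  "collapsible (order_complex (\<subset>) (traced_sets (insert B P) - {\<Union>P}))"
proof -
  let ?X = "traced_sets (insert B P) - {\<Union>P}" and ?Y = "{X\<in>traced_sets (insert B P). \<not> \<Union>P \<subseteq> X}"
  have "critical_chains (\<subset>) ?X {}"
  proof (rule inclusion.critical_chains_superset)
    have "?Y = {X\<in>traced_sets (insert B P). \<not> \<Union>P \<subseteq> X \<and> X \<inter> B \<subseteq> B}" by auto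
    then show "critical_chains (\<subset>) ?Y {}"
      using collapsible_traced_sets_block[OF new_block order_refl] by (simp add: critical_chains_empty)
    fix X assume X: "X \<in> ?X - ?Y"
    define Z where "Z = X \<inter> B"
    have X': "\<Union>P \<subseteq> X" "X \<noteq> \<Union>P" and traced: "X \<in> traced_sets (insert B P)"
      using X by auto
    have Xeq: "X = \<Union>P \<union> Z" using X'(1) traced unfolding traced_sets_insert Z_def by blast
    then have "Z \<noteq> {}" using X'(2) by auto
    then have Z: "Z \<in> blocks" "Z \<subseteq> B" using traced unfolding traced_sets_insert Z_def by auto
    have "Y \<subset> X \<longleftrightarrow> Y \<inter> B \<subseteq> Z" if "Y \<in> ?Y" for Y
    proof -
      have "Y \<subseteq> B \<union> \<Union>P" "\<not> \<Union>P \<subseteq> Y"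
        using that unfolding mem_Collect_eq traced_sets_insert by auto
      then show ?thesis using Z(2) new_block_disjoint unfolding Xeq by blast
    qed
    then have "{Y\<in>?Y. Y \<subset> X} = {X\<in>traced_sets (insert B P). \<not> \<Union>P \<subseteq> X \<and> X \<inter> B \<subseteq> Z}" by blast
    then show "collapsible (order_complex (\<subset>) {Y\<in>?Y. Y \<subset> X})"
      using collapsible_traced_sets_block[OF Z] by simp
  qed auto
  then show ?thesis by (simp add: critical_chains_empty)
qed

lemma traced_sets_below_Union: "{Y\<in>traced_sets (insert B P) - {\<Union>P}. Y \<subset> \<Union>P} = traced_sets P"
proof (rule set_eqI)
  fix Y
  have "Y \<inter> B = {}" if "Y \<subset> \<Union>P" using that new_block_disjoint by blast
  then show "Y \<in> {Y\<in>traced_sets (insert B P) - {\<Union>P}. Y \<subset> \<Union>P} \<longleftrightarrow> Y \<in> traced_sets P"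
    unfolding mem_Collect_eq Diff_iff traced_sets_insert by (auto simp: traced_sets_def)
qed

lemma traced_sets_above_Union:
  "{Z\<in>traced_sets (insert B P) - {\<Union>P}. \<Union>P \<subset> Z} = (\<union>) (\<Union>P) ` blocks_below q B"
proof (intro equalityI subsetI)
  fix Z assume Z: "Z \<in> {Z\<in>traced_sets (insert B P) - {\<Union>P}. \<Union>P \<subset> Z}"
  then have above: "\<Union>P \<subset> Z" and traced: "Z \<in> traced_sets (insert B P)" by auto
  have Zeq: "Z = \<Union>P \<union> (Z \<inter> B)" using above traced unfolding traced_sets_insert by blast
  then have "Z \<inter> B \<noteq> {}" using above by auto
  moreover have "Z \<inter> B \<noteq> B" using Zeq traced unfolding traced_sets_insert by blast
  ultimately have "Z \<inter> B \<in> blocks" "Z \<inter> B \<subset> B"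
    using traced unfolding traced_sets_insert by auto
  then have "Z \<inter> B \<in> blocks_below q B" unfolding blocks_below_def blocks_def by auto
  then show "Z \<in> (\<union>) (\<Union>P) ` blocks_below q B" using Zeq by (rule image_eqI[rotated])
next
  fix Z assume "Z \<in> (\<union>) (\<Union>P) ` blocks_below q B"
  then obtain Y where Y: "Z = \<Union>P \<union> Y" "Y \<subset> B" "Y \<in> blocks"
    unfolding blocks_below_def blocks_def by auto
  have "Z \<inter> B = Y" "\<Union>P \<subset> Z" "Z \<subset> B \<union> \<Union>P"
    using Y block_nonempty[OF Y(3)] new_block_disjoint by blast+
  moreover have "blockwise P Z" using blockwise_Un[of Y "\<Union>P"] blockwise_Union Y(1,2) by auto
  ultimately show "Z \<in> {Z\<in>traced_sets (insert B P) - {\<Union>P}. \<Union>P \<subset> Z}"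
    using Y(3) unfolding mem_Collect_eq Diff_iff traced_sets_insert by auto
qed

lemma inj_on_Union_Un: "inj_on ((\<union>) (\<Union>P)) (Pow B)"
  by (rule inj_on_inverseI[of _ "\<lambda>Z. Z \<inter> B"]) (use new_block_disjoint in auto)

lemma blocks_below_Pow: "blocks_below m B \<subseteq> Pow B"
  unfolding blocks_below_def by auto

lemma critical_chains_above_Union:
  "critical_chains (\<subset>) {Z\<in>traced_sets (insert B P) - {\<Union>P}. \<Union>P \<subset> Z} ((`) ((\<union>) (\<Union>P)) ` edge_chains q B)"
  unfolding traced_sets_above_Union
proof (rule critical_chains_image[OF inj_on_subset[OF inj_on_Union_Un blocks_below_Pow]])
  have "\<exists>i<q. E i \<subseteq> B" using new_block unfolding blocks_def by auto
  then show "critical_chains (\<subset>) (blocks_below q B) (edge_chains q B)"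
    by (rule blocks_below_critical[OF order_refl])
  show "comparable (\<subset>) (\<Union>P \<union> Z) (\<Union>P \<union> Z') \<longleftrightarrow> comparable (\<subset>) Z Z'"
    if "Z \<in> blocks_below q B" "Z' \<in> blocks_below q B" for Z Z'
  proof -
    have "Z \<subseteq> B" "Z' \<subseteq> B" using that blocks_below_Pow by auto
    then have "\<Union>P \<union> Z \<subseteq> \<Union>P \<union> Z' \<longleftrightarrow> Z \<subseteq> Z'" "\<Union>P \<union> Z' \<subseteq> \<Union>P \<union> Z \<longleftrightarrow> Z' \<subseteq> Z"
      using new_block_disjoint by blast+
    then show ?thesis unfolding comparable_psubset by simp
  qed
qed

lemma traces_insert_old:
  assumes "X \<subseteq> \<Union>P"
  shows "traces (insert B P) X = traces P X"
proof -
  have "X \<inter> B = {}" using assms new_block_disjoint by auto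
  then show ?thesis unfolding traces_def by simp
qed

lemma traces_insert_new:
  assumes Z: "Z \<subseteq> B" "Z \<noteq> {}"
  shows "traces (insert B P) (\<Union>P \<union> Z) = P \<union> {Z}"
proof -
  have "(\<Union>P \<union> Z) \<inter> A = A" if "A \<in> P" for A using that Z(1) new_block_disjoint by auto
  then have "(\<lambda>A. (\<Union>P \<union> Z) \<inter> A) ` P = P" by auto
  moreover have "(\<Union>P \<union> Z) \<inter> B = Z" using Z(1) new_block_disjoint by auto
  moreover have "{} \<notin> P" using families_nonempty[OF old_families] by auto
  ultimately show ?thesis unfolding traces_def using Z(2) by simp
qed

definition extend_chain :: "nat \<Rightarrow> 'n set set \<Rightarrow> 'n set set" where
  "extend_chain i c = c \<union> insert (\<Union>P) ((\<union>) (\<Union>P) ` edge_chain i B)"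

context
  fixes i :: nat
  assumes i: "i \<in> trapping_indices q B"
begin

lemma edge_chain_member:
  assumes "Z \<in> edge_chain i B"
  shows "Z \<subseteq> B" "Z \<noteq> {}" "Z \<in> edge_unions"
proof -
  note Z = edge_chain_lower[OF trapping_subset[OF i] assms] edge_chain_upper[OF trapping_subset[OF i] assms]
  show "Z \<subseteq> B" using Z(2) by simp
  then show "Z \<in> edge_unions" by (rule trapping_edge_unions[OF i Z(1)])
  show "Z \<noteq> {}" using block_nonempty[OF edge_block[OF trapping_less[OF i]]] Z(1) by auto
qed

lemma edge_chain_Pow: "edge_chain i B \<subseteq> Pow B"
  using edge_chain_member(1) by (intro subsetI) simp

lemma Union_edge_chain_above: "(\<union>) (\<Union>P) ` edge_chain i B \<subseteq> {Z\<in>traced_sets (insert B P) - {\<Union>P}. \<Union>P \<subset> Z}"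
  unfolding traced_sets_above_Union
  by (intro image_mono edge_chain_blocks_below[OF trapping_less[OF i] trapping_subset[OF i]])

lemma extend_chain_traced:
  assumes "c \<subseteq> traced_sets P"
  shows "extend_chain i c \<subseteq> traced_sets (insert B P)"
  using assms traced_sets_below_Union Union_edge_chain_above old_Union_traced unfolding extend_chain_def
  by blast

lemma extend_chain_saturated:
  assumes c: "c \<subseteq> traced_sets P" and saturated: "refinement.saturated families {} (traces P ` c) P"
  shows "refinement.saturated families {} (traces (insert B P) ` extend_chain i c) (insert B P)"
proof -
  have "X \<subseteq> \<Union>P" if "X \<in> c" for X using that c unfolding traced_sets_def by auto
  then have "traces (insert B P) ` c = traces P ` c" by (simp add: traces_insert_old)
  moreover have "traces (insert B P) (\<Union>P) = P"
    using traces_insert_old traces_Union[OF old_families] by simp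
  moreover have "traces (insert B P) ` (\<union>) (\<Union>P) ` edge_chain i B = (\<union>) P ` (\<lambda>Z. {Z}) ` edge_chain i B"
    unfolding image_image using edge_chain_member by (intro image_cong) (simp_all add: traces_insert_new)
  ultimately have "traces (insert B P) ` extend_chain i c
    = traces P ` c \<union> insert P ((\<union>) P ` (\<lambda>Z. {Z}) ` edge_chain i B)"
    unfolding extend_chain_def by (simp add: image_Un)
  moreover have "refinement.saturated families P ((\<union>) P ` (\<lambda>Z. {Z}) ` edge_chain i B) (insert B P)"
    by (rule saturated_Un[OF old_families new_block new_block_disjoint
          edge_chain_saturated[OF trapping_less[OF i] trapping_subset[OF i]]])
  ultimately show ?thesis using refinement.saturated_compose[OF saturated _ old_families] by simp
qed

lemma card_extend_chain:
  assumes "c \<subseteq> traced_sets P"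
  shows "card (extend_chain i c) = card c + (card (edge_chain i B) + 1)"
proof -
  have above: "\<Union>P \<subset> Z" if "Z \<in> (\<union>) (\<Union>P) ` edge_chain i B" for Z
    using subsetD[OF Union_edge_chain_above that] by simp
  have "X \<notin> insert (\<Union>P) ((\<union>) (\<Union>P) ` edge_chain i B)" if "X \<in> c" for X
  proof
    assume "X \<in> insert (\<Union>P) ((\<union>) (\<Union>P) ` edge_chain i B)"
    then have "\<Union>P \<subseteq> X" using above[of X] by (elim insertE) simp_all
    moreover have "X \<subset> \<Union>P" using that assms unfolding traced_sets_def by auto
    ultimately show False by blast
  qed
  then have "c \<inter> insert (\<Union>P) ((\<union>) (\<Union>P) ` edge_chain i B) = {}" by blast
  moreover have "\<Union>P \<notin> (\<union>) (\<Union>P) ` edge_chain i B"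
    using above[of "\<Union>P"] by (intro notI) simp
  moreover have "card ((\<union>) (\<Union>P) ` edge_chain i B) = card (edge_chain i B)"
    by (rule card_image[OF inj_on_subset[OF inj_on_Union_Un edge_chain_Pow]])
  ultimately show ?thesis unfolding extend_chain_def by (simp add: card_Un_disjoint)
qed

lemma extend_chain_edge_unions:
  assumes c: "traps P D c" and D: "D \<in> trappings P" and X: "X \<in> extend_chain i c" and A: "A \<in> insert B P"
  shows "X \<inter> A \<in> edge_unions"
proof -
  have old: "X \<inter> B = {}" if "X \<subseteq> \<Union>P" for X using that new_block_disjoint by auto
  consider "X \<in> c" | Z where "Z = {} \<or> Z \<in> edge_chain i B" "X = \<Union>P \<union> Z"
    using X unfolding extend_chain_def by auto
  then show ?thesis
  proof cases
    case 1
    then have "X \<subseteq> \<Union>P" using traps_traced_sets[OF c] unfolding traced_sets_def by auto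
    then show ?thesis using old[of X] 1 A traps_edge_unions[OF c] empty_edge_unions by auto
  next
    case 2
    then have Z: "Z \<subseteq> B" "Z \<in> edge_unions" using edge_chain_member empty_edge_unions by auto
    have "X \<inter> B = Z" "A \<in> P \<Longrightarrow> X \<inter> A = A"
      using 2(2) Z(1) new_block_disjoint by blast+
    then show ?thesis using A Z(2) trappings_block[OF D, of A] by auto
  qed
qed

lemma traps_extend_chain:
  assumes D: "D \<in> trappings P" and c: "traps P D c"
  shows "traps (insert B P) (insert (B, i) D) (extend_chain i c)"
  unfolding traps_def
proof (intro conjI ballI)
  note sub = traps_traced_sets[OF c]
  show "extend_chain i c \<subseteq> traced_sets (insert B P)" by (rule extend_chain_traced[OF sub])
  show "refinement.saturated families {} (traces (insert B P) ` extend_chain i c) (insert B P)"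
    by (rule extend_chain_saturated[OF sub traps_saturated[OF c]])
  show "card (extend_chain i c) + 1 = trapping_size (insert (B, i) D)"
    unfolding card_extend_chain[OF sub] trapping_size_insert[OF D BP(2)]
    using card_edge_chain[OF trapping_subset[OF i]] traps_card[OF c] by simp
qed (rule extend_chain_edge_unions[OF c D])

end

context
  fixes C :: "('n set \<times> nat) set \<Rightarrow> 'n set set"
  assumes C: "trapping_chains P C"
begin

definition extend_trapping_chain :: "('n set \<times> nat) set \<Rightarrow> 'n set set" where
  "extend_trapping_chain D = extend_chain (snd (the_elem {p\<in>D. fst p = B})) (C {p\<in>D. fst p \<noteq> B})"

lemma extend_trapping_chain_insert:
  assumes "D \<in> trappings P"
  shows "extend_trapping_chain (insert (B, i) D) = extend_chain i (C D)"
proof -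
  have "fst p \<noteq> B" if "p \<in> D" for p using that BP(2) trappings_fst[OF assms] by auto
  then have "{p\<in>insert (B, i) D. fst p = B} = {(B, i)}" "{p\<in>insert (B, i) D. fst p \<noteq> B} = D"
    by auto
  then show ?thesis unfolding extend_trapping_chain_def by simp
qed

lemma inj_on_extend_trapping_chain: "inj_on extend_trapping_chain (trappings (insert B P))"
proof (rule inj_onI)
  fix D1' D2' assume D': "D1' \<in> trappings (insert B P)" "D2' \<in> trappings (insert B P)"
    and eq: "extend_trapping_chain D1' = extend_trapping_chain D2'"
  obtain D1 i1 where split: "D1 \<in> trappings P" "i1 \<in> trapping_indices q B" "D1' = insert (B, i1) D1"
    by (rule trappings_insertE[OF BP(2) D'(1)])
  obtain D2 i2 where split': "D2 \<in> trappings P" "i2 \<in> trapping_indices q B" "D2' = insert (B, i2) D2"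
    by (rule trappings_insertE[OF BP(2) D'(2)])
  have notin: "\<Union>P \<notin> traced_sets P" unfolding traced_sets_def by simp
  have below: "C D \<subseteq> {Y\<in>traced_sets P. Y \<subset> \<Union>P}" if "D \<in> trappings P" for D
    using traps_traced_sets[OF trapping_chains_traps[OF C that]] unfolding traced_sets_def by auto
  have above: "(\<union>) (\<Union>P) ` edge_chain i B \<subseteq> {Z. \<Union>P \<subset> Z}" if "i \<in> trapping_indices q B" for i
    using Union_edge_chain_above[OF that] by auto
  have "extend_chain i1 (C D1) = extend_chain i2 (C D2)"
    using eq unfolding split(3) split'(3) extend_trapping_chain_insert[OF split(1)] extend_trapping_chain_insert[OF split'(1)] .
  then have "C D1 = C D2" and images: "(\<union>) (\<Union>P) ` edge_chain i1 B = (\<union>) (\<Union>P) ` edge_chain i2 B"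
    using inclusion.chain_through_unique[OF _ notin notin below[OF split(1)] below[OF split'(1)] above[OF split(2)] above[OF split'(2)]]
    unfolding extend_chain_def by auto
  then have "D1 = D2" using inj_onD[OF trapping_chains_inj[OF C] _ split(1) split'(1)] by simp
  moreover have "edge_chain i1 B = edge_chain i2 B"
    using inj_on_image_eq_iff[OF inj_on_Union_Un edge_chain_Pow[OF split(2)] edge_chain_Pow[OF split'(2)]] images
    by simp
  then have "i1 = i2" by (rule inj_onD[OF inj_on_edge_chain _ split(2) split'(2)])
  ultimately show "D1' = D2'" using split(3) split'(3) by simp
qed

lemma image_extend_trapping_chain:
  "extend_trapping_chain ` trappings (insert B P)
    = chains_through (C ` trappings P) (\<Union>P) ((`) ((\<union>) (\<Union>P)) ` edge_chains q B)"
proof (intro equalityI subsetI)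
  fix c assume "c \<in> extend_trapping_chain ` trappings (insert B P)"
  then obtain D' where D': "D' \<in> trappings (insert B P)" "c = extend_trapping_chain D'" by auto
  obtain D i where Di: "D \<in> trappings P" "i \<in> trapping_indices q B" "D' = insert (B, i) D"
    by (rule trappings_insertE[OF BP(2) D'(1)])
  have "c = C D \<union> insert (\<Union>P) ((\<union>) (\<Union>P) ` edge_chain i B)"
    using D'(2) extend_trapping_chain_insert[OF Di(1)] unfolding Di(3) extend_chain_def by simp
  then show "c \<in> chains_through (C ` trappings P) (\<Union>P) ((`) ((\<union>) (\<Union>P)) ` edge_chains q B)"
    using Di(1,2) unfolding chains_through_def by blast
next
  fix c assume "c \<in> chains_through (C ` trappings P) (\<Union>P) ((`) ((\<union>) (\<Union>P)) ` edge_chains q B)"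
  then obtain D i where Di: "D \<in> trappings P" "i \<in> trapping_indices q B" "c = extend_chain i (C D)"
    unfolding chains_through_def extend_chain_def by auto
  then have "c = extend_trapping_chain (insert (B, i) D)" using extend_trapping_chain_insert by simp
  then show "c \<in> extend_trapping_chain ` trappings (insert B P)"
    using trappings_insertI[OF BP(2) Di(1,2)] by auto
qed

lemma trapping_chains_insert: "trapping_chains (insert B P) extend_trapping_chain"
  unfolding trapping_chains_def
proof (intro conjI ballI)
  let ?S = "extend_trapping_chain ` trappings (insert B P)" and ?Y = "traced_sets (insert B P) - {\<Union>P}"
  show traps: "traps (insert B P) D' (extend_trapping_chain D')" if D': "D' \<in> trappings (insert B P)" for D'
  proof -
    obtain D i where Di: "D \<in> trappings P" "i \<in> trapping_indices q B" "D' = insert (B, i) D"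
      by (rule trappings_insertE[OF BP(2) D'])
    then show ?thesis
      using traps_extend_chain[OF Di(2,1) trapping_chains_traps[OF C Di(1)]] extend_trapping_chain_insert[OF Di(1)]
      by simp
  qed
  have insert: "insert (\<Union>P) ?Y = traced_sets (insert B P)" using old_Union_traced by auto
  have "critical_chains (\<subset>) (insert (\<Union>P) ?Y)
    ({} \<union> chains_through (C ` trappings P) (\<Union>P) ((`) ((\<union>) (\<Union>P)) ` edge_chains q B))"
  proof (rule inclusion.critical_chains_insert)
    show "critical_chains (\<subset>) ?Y {}"
      using collapsible_traced_sets_except_Union by (simp add: critical_chains_empty)
    show "critical_chains (\<subset>) {Y\<in>?Y. Y \<subset> \<Union>P} (C ` trappings P)"
      unfolding traced_sets_below_Union by (rule trapping_chains_critical[OF C])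
    fix c assume "c \<in> chains_through (C ` trappings P) (\<Union>P) ((`) ((\<union>) (\<Union>P)) ` edge_chains q B)"
    then obtain D where D: "D \<in> trappings (insert B P)" "c = extend_trapping_chain D"
      unfolding image_extend_trapping_chain[symmetric] by auto
    show "max_chain (\<subset>) (insert (\<Union>P) ?Y) c"
      unfolding insert D(2)
      by (rule max_chain_traced_sets[OF BP(1) traps_traced_sets[OF traps[OF D(1)]] traps_saturated[OF traps[OF D(1)]]])
  qed (use critical_chains_above_Union in simp_all)
  then show "critical_chains (\<subset>) (traced_sets (insert B P)) ?S"
    unfolding insert image_extend_trapping_chain by simp
qed (rule inj_on_extend_trapping_chain)

end

end

theorem trapping_chains_exists:
  assumes "P \<in> families" "P \<noteq> {}"
  shows "\<exists>C. trapping_chains P C"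
proof -
  have "finite P" by simp
  then show ?thesis using assms(2,1)
  proof (induction rule: finite_ne_induct)
    case (singleton B)
    then show ?case using trapping_chains_singleton singleton_families by blast
  next
    case (insert B P)
    then obtain C where "trapping_chains P C" using families_subset[OF insert.prems] by blast
    then show ?case using trapping_chains_insert[OF insert.prems insert.hyps(3,2)] by blast
  qed
qed

end

section \<open>Coarsenings of a family\<close>

context block_system
begin

definition coarsenings :: "'n set set \<Rightarrow> 'n set set set" where
  "coarsenings P = interval P {\<Union>P}"

lemma singleton_Union_families: "P \<in> families \<Longrightarrow> P \<noteq> {} \<Longrightarrow> {\<Union>P} \<in> families"
  using Union_block singleton_families by simp

lemma coarsenings_iff:
  assumes P: "P \<in> families" "P \<noteq> {}"
  shows "Q \<in> coarsenings P \<longleftrightarrow> Q \<in> families \<and> finer P Q \<and> Q \<noteq> P \<and> \<Union>Q = \<Union>P \<and> Q \<noteq> {\<Union>P}"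
proof -
  have "finer P Q \<Longrightarrow> \<Union>P \<subseteq> \<Union>Q" by (rule finer_Union)
  then show ?thesis
    unfolding coarsenings_def interval_iff[OF P(1) singleton_Union_families[OF P]] finer_singleton by auto
qed

lemma coarsenings_above:
  assumes "P \<in> families" "P \<noteq> {}" "Q \<in> coarsenings P"
  shows "{Z\<in>coarsenings P. strictly_finer Q Z} = coarsenings Q"
proof -
  have "\<Union>Q = \<Union>P" using assms(3) unfolding coarsenings_iff[OF assms(1,2)] by simp
  moreover have "strictly_finer P Q" using assms(3) unfolding coarsenings_def by simp
  ultimately show ?thesis unfolding coarsenings_def using refinement.trans[of P Q] by auto
qed

lemma coarsening_contains_block:
  assumes Q: "Q \<in> families" "finer P Q" "\<Union>Q = \<Union>P" and C: "C \<in> Q" "x \<in> C"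
  shows "\<exists>A\<in>P. x \<in> A \<and> A \<subseteq> C"
proof -
  have "x \<in> \<Union>P" unfolding Q(3)[symmetric] using C by auto
  then obtain A where A: "A \<in> P" "x \<in> A" by auto
  obtain C' where C': "C' \<in> Q" "A \<subseteq> C'" using finerE[OF Q(2) A(1)] by metis
  have "C' = C" using families_unique[OF Q(1) C'(1) C(1), of x] C' A C by auto
  then show ?thesis using A C' by auto
qed

subsection \<open>Separating a block\<close>

definition split_off :: "'n set \<Rightarrow> 'n set set \<Rightarrow> 'n set set" where
  "split_off a P = {a, \<Union>(P - {a})}"

text \<open>The meet of \<open>Q\<close> and \<open>split_off a P\<close>, for every coarsening \<open>Q\<close> of a family \<open>P\<close> with block \<open>a\<close>.\<close>
definition separate :: "'n set \<Rightarrow> 'n set set \<Rightarrow> 'n set set" where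
  "separate a Q = insert a ((\<lambda>C. C - a) ` Q - {{}})"

lemma separate_cases:
  assumes "X \<in> separate a Q"
  obtains "X = a" | C where "C \<in> Q" "X = C - a" "X \<noteq> {}"
  using assms unfolding separate_def by auto

lemma separate_mem: "a \<in> separate a Q"
  unfolding separate_def by simp

lemma separate_diff: "C \<in> Q \<Longrightarrow> C - a \<noteq> {} \<Longrightarrow> C - a \<in> separate a Q"
  unfolding separate_def by auto

context
  fixes P Q :: "'n set set" and a :: "'n set"
  assumes P: "P \<in> families" "a \<in> P" and Q: "Q \<in> families" "finer P Q" "\<Union>Q = \<Union>P"
begin

lemma other_block_disjoint: "A \<in> P \<Longrightarrow> A \<noteq> a \<Longrightarrow> A \<inter> a = {}"
  using families_unique[OF P(1) _ P(2)] by blast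

lemma diff_block:
  assumes C: "C \<in> Q" "C - a \<noteq> {}"
  shows "C - a \<in> blocks"
proof -
  obtain x where x: "x \<in> C" "x \<notin> a" using C(2) by auto
  obtain A where A: "A \<in> P" "x \<in> A" "A \<subseteq> C"
    using coarsening_contains_block[OF Q C(1) x(1)] by auto
  have "A \<subseteq> C - a" using other_block_disjoint[OF A(1)] A(2,3) x(2) by blast
  then show ?thesis using block_mono[OF families_block[OF P(1) A(1)]] by simp
qed

lemma separate_families: "separate a Q \<in> families"
proof (rule familiesI)
  show "X \<in> blocks" if "X \<in> separate a Q" for X
    using that families_block[OF P] diff_block by (cases rule: separate_cases) auto
  show "X = Y" if X: "X \<in> separate a Q" and Y: "Y \<in> separate a Q" and x: "x \<in> X" "x \<in> Y" for X Y x
    using X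
  proof (cases rule: separate_cases)
    case 1
    from Y show ?thesis using 1 x by (cases rule: separate_cases) auto
  next
    case X: (2 C)
    from Y show ?thesis
    proof (cases rule: separate_cases)
      case 1
      then show ?thesis using X x by auto
    next
      case (2 C')
      then show ?thesis using families_unique[OF Q(1) X(1) 2(1), of x] X(2) x by auto
    qed
  qed
qed

lemma finer_separate: "finer P (separate a Q)"
proof (rule finerI)
  fix A assume A: "A \<in> P"
  show "\<exists>Y\<in>separate a Q. A \<subseteq> Y"
  proof (cases "A = a")
    case True
    then show ?thesis using separate_mem by auto
  next
    case False
    obtain C where C: "C \<in> Q" "A \<subseteq> C" using finerE[OF Q(2) A] by metis
    then have "A \<subseteq> C - a" using other_block_disjoint[OF A False] by auto
    then show ?thesis using separate_diff[OF C(1), of a] families_nonempty[OF P(1) A] by blast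
  qed
qed

lemma separate_finer: "finer (separate a Q) Q"
proof (rule finerI)
  fix X assume "X \<in> separate a Q"
  then show "\<exists>Y\<in>Q. X \<subseteq> Y"
  proof (cases rule: separate_cases)
    case 1
    then show ?thesis using finerE[OF Q(2) P(2)] by metis
  qed auto
qed

lemma separate_finer_split_off: "finer (separate a Q) (split_off a P)"
proof (rule finerI)
  fix X assume "X \<in> separate a Q"
  then show "\<exists>Y\<in>split_off a P. X \<subseteq> Y"
  proof (cases rule: separate_cases)
    case (2 C)
    then have "X \<subseteq> \<Union>P - a" using Q(3) by blast
    then show ?thesis unfolding split_off_def by auto
  qed (auto simp: split_off_def)
qed

lemma Union_separate: "\<Union>(separate a Q) = \<Union>P"
  using finer_Union[OF separate_finer] finer_Union[OF finer_separate] Q(3) by auto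

lemma separate_greatest:
  assumes Z: "Z \<in> families" "finer Z Q" "finer Z (split_off a P)"
  shows "finer Z (separate a Q)"
proof (rule finerI)
  fix X assume X: "X \<in> Z"
  obtain C where C: "C \<in> Q" "X \<subseteq> C" using finerE[OF Z(2) X] by metis
  obtain Y where Y: "Y \<in> split_off a P" "X \<subseteq> Y" using finerE[OF Z(3) X] by metis
  show "\<exists>Y\<in>separate a Q. X \<subseteq> Y"
  proof (cases "Y = a")
    case True
    then show ?thesis using Y(2) separate_mem by auto
  next
    case False
    then have "X \<subseteq> C - a" using C(2) Y other_block_disjoint unfolding split_off_def by blast
    then show ?thesis using separate_diff[OF C(1), of a] families_nonempty[OF Z(1) X] by blast
  qed
qed

lemma separate_eq_cases:
  assumes eq: "separate a Q = P"
  shows "Q = P \<or> (\<exists>b\<in>P - {a}. Q = merge a b P)"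
proof -
  obtain C0 where C0: "C0 \<in> Q" "a \<subseteq> C0" using finerE[OF Q(2) P(2)] by metis
  have other: "C \<in> P" "C \<inter> C0 = {}" if C: "C \<in> Q" "C \<noteq> C0" for C
  proof -
    show "C \<inter> C0 = {}" using families_unique[OF Q(1) C(1) C0(1)] C(2) by auto
    then have "C - a = C" using C0(2) by auto
    then show "C \<in> P" using separate_diff[OF C(1), of a] families_nonempty[OF Q(1) C(1)] eq by simp
  qed
  show ?thesis
  proof (cases "C0 = a")
    case True
    then have "C \<in> P" if "C \<in> Q" for C using other(1)[OF that] P(2) by (cases "C = C0") auto
    then have "finer Q P" unfolding finer_def by blast
    then show ?thesis using finer_antisym[OF Q(1) P(1) _ Q(2)] by simp
  next
    case False
    define b where "b = C0 - a"
    have b: "b \<in> P" using separate_diff[OF C0(1), of a] False C0(2) eq unfolding b_def by auto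
    have C0_eq: "C0 = a \<union> b" using C0(2) unfolding b_def by auto
    have b_neq: "b \<noteq> a" using families_nonempty[OF P] unfolding b_def by auto
    have "finer Q (merge a b P)"
    proof (rule finerI)
      fix C assume C: "C \<in> Q"
      show "\<exists>Y\<in>merge a b P. C \<subseteq> Y"
      proof (cases "C = C0")
        case True
        then show ?thesis unfolding merge_def C0_eq by auto
      next
        case False
        have "C \<noteq> a" "C \<noteq> b"
          using other(2)[OF C False] families_nonempty[OF Q(1) C] unfolding C0_eq by auto
        then show ?thesis using other(1)[OF C False] unfolding merge_def by auto
      qed
    qed
    then show ?thesis using finer_merge_cases[OF P b Q(1,2)] b b_neq by blast
  qed
qed

end

subsection \<open>Critical chains of coarsenings\<close>

lemma card_merge:
  assumes P: "P \<in> families" "a \<in> P" "b \<in> P" "a \<noteq> b"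
  shows "card (merge a b P) = card P - 1"
proof -
  have "2 \<le> card P" using card_mono[of P "{a, b}"] P(2,3,4) by simp
  moreover have "card (P - {a, b}) = card P - 2" using P(2,3,4) by (simp add: card_Diff_subset)
  moreover have "a \<union> b \<notin> P - {a, b}" using merge_union_notin[OF P] by simp
  ultimately show ?thesis unfolding merge_def by simp
qed

definition merges :: "'n set \<Rightarrow> 'n set set \<Rightarrow> 'n set set set" where
  "merges a P = (\<lambda>b. merge a b P) ` (P - {a})"

definition partition_chains :: "'n set set \<Rightarrow> 'n set set set set \<Rightarrow> bool" where
  "partition_chains P S \<longleftrightarrow> critical_chains strictly_finer (coarsenings P) S \<and> card S = fact (card P - 1)
    \<and> (\<forall>c\<in>S. refinement.saturated families P c {\<Union>P} \<and> card c + 2 = card P)"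

lemma
  assumes "partition_chains P S"
  shows partition_chains_critical: "critical_chains strictly_finer (coarsenings P) S"
    and partition_chains_card: "card S = fact (card P - 1)"
    and partition_chains_saturated: "c \<in> S \<Longrightarrow> refinement.saturated families P c {\<Union>P}"
    and partition_chains_length: "c \<in> S \<Longrightarrow> card c + 2 = card P"
    and partition_chains_coarsenings: "c \<in> S \<Longrightarrow> c \<subseteq> coarsenings P"
  using assms critical_chains_subset[of strictly_finer "coarsenings P" S c] unfolding partition_chains_def
  by auto

context
  fixes P :: "'n set set" and a :: "'n set"
  assumes P: "P \<in> families" "a \<in> P"
begin

lemma families_with_block_nonempty: "P \<noteq> {}"
  using P(2) by auto

lemma merge_inj: "inj_on (\<lambda>b. merge a b P) (P - {a})"
proof (rule inj_onI)
  fix b b' assume b: "b \<in> P - {a}" "b' \<in> P - {a}" and eq: "merge a b P = merge a b' P"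
  have "a \<union> b \<in> merge a b' P" unfolding eq[symmetric] by (simp add: merge_def)
  moreover have "a \<union> b \<notin> P" using merge_union_notin[OF P, of b] b by auto
  ultimately have union_eq: "a \<union> b = a \<union> b'" unfolding merge_def by auto
  have "b \<inter> a = {}" "b' \<inter> a = {}"
    using b families_unique[OF P(1) _ P(2)] by blast+
  then show "b = b'" using union_eq by blast
qed

lemma card_merges: "card (merges a P) = card P - 1"
  unfolding merges_def using card_image[OF merge_inj] P(2) by simp

lemma
  assumes x: "x \<in> merges a P"
  shows merges_families: "x \<in> families"
    and merges_saturated: "refinement.saturated families P {} x"
    and merges_Union: "\<Union>x = \<Union>P"
    and merges_card: "card x = card P - 1"
    and merges_notin: "a \<notin> x"
proof -
  obtain b where b: "b \<in> P" "a \<noteq> b" "x = merge a b P" using x unfolding merges_def by auto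
  show "x \<in> families" "refinement.saturated families P {} x" "\<Union>x = \<Union>P" "card x = card P - 1"
    unfolding b(3)
    using merge_families[OF P b(1)] saturated_merge[OF P b(1,2)] Union_merge[OF P(2) b(1)] card_merge[OF P b(1,2)]
    by simp_all
  show "a \<notin> x"
  proof
    assume "a \<in> x"
    then have "b \<subseteq> a" unfolding b(3) merge_def by auto
    then show False using families_unique[OF P(1) b(1) P(2)] families_nonempty[OF P(1) b(1)] b(2) by blast
  qed
qed

lemma nothing_below_merges: "x \<in> merges a P \<Longrightarrow> {Y\<in>coarsenings P. strictly_finer Y x} = {}"
  using refinement.saturated_max_chain[OF merges_saturated] unfolding max_chain_def coarsenings_def by auto

lemma other_blocks_nonempty:
  assumes "2 \<le> card P"
  shows "P - {a} \<noteq> {}"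
proof
  assume "P - {a} = {}"
  then have "card P \<le> 1" using card_mono[of "{a}" P] by simp
  then show False using assms by simp
qed

lemma partition_chains_two:
  assumes "card P = 2"
  shows "partition_chains P {{}}"
proof -
  have "P - {a} \<noteq> {}" using assms by (intro other_blocks_nonempty) simp
  then obtain x where x: "x \<in> merges a P" unfolding merges_def by auto
  have "card x = 1" using merges_card[OF x] assms by simp
  then obtain A where "x = {A}" by (auto simp: card_1_singleton_iff)
  then have "x = {\<Union>P}" using merges_Union[OF x] by simp
  then have saturated: "refinement.saturated families P {} {\<Union>P}" using merges_saturated[OF x] by simp
  then have "coarsenings P = {}"
    using refinement.saturated_max_chain unfolding coarsenings_def max_chain_def by blast
  then show ?thesis using saturated assms critical_chains_void unfolding partition_chains_def by simp
qed

context
  assumes three: "3 \<le> card P"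
begin

lemma block_neq_Union: "a \<noteq> \<Union>P"
proof
  assume aU: "a = \<Union>P"
  have "A = a" if A: "A \<in> P" for A
    using families_unique[OF P(1) A P(2)] families_nonempty[OF P(1) A] A aU by blast
  then have "P = {a}" using P(2) by blast
  then show False using three by simp
qed

lemma merges_coarsenings: "merges a P \<subseteq> coarsenings P"
proof
  fix x assume x: "x \<in> merges a P"
  have "strictly_finer P x" by (rule refinement.saturated_less[OF merges_saturated[OF x]])
  moreover have "x \<noteq> {\<Union>P}" using merges_card[OF x] three by auto
  ultimately show "x \<in> coarsenings P"
    unfolding coarsenings_iff[OF P(1) families_with_block_nonempty]
    using merges_families[OF x] merges_Union[OF x] strictly_finer_iff[OF P(1) merges_families[OF x]] by auto
qed

lemma split_off_families: "split_off a P \<in> families"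
  unfolding split_off_def
proof (rule insert_families)
  have "P - {a} \<noteq> {}" using three by (intro other_blocks_nonempty) simp
  then have "\<Union>(P - {a}) \<in> blocks" by (intro Union_block families_subset[OF P(1)]) auto
  then show "{\<Union>(P - {a})} \<in> families" by (simp add: singleton_families)
  show "a \<inter> \<Union>{\<Union>(P - {a})} = {}" using families_unique[OF P(1) _ P(2)] by blast
qed (rule families_block[OF P])

lemma split_off_coarsening: "split_off a P \<in> coarsenings P - merges a P"
proof -
  have mem: "a \<in> split_off a P" unfolding split_off_def by simp
  have "finer P (split_off a P)" unfolding finer_def split_off_def by auto
  moreover have "card (split_off a P) \<le> 2" unfolding split_off_def by (simp add: card_insert_if)
  then have "split_off a P \<noteq> P" using three by auto
  moreover have "\<Union>(split_off a P) = \<Union>P" unfolding split_off_def using P(2) by auto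
  ultimately show ?thesis
    using split_off_families mem block_neq_Union merges_notin
    unfolding Diff_iff coarsenings_iff[OF P(1) families_with_block_nonempty] by auto
qed

lemma separate_coarsening:
  assumes Q: "Q \<in> coarsenings P - merges a P"
  shows "separate a Q \<in> coarsenings P - merges a P"
proof -
  have Q': "Q \<in> families" "finer P Q" "\<Union>Q = \<Union>P" "Q \<noteq> P"
    using Q unfolding Diff_iff coarsenings_iff[OF P(1) families_with_block_nonempty] by auto
  have "separate a Q \<noteq> P" using separate_eq_cases[OF P Q'(1-3)] Q'(4) Q unfolding merges_def by auto
  then show ?thesis
    using separate_families[OF P Q'(1-3)] finer_separate[OF P Q'(1-3)] Union_separate[OF P Q'(1-3)]
      separate_mem[of a Q] block_neq_Union merges_notin
    unfolding Diff_iff coarsenings_iff[OF P(1) families_with_block_nonempty] by auto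
qed

lemma collapsible_coarsenings_except_merges:
  "collapsible (order_complex strictly_finer (coarsenings P - merges a P))"
proof (rule refinement.collapsible_order_complex_meet[OF _ split_off_coarsening, where m = "separate a"])
  fix Q assume Q: "Q \<in> coarsenings P - merges a P"
  then have Q': "Q \<in> families" "finer P Q" "\<Union>Q = \<Union>P"
    unfolding Diff_iff coarsenings_iff[OF P(1) families_with_block_nonempty] by auto
  note sep = separate_families[OF P Q']
  show "separate a Q \<in> coarsenings P - merges a P \<and> (separate a Q = Q \<or> strictly_finer (separate a Q) Q)
    \<and> (separate a Q = split_off a P \<or> strictly_finer (separate a Q) (split_off a P))"
    using separate_coarsening[OF Q] finer_iff[OF sep Q'(1)] finer_iff[OF sep split_off_families]
      separate_finer[OF P Q'] separate_finer_split_off[OF P Q'] by simp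
  fix Z assume Z: "Z \<in> coarsenings P - merges a P" "strictly_finer Z Q"
    "Z = split_off a P \<or> strictly_finer Z (split_off a P)"
  have Z_families: "Z \<in> families" using Z(1) unfolding coarsenings_def by simp
  have "finer Z Q" "finer Z (split_off a P)"
    using Z(2,3) finer_refl unfolding strictly_finer_def by auto
  then have "finer Z (separate a Q)" by (rule separate_greatest[OF P Q' Z_families])
  then show "Z = separate a Q \<or> strictly_finer Z (separate a Q)"
    using finer_iff[OF Z_families sep] by simp
qed simp

context
  fixes T :: "'n set set \<Rightarrow> 'n set set set set"
  assumes T: "\<And>x. x \<in> merges a P \<Longrightarrow> partition_chains x (T x)"
begin

lemma merge_chain_above: "x \<in> merges a P \<Longrightarrow> t \<in> T x \<Longrightarrow> t \<subseteq> {z. strictly_finer x z}"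
  using partition_chains_coarsenings[OF T] unfolding coarsenings_def by blast

lemma merge_chain_notin: "x \<in> merges a P \<Longrightarrow> t \<in> T x \<Longrightarrow> x \<notin> t"
  using merge_chain_above refinement.irrefl by blast

lemma
  assumes x: "x \<in> merges a P" and t: "t \<in> T x"
  shows merge_chain_saturated: "refinement.saturated families P (insert x t) {\<Union>P}"
    and card_merge_chain: "card (insert x t) + 2 = card P"
proof -
  have "refinement.saturated families x t {\<Union>P}"
    using partition_chains_saturated[OF T[OF x] t] merges_Union[OF x] by simp
  from refinement.saturated_compose[OF merges_saturated[OF x] this merges_families[OF x]]
  show "refinement.saturated families P (insert x t) {\<Union>P}" by simp
  have "card (insert x t) = card t + 1" using merge_chain_notin[OF x t] by simp
  then show "card (insert x t) + 2 = card P"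
    using partition_chains_length[OF T[OF x] t] merges_card[OF x] three by simp
qed

lemma merge_chains_critical:
  "critical_chains strictly_finer (coarsenings P) (\<Union>x\<in>merges a P. insert x ` T x)"
proof -
  let ?Y = "coarsenings P - merges a P"
  have diff: "coarsenings P - ?Y = merges a P" using merges_coarsenings by auto
  have "critical_chains strictly_finer (coarsenings P)
    ({} \<union> (\<Union>x\<in>coarsenings P - ?Y. chains_through {{}} x (T x)))"
  proof (rule refinement.critical_chains_insert_elements, unfold diff)
    show "critical_chains strictly_finer ?Y {}"
      using collapsible_coarsenings_except_merges by (simp add: critical_chains_empty)
    fix x assume x: "x \<in> merges a P"
    have below: "{y\<in>?Y. strictly_finer y x} = {}" using nothing_below_merges[OF x] by auto
    show "critical_chains strictly_finer {y\<in>?Y. strictly_finer y x} {{}}"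
      unfolding below by (rule critical_chains_void)
    show "critical_chains strictly_finer {z\<in>coarsenings P. strictly_finer x z} (T x)"
      unfolding coarsenings_above[OF P(1) families_with_block_nonempty subsetD[OF merges_coarsenings x]]
      by (rule partition_chains_critical[OF T[OF x]])
    show "max_chain strictly_finer (coarsenings P) c" if "c \<in> chains_through {{}} x (T x)" for c
      using that refinement.saturated_max_chain[OF merge_chain_saturated[OF x]]
      unfolding chains_through_bottom coarsenings_def by auto
  qed auto
  then show ?thesis unfolding diff chains_through_bottom by simp
qed

lemma card_merge_chains: "card (\<Union>x\<in>merges a P. insert x ` T x) = fact (card P - 1)"
proof -
  have card_insert: "card (insert x ` T x) = fact (card P - 2)" if x: "x \<in> merges a P" for x
  proof -
    have "inj_on (insert x) (T x)"
      using merge_chain_notin[OF x] by (intro inj_onI) (metis insert_ident)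
    then have "card (insert x ` T x) = fact (card x - 1)"
      using partition_chains_card[OF T[OF x]] by (simp add: card_image)
    then show ?thesis using merges_card[OF x] by (simp add: numeral_2_eq_2)
  qed
  have "card (\<Union>x\<in>merges a P. insert x ` T x) = (\<Sum>x\<in>merges a P. card (insert x ` T x))"
  proof (rule card_UN_disjoint)
    show "\<forall>x\<in>merges a P. \<forall>y\<in>merges a P. x \<noteq> y \<longrightarrow> insert x ` T x \<inter> insert y ` T y = {}"
    proof (intro ballI impI equals0I)
      fix x y c assume xy: "x \<in> merges a P" "y \<in> merges a P" "x \<noteq> y" and c: "c \<in> insert x ` T x \<inter> insert y ` T y"
      then obtain t t' where t: "t \<in> T x" "t' \<in> T y" "insert x t = insert y t'" by auto
      then have "y \<in> t" "x \<in> t'" using xy(3) by auto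
      then have "strictly_finer x y" "strictly_finer y x"
        using merge_chain_above[OF xy(1) t(1)] merge_chain_above[OF xy(2) t(2)] by auto
      then show False using refinement.asym by auto
    qed
  qed auto
  also have "\<dots> = card (merges a P) * fact (card P - 2)" using card_insert by simp
  also have "\<dots> = fact (card P - 1)"
    using fact_reduce[of "card P - 1", where 'a = nat] three unfolding card_merges
    by (simp add: numeral_2_eq_2)
  finally show ?thesis .
qed

lemma partition_chains_merge_chains: "partition_chains P (\<Union>x\<in>merges a P. insert x ` T x)"
  unfolding partition_chains_def
  using merge_chains_critical card_merge_chains merge_chain_saturated card_merge_chain by blast

end

end

end

theorem partition_chains_exists: "P \<in> families \<Longrightarrow> 2 \<le> card P \<Longrightarrow> \<exists>S. partition_chains P S"
proof (induction "card P" arbitrary: P rule: less_induct)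
  case less
  obtain a where a: "a \<in> P" using less.prems(2) by fastforce
  show ?case
  proof (cases "card P = 2")
    case True
    then show ?thesis using partition_chains_two[OF less.prems(1) a] by blast
  next
    case False
    then have three: "3 \<le> card P" using less.prems(2) by simp
    have "\<exists>S. partition_chains x S" if x: "x \<in> merges a P" for x
      using less.hyps[of x] merges_families[OF less.prems(1) a x] merges_card[OF less.prems(1) a x] three
      by simp
    then obtain T where "\<And>x. x \<in> merges a P \<Longrightarrow> partition_chains x (T x)" by metis
    then show ?thesis using partition_chains_merge_chains[OF less.prems(1) a three] by blast
  qed
qed

end

section \<open>Intervals of families\<close>

context shelled_edges
begin

definition noncovering :: "'n set set \<Rightarrow> 'n set set set" where
  "noncovering P = {Q\<in>families. Q \<noteq> {} \<and> finer Q P \<and> \<Union>Q \<noteq> \<Union>P}"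

lemma noncovering_interval:
  assumes "P \<in> families"
  shows "noncovering P \<subseteq> interval {} P"
  unfolding noncovering_def using interval_iff[OF empty_families assms] by (auto simp: finer_def)

lemma traces_noncovering:
  assumes P: "P \<in> families" and X: "X \<in> traced_sets P"
  shows "traces P X \<in> noncovering P"
proof -
  have "\<Union>(traces P X) \<noteq> \<Union>P"
    using X Union_traces[of X P] unfolding traced_sets_def by auto
  then show ?thesis
    using traces_interval[OF P X] unfolding interval_iff[OF empty_families P] noncovering_def by simp
qed

lemma finer_traces_Union:
  assumes Q: "Q \<in> families" "finer Q P"
  shows "finer Q (traces P (\<Union>Q))"
proof (rule finerI)
  fix C assume C: "C \<in> Q"
  obtain A where A: "A \<in> P" "C \<subseteq> A" using finerE[OF Q(2) C] by metis
  then have "C \<subseteq> \<Union>Q \<inter> A" "\<Union>Q \<inter> A \<noteq> {}"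
    using C families_nonempty[OF Q(1) C] by auto
  moreover from this have "\<Union>Q \<inter> A \<in> traces P (\<Union>Q)"
    using A(1) unfolding traces_def by simp
  ultimately show "\<exists>Y\<in>traces P (\<Union>Q). C \<subseteq> Y"
    by (intro bexI[of _ "\<Union>Q \<inter> A"])
qed

lemma Union_noncovering_traced:
  assumes P: "P \<in> families" and Q: "Q \<in> noncovering P"
  shows "\<Union>Q \<in> traced_sets P"
proof -
  have Q': "Q \<in> families" "Q \<noteq> {}" "finer Q P" "\<Union>Q \<noteq> \<Union>P"
    using Q unfolding noncovering_def by auto
  have "\<Union>Q \<inter> A \<in> blocks" if A: "A \<in> P" "\<Union>Q \<inter> A \<noteq> {}" for A
  proof -
    obtain x C where x: "x \<in> C" "C \<in> Q" "x \<in> A" using A(2) by auto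
    obtain A' where A': "A' \<in> P" "C \<subseteq> A'" using finerE[OF Q'(3) x(2)] by metis
    have "A' = A" using families_unique[OF P A'(1) A(1), of x] A'(2) x by auto
    then have "C \<subseteq> \<Union>Q \<inter> A" using A'(2) x(2) by auto
    then show ?thesis by (rule block_mono[OF families_block[OF Q'(1) x(2)]])
  qed
  moreover have "\<Union>Q \<subset> \<Union>P" using finer_Union[OF Q'(3)] Q'(4) by auto
  moreover have "\<Union>Q \<noteq> {}" using Q'(2) families_nonempty[OF Q'(1)] by auto
  ultimately show ?thesis unfolding traced_sets_def blockwise_def by auto
qed

lemma collapsible_traces_above:
  assumes P: "P \<in> families" and Q: "Q \<in> noncovering P - traces P ` traced_sets P"
  shows "collapsible (order_complex strictly_finer {Y\<in>traces P ` traced_sets P. strictly_finer Q Y})"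
proof (rule collapsible_order_complex_cone[of _ "traces P (\<Union>Q)"])
  have Q': "Q \<in> families" "finer Q P" using Q unfolding noncovering_def by auto
  have Union_Q_traced: "\<Union>Q \<in> traced_sets P" using Union_noncovering_traced[OF P] Q by simp
  then have "traces P (\<Union>Q) \<in> families" using traces_interval[OF P] by simp
  moreover have "Q \<noteq> traces P (\<Union>Q)" using Q Union_Q_traced by auto
  ultimately have "strictly_finer Q (traces P (\<Union>Q))"
    using strictly_finer_iff[OF Q'(1)] finer_traces_Union[OF Q'] by simp
  then show "traces P (\<Union>Q) \<in> {Y\<in>traces P ` traced_sets P. strictly_finer Q Y}"
    using Union_Q_traced by simp
  fix Y assume "Y \<in> {Y\<in>traces P ` traced_sets P. strictly_finer Q Y}"
  then obtain X where X: "X \<in> traced_sets P" "Y = traces P X" "strictly_finer Q Y" by auto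
  have X_subset: "X \<subseteq> \<Union>P" using X(1) unfolding traced_sets_def by auto
  have "\<Union>Q \<subseteq> \<Union>Y" using finer_Union[OF strictly_finer_imp_finer[OF X(3)]] .
  then have "comparable (\<subset>) (\<Union>Q) X"
    unfolding X(2) Union_traces[OF X_subset] comparable_psubset by simp
  then show "comparable strictly_finer (traces P (\<Union>Q)) Y"
    unfolding X(2) comparable_traces[OF Union_Q_traced X(1)] .
qed simp

lemma noncovering_critical:
  assumes P: "P \<in> families" and C: "trapping_chains P C"
  shows "critical_chains strictly_finer (noncovering P) ((\<lambda>D. traces P ` C D) ` trappings P)"
proof (rule refinement.critical_chains_superset_above)
  have "critical_chains strictly_finer (traces P ` traced_sets P) ((`) (traces P) ` C ` trappings P)"
    by (rule critical_chains_image[OF inj_on_traces_traced_sets comparable_traces trapping_chains_critical[OF C]])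
  then show crit: "critical_chains strictly_finer (traces P ` traced_sets P) ((\<lambda>D. traces P ` C D) ` trappings P)"
    by (simp add: image_image)
  show sub: "traces P ` traced_sets P \<subseteq> noncovering P" using traces_noncovering[OF P] by auto
  fix c assume c: "c \<in> (\<lambda>D. traces P ` C D) ` trappings P"
  then obtain D where D: "D \<in> trappings P" "c = traces P ` C D" by auto
  have "max_chain strictly_finer (interval {} P) c"
    unfolding D(2)
    by (rule refinement.saturated_max_chain[OF traps_saturated[OF trapping_chains_traps[OF C D(1)]]])
  then show "max_chain strictly_finer (noncovering P) c"
    by (rule max_chain_restrict[OF _ subset_trans[OF critical_chains_subset[OF crit c] sub] noncovering_interval[OF P]])
next
  fix Q assume "Q \<in> noncovering P - traces P ` traced_sets P"
  then show "collapsible (order_complex strictly_finer {Y\<in>traces P ` traced_sets P. strictly_finer Q Y})"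
    by (rule collapsible_traces_above[OF P])
qed simp

subsection \<open>The chains of a decomposition\<close>

definition trapping_chain :: "'n set set \<Rightarrow> ('n set \<times> nat) set \<Rightarrow> 'n set set" where
  "trapping_chain P = (SOME C. trapping_chains P C)"

lemma trapping_chains_trapping_chain: "P \<in> families \<Longrightarrow> P \<noteq> {} \<Longrightarrow> trapping_chains P (trapping_chain P)"
  unfolding trapping_chain_def using someI_ex[OF trapping_chains_exists] .

definition lower_chain :: "('n set \<times> nat) set \<Rightarrow> 'n set set set" where
  "lower_chain D = traces (fst ` D) ` trapping_chain (fst ` D) D"

definition coarsening_chains :: "'n set set \<Rightarrow> 'n set set set set" where
  "coarsening_chains P = (if card P \<le> 1 then {{}} else (SOME S. partition_chains P S))"

lemma partition_chains_coarsening_chains: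
  assumes "P \<in> families" "2 \<le> card P"
  shows "partition_chains P (coarsening_chains P)"
proof -
  have "coarsening_chains P = (SOME S. partition_chains P S)"
    using assms(2) unfolding coarsening_chains_def by simp
  then show ?thesis using someI_ex[OF partition_chains_exists[OF assms]] by simp
qed

lemma coarsening_chains_small: "card P \<le> 1 \<Longrightarrow> coarsening_chains P = {{}}"
  unfolding coarsening_chains_def by simp

lemma card_coarsening_chains:
  assumes "P \<in> families"
  shows "card (coarsening_chains P) = fact (card P - 1)"
proof (cases "card P \<le> 1")
  case True
  then have "card P - 1 = 0" by simp
  then show ?thesis using True by (simp add: coarsening_chains_small)
next
  case False
  then show ?thesis using partition_chains_card[OF partition_chains_coarsening_chains[OF assms]] by simp
qed

lemma coarsening_chains_coarsenings:
  assumes "P \<in> families" "t \<in> coarsening_chains P"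
  shows "t \<subseteq> coarsenings P"
proof (cases "card P \<le> 1")
  case True
  then show ?thesis using assms(2) by (simp add: coarsening_chains_small)
next
  case False
  then show ?thesis
    using partition_chains_coarsenings[OF partition_chains_coarsening_chains[OF assms(1)] assms(2)] by simp
qed

lemma card_ge_2:
  fixes P :: "'n set set"
  assumes "P \<noteq> {}" "P \<noteq> {\<Union>P}"
  shows "2 \<le> card P"
proof (rule ccontr)
  assume "\<not> 2 \<le> card P"
  moreover have "card P > 0" using assms(1) by (simp add: card_gt_0_iff)
  ultimately have "card P = 1" by linarith
  then obtain A where "P = {A}" by (auto simp: card_1_singleton_iff)
  then show False using assms(2) by simp
qed

definition trapped_decomps :: "'n set \<Rightarrow> ('n set \<times> nat) set set" where
  "trapped_decomps B = {D. fst ` D \<in> families \<and> \<Union>(fst ` D) = B \<and> D \<in> trappings (fst ` D)}"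

definition chain_index :: "'n set \<Rightarrow> (('n set \<times> nat) set \<times> 'n set set set) set" where
  "chain_index B = (SIGMA D:trapped_decomps B. coarsening_chains (fst ` D))"

text \<open>If \<open>B\<close> is the only block of \<open>D\<close>, then \<open>{B}\<close> is the top of the interval and not part of the chain.\<close>
definition decomp_chain :: "'n set \<Rightarrow> ('n set \<times> nat) set \<Rightarrow> 'n set set set \<Rightarrow> 'n set set set" where
  "decomp_chain B D t = (lower_chain D \<union> insert (fst ` D) t) - {{B}}"

lemma
  assumes "D \<in> trapped_decomps B"
  shows trapped_decomps_families: "fst ` D \<in> families"
    and trapped_decomps_Union: "\<Union>(fst ` D) = B"
    and trapped_decomps_trappings: "D \<in> trappings (fst ` D)"
  using assms unfolding trapped_decomps_def by auto

lemma trappings_trapped_decomps: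
  assumes "D \<in> trappings P" "P \<in> families"
  shows "D \<in> trapped_decomps (\<Union>P)"
  using assms trappings_fst[OF assms(1)] unfolding trapped_decomps_def by auto

lemma coarsening_edge_unions:
  assumes P: "P \<subseteq> edge_unions" and Q: "Q \<in> families" "finer P Q" "\<Union>Q = \<Union>P"
  shows "Q \<subseteq> edge_unions"
proof (intro subsetI edge_unionsI)
  fix C x assume C: "C \<in> Q" "x \<in> C"
  then obtain A where A: "A \<in> P" "x \<in> A" "A \<subseteq> C"
    using coarsening_contains_block[OF Q] by blast
  obtain i where "i < q" "E i \<subseteq> A" "x \<in> E i"
    using edge_unionsE[OF subsetD[OF P A(1)] A(2)] by metis
  then show "\<exists>i<q. E i \<subseteq> C \<and> x \<in> E i" using A(3) by auto
qed

context
  fixes B :: "'n set"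
  assumes B: "B \<in> blocks"
begin

lemma trapped_decomps_nonempty: "D \<in> trapped_decomps B \<Longrightarrow> fst ` D \<noteq> {}"
  using trapped_decomps_Union block_nonempty[OF B] by fastforce

lemma covering_iff:
  "P \<in> interval {} {B} - noncovering {B} \<longleftrightarrow> P \<in> families \<and> \<Union>P = B \<and> P \<noteq> {B}"
proof -
  have "\<Union>P = B \<Longrightarrow> P \<noteq> {}" using block_nonempty[OF B] by auto
  then show ?thesis
    unfolding Diff_iff interval_empty_singleton[OF B] noncovering_def by (auto simp: finer_singleton)
qed

context
  fixes D :: "('n set \<times> nat) set"
  assumes D: "D \<in> trapped_decomps B"
begin

lemma lower_chain_traps: "traps (fst ` D) D (trapping_chain (fst ` D) D)"
  by (rule trapping_chains_traps[OF trapping_chains_trapping_chain[OF trapped_decomps_families[OF D]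
          trapped_decomps_nonempty[OF D]] trapped_decomps_trappings[OF D]])

lemma lower_chain_noncovering: "lower_chain D \<subseteq> noncovering (fst ` D)"
  unfolding lower_chain_def
  using traces_noncovering[OF trapped_decomps_families[OF D]] traps_traced_sets[OF lower_chain_traps] by blast

lemma lower_chain_below: "lower_chain D \<subseteq> {Q\<in>noncovering {B}. strictly_finer Q (fst ` D)}"
proof
  fix Q assume "Q \<in> lower_chain D"
  then have Q: "Q \<in> families" "Q \<noteq> {}" "finer Q (fst ` D)" "\<Union>Q \<noteq> B"
    using lower_chain_noncovering trapped_decomps_Union[OF D] unfolding noncovering_def by auto
  moreover have "Q \<noteq> fst ` D" using Q(4) trapped_decomps_Union[OF D] by auto
  moreover have "\<Union>Q \<subseteq> B" using finer_Union[OF Q(3)] trapped_decomps_Union[OF D] by simp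
  ultimately show "Q \<in> {Q\<in>noncovering {B}. strictly_finer Q (fst ` D)}"
    using strictly_finer_iff[OF Q(1) trapped_decomps_families[OF D]] unfolding noncovering_def
    by (simp add: finer_singleton)
qed

lemma top_notin_lower_chain: "{B} \<notin> lower_chain D"
  using lower_chain_below unfolding noncovering_def by auto

lemma lower_chain_saturated: "refinement.saturated families {} (lower_chain D) (fst ` D)"
  unfolding lower_chain_def by (rule traps_saturated[OF lower_chain_traps])

lemma card_lower_chain: "card (lower_chain D) + 1 = trapping_size D"
  using traps_card[OF lower_chain_traps]
    card_image[OF inj_on_subset[OF inj_on_traces_traced_sets traps_traced_sets[OF lower_chain_traps]]]
  unfolding lower_chain_def by simp

lemma lower_chain_edge_unions: "Q \<in> lower_chain D \<Longrightarrow> Q \<subseteq> edge_unions"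
  using traps_edge_unions[OF lower_chain_traps] unfolding lower_chain_def traces_def by auto

lemma blocks_edge_unions: "fst ` D \<subseteq> edge_unions"
  using trappings_block[OF trapped_decomps_trappings[OF D]] by auto

context
  fixes t :: "'n set set set"
  assumes t: "t \<in> coarsening_chains (fst ` D)"
begin

lemma decomp_coarsening:
  assumes "Q \<in> t"
  shows "Q \<in> families" "finer (fst ` D) Q" "Q \<noteq> fst ` D" "\<Union>Q = B" "Q \<noteq> {B}"
  using subsetD[OF coarsening_chains_coarsenings[OF trapped_decomps_families[OF D] t] assms]
    trapped_decomps_Union[OF D]
  unfolding coarsenings_iff[OF trapped_decomps_families[OF D] trapped_decomps_nonempty[OF D]] by auto

lemma decomp_chain_top:
  assumes "fst ` D = {B}"
  shows "t = {}" "decomp_chain B D t = lower_chain D"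
proof -
  show "t = {}" using t assms by (simp add: coarsening_chains_small)
  then show "decomp_chain B D t = lower_chain D"
    using top_notin_lower_chain assms unfolding decomp_chain_def by auto
qed

lemma decomp_chain_proper:
  assumes "fst ` D \<noteq> {B}"
  shows "decomp_chain B D t = lower_chain D \<union> insert (fst ` D) t"
proof -
  have "{B} \<notin> t" using decomp_coarsening(5) by auto
  then show ?thesis using top_notin_lower_chain assms unfolding decomp_chain_def by auto
qed

lemma decomp_coarsening_above: "insert {B} t - {fst ` D} \<subseteq> {Z. strictly_finer (fst ` D) Z}"
proof
  fix Z assume Z: "Z \<in> insert {B} t - {fst ` D}"
  have "{B} \<in> families" using B singleton_families by simp
  then have "Z \<in> families" "finer (fst ` D) Z"
    using Z decomp_coarsening trapped_decomps_Union[OF D] by (auto simp: finer_singleton)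
  then show "Z \<in> {Z. strictly_finer (fst ` D) Z}"
    using strictly_finer_iff[OF trapped_decomps_families[OF D]] Z by auto
qed

lemma insert_top_decomp_chain:
  "insert {B} (decomp_chain B D t) = lower_chain D \<union> insert (fst ` D) (insert {B} t - {fst ` D})"
  unfolding decomp_chain_def by auto

lemma decomp_partition_chains:
  assumes "fst ` D \<noteq> {B}"
  shows "partition_chains (fst ` D) (coarsening_chains (fst ` D))"
  using assms card_ge_2[OF trapped_decomps_nonempty[OF D]] trapped_decomps_Union[OF D]
  by (intro partition_chains_coarsening_chains trapped_decomps_families[OF D]) auto

lemma decomp_chain_saturated: "refinement.saturated families {} (decomp_chain B D t) {B}"
proof (cases "fst ` D = {B}")
  case True
  then show ?thesis using lower_chain_saturated decomp_chain_top(2) by simp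
next
  case False
  have "refinement.saturated families (fst ` D) t {B}"
    using partition_chains_saturated[OF decomp_partition_chains[OF False] t] trapped_decomps_Union[OF D]
    by simp
  from refinement.saturated_compose[OF lower_chain_saturated this trapped_decomps_families[OF D]]
  show ?thesis unfolding decomp_chain_proper[OF False] .
qed

lemma card_decomp_chain: "card (decomp_chain B D t) + 2 = trapping_size D + card (fst ` D)"
proof (cases "fst ` D = {B}")
  case True
  then show ?thesis using card_lower_chain decomp_chain_top(2) by simp
next
  case False
  have "\<Union>Q \<noteq> B" if "Q \<in> lower_chain D" for Q
    using that lower_chain_below unfolding noncovering_def by auto
  moreover have "\<Union>Q = B" if "Q \<in> insert (fst ` D) t" for Q
    using that decomp_coarsening(4) trapped_decomps_Union[OF D] by (cases "Q = fst ` D") simp_all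
  ultimately have "lower_chain D \<inter> insert (fst ` D) t = {}" by blast
  moreover have "fst ` D \<notin> t" using decomp_coarsening(3) by auto
  ultimately have "card (decomp_chain B D t) = card (lower_chain D) + (card t + 1)"
    unfolding decomp_chain_proper[OF False] by (simp add: card_Un_disjoint)
  then show ?thesis
    using card_lower_chain partition_chains_length[OF decomp_partition_chains[OF False] t] by simp
qed

lemma decomp_chain_edge_unions:
  assumes "Q \<in> decomp_chain B D t"
  shows "Q \<subseteq> edge_unions"
proof -
  consider "Q \<in> lower_chain D" | "Q = fst ` D" | "Q \<in> t"
    using assms unfolding decomp_chain_def by auto
  then show ?thesis
  proof cases
    case 1
    then show ?thesis by (rule lower_chain_edge_unions)
  next
    case 2
    then show ?thesis using blocks_edge_unions by simp
  next
    case 3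
    then show ?thesis
      using decomp_coarsening trapped_decomps_Union[OF D]
      by (intro coarsening_edge_unions[OF blocks_edge_unions]) auto
  qed
qed

end

end

lemma lower_chain_inj:
  assumes D: "D \<in> trapped_decomps B" "D' \<in> trapped_decomps B" and fst: "fst ` D = fst ` D'"
    and eq: "lower_chain D = lower_chain D'"
  shows "D = D'"
proof -
  let ?P = "fst ` D"
  note C = trapping_chains_trapping_chain[OF trapped_decomps_families[OF D(1)] trapped_decomps_nonempty[OF D(1)]]
  note trappings_D = trapped_decomps_trappings[OF D(1)] and trappings_D' = trapped_decomps_trappings[OF D(2), folded fst]
  have "traces ?P ` trapping_chain ?P D = traces ?P ` trapping_chain ?P D'"
    using eq fst unfolding lower_chain_def by simp
  then have "trapping_chain ?P D = trapping_chain ?P D'"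
    using inj_on_image_eq_iff[OF inj_on_traces_traced_sets
        traps_traced_sets[OF trapping_chains_traps[OF C trappings_D]] traps_traced_sets[OF trapping_chains_traps[OF C trappings_D']]] by simp
  then show ?thesis by (rule inj_onD[OF trapping_chains_inj[OF C] _ trappings_D trappings_D'])
qed

lemma inj_on_decomp_chain: "inj_on (\<lambda>(D, t). decomp_chain B D t) (chain_index B)"
proof (rule inj_onI, clarify)
  fix D t D' t' assume index: "(D, t) \<in> chain_index B" "(D', t') \<in> chain_index B"
    and eq: "decomp_chain B D t = decomp_chain B D' t'"
  have D: "D \<in> trapped_decomps B" "D' \<in> trapped_decomps B"
    and t: "t \<in> coarsening_chains (fst ` D)" "t' \<in> coarsening_chains (fst ` D')"
    using index unfolding chain_index_def by auto
  have notin: "fst ` D \<notin> noncovering {B}" if "D \<in> trapped_decomps B" for D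
    using trapped_decomps_Union[OF that] unfolding noncovering_def by simp
  have "lower_chain D \<union> insert (fst ` D) (insert {B} t - {fst ` D})
    = lower_chain D' \<union> insert (fst ` D') (insert {B} t' - {fst ` D'})"
    unfolding insert_top_decomp_chain[OF D(1) t(1), symmetric] insert_top_decomp_chain[OF D(2) t(2), symmetric] eq ..
  note same = refinement.chain_through_unique[OF this notin[OF D(1)] notin[OF D(2)] lower_chain_below[OF D(1)]
      lower_chain_below[OF D(2)] decomp_coarsening_above[OF D(1) t(1)] decomp_coarsening_above[OF D(2) t(2)]]
  have "D = D'" by (rule lower_chain_inj[OF D conjunct1[OF same] conjunct1[OF conjunct2[OF same]]])
  have upper: "insert {B} t - {fst ` D} - {{B}} = t" if "D \<in> trapped_decomps B" "t \<in> coarsening_chains (fst ` D)" for D t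
    using decomp_coarsening(3,5)[OF that] by auto
  have "t = t'"
    using conjunct2[OF conjunct2[OF same]] upper[OF D(1) t(1)] upper[OF D(2) t(2)] by argo
  with \<open>D = D'\<close> show "D = D' \<and> t = t'" ..
qed

subsection \<open>Critical chains of the interval\<close>

abbreviation decomp_chains :: "'n set set set set" where
  "decomp_chains \<equiv> (\<lambda>(D, t). decomp_chain B D t) ` chain_index B"

lemma max_chain_decomp_chains:
  assumes "c \<in> decomp_chains"
  shows "max_chain strictly_finer (interval {} {B}) c"
  using assms refinement.saturated_max_chain[OF decomp_chain_saturated] unfolding chain_index_def by auto

lemma lower_chain_critical:
  assumes P: "P \<in> families" "P \<noteq> {}"
  shows "critical_chains strictly_finer (noncovering P) (lower_chain ` trappings P)"
proof -
  have "lower_chain ` trappings P = (\<lambda>D. traces P ` trapping_chain P D) ` trappings P"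
    by (rule image_cong) (auto simp: lower_chain_def trappings_fst)
  then show ?thesis using noncovering_critical[OF P(1) trapping_chains_trapping_chain[OF P]] by simp
qed

lemma lower_chain_decomp_chains:
  assumes D: "D \<in> trappings {B}"
  shows "lower_chain D \<in> decomp_chains"
proof -
  have index: "D \<in> trapped_decomps B" "{} \<in> coarsening_chains (fst ` D)" "fst ` D = {B}"
    using trappings_trapped_decomps[OF D] trappings_fst[OF D] B
    by (auto simp: singleton_families coarsening_chains_small)
  have "lower_chain D = decomp_chain B D {}" unfolding decomp_chain_top(2)[OF index] ..
  then show ?thesis using index(1,2) unfolding chain_index_def by auto
qed

lemma chains_through_decomp_chains:
  assumes P: "P \<in> interval {} {B} - noncovering {B}"
    and c: "c \<in> chains_through (lower_chain ` trappings P) P (coarsening_chains P)"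
  shows "c \<in> decomp_chains"
proof -
  have P': "P \<in> families" "\<Union>P = B" "P \<noteq> {B}" using P unfolding covering_iff by simp_all
  obtain D t where D: "D \<in> trappings P" and t: "t \<in> coarsening_chains P" and c_eq: "c = lower_chain D \<union> insert P t"
    using c unfolding chains_through_def by auto
  have index: "D \<in> trapped_decomps B" "t \<in> coarsening_chains (fst ` D)" "fst ` D \<noteq> {B}"
    using trappings_trapped_decomps[OF D P'(1)] trappings_fst[OF D] t P' by auto
  have "c = decomp_chain B D t" unfolding c_eq decomp_chain_proper[OF index] trappings_fst[OF D] ..
  then show ?thesis using index unfolding chain_index_def by auto
qed

lemma decomp_chains_eq:
  "decomp_chains = lower_chain ` trappings {B} \<union>
    (\<Union>P\<in>interval {} {B} - noncovering {B}. chains_through (lower_chain ` trappings P) P (coarsening_chains P))"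
  (is "_ = ?l \<union> ?u")
proof (intro equalityI subsetI)
  fix c assume "c \<in> decomp_chains"
  then obtain D t where D: "D \<in> trapped_decomps B" and t: "t \<in> coarsening_chains (fst ` D)"
    and c: "c = decomp_chain B D t" unfolding chain_index_def by auto
  note trap = trapped_decomps_trappings[OF D]
  show "c \<in> ?l \<union> ?u"
  proof (cases "fst ` D = {B}")
    case True
    then have "D \<in> trappings {B}" using trap by simp
    then show ?thesis unfolding c decomp_chain_top(2)[OF D t True] by simp
  next
    case False
    then have "fst ` D \<in> interval {} {B} - noncovering {B}"
      unfolding covering_iff using trapped_decomps_families[OF D] trapped_decomps_Union[OF D] by simp
    moreover have "c \<in> chains_through (lower_chain ` trappings (fst ` D)) (fst ` D) (coarsening_chains (fst ` D))"
      unfolding c decomp_chain_proper[OF D t False] chains_through_def using trap t by blast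
    ultimately show ?thesis by blast
  qed
next
  fix c assume "c \<in> ?l \<union> ?u"
  then consider D where "D \<in> trappings {B}" "c = lower_chain D"
    | P where "P \<in> interval {} {B} - noncovering {B}" "c \<in> chains_through (lower_chain ` trappings P) P (coarsening_chains P)"
    by blast
  then show "c \<in> decomp_chains"
  proof cases
    case 1
    show ?thesis unfolding 1(2) by (rule lower_chain_decomp_chains[OF 1(1)])
  next
    case 2
    then show ?thesis by (rule chains_through_decomp_chains)
  qed
qed

theorem interval_critical: "critical_chains strictly_finer (interval {} {B}) decomp_chains"
  unfolding decomp_chains_eq
proof (rule refinement.critical_chains_insert_elements)
  have top: "{B} \<in> families" using B singleton_families by simp
  show "noncovering {B} \<subseteq> interval {} {B}" by (rule noncovering_interval[OF top])
  show "critical_chains strictly_finer (noncovering {B}) (lower_chain ` trappings {B})"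
    by (rule lower_chain_critical[OF top]) simp
  show "max_chain strictly_finer (interval {} {B}) c" if "c \<in> lower_chain ` trappings {B}" for c
    using that lower_chain_decomp_chains by (intro max_chain_decomp_chains) auto
  fix P assume P: "P \<in> interval {} {B} - noncovering {B}"
  then have P': "P \<in> families" "\<Union>P = B" "P \<noteq> {B}" unfolding covering_iff by simp_all
  have nonempty: "P \<noteq> {}" using P'(2) block_nonempty[OF B] by auto
  have "Q \<in> noncovering {B} \<and> strictly_finer Q P \<longleftrightarrow> Q \<in> noncovering P" for Q
  proof (cases "Q \<in> families")
    case True
    have "finer Q P \<Longrightarrow> \<Union>Q \<subseteq> B" using finer_Union[of Q P] P'(2) by simp
    then show ?thesis
      using strictly_finer_iff[OF True P'(1)] P'(2) unfolding noncovering_def finer_singleton by auto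
  qed (simp add: noncovering_def)
  then show "critical_chains strictly_finer {Q\<in>noncovering {B}. strictly_finer Q P} (lower_chain ` trappings P)"
    using lower_chain_critical[OF P'(1) nonempty] by simp
  have "strictly_finer {} P" by (simp add: empty_strictly_finer nonempty)
  then have "{Z\<in>interval {} {B}. strictly_finer P Z} = coarsenings P"
    unfolding coarsenings_def P'(2) using refinement.trans by blast
  moreover have "2 \<le> card P" by (rule card_ge_2[OF nonempty]) (use P' in simp)
  ultimately show "critical_chains strictly_finer {Z\<in>interval {} {B}. strictly_finer P Z} (coarsening_chains P)"
    using partition_chains_critical[OF partition_chains_coarsening_chains[OF P'(1)]] by simp
  show "max_chain strictly_finer (interval {} {B}) c"
    if "c \<in> chains_through (lower_chain ` trappings P) P (coarsening_chains P)" for c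
    by (rule max_chain_decomp_chains[OF chains_through_decomp_chains[OF P that]])
qed simp

end

subsection \<open>Families of unions of edges\<close>

definition edge_families_below :: "'n set \<Rightarrow> 'n set set set" where
  "edge_families_below B = {Q\<in>interval {} {B}. Q \<subseteq> edge_unions}"

definition edge_core :: "'n set \<Rightarrow> 'n set" where
  "edge_core C = \<Union>{E i | i. i < q \<and> E i \<subseteq> C}"

lemma
  shows edge_core_subset: "edge_core C \<subseteq> C"
    and edge_core_edge_unions: "edge_core C \<in> edge_unions"
  unfolding edge_core_def edge_unions_def by auto

lemma edge_core_block: "C \<in> blocks \<Longrightarrow> edge_core C \<in> blocks"
  unfolding edge_core_def blocks_def by blast

lemma edge_core_greatest:
  assumes "X \<in> edge_unions" "X \<subseteq> C"
  shows "X \<subseteq> edge_core C"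
proof
  fix x assume "x \<in> X"
  then obtain i where "i < q" "E i \<subseteq> X" "x \<in> E i" using assms(1) edge_unionsE by metis
  then show "x \<in> edge_core C" unfolding edge_core_def using assms(2) by auto
qed

lemma edge_cores_families:
  assumes Q: "Q \<in> families"
  shows "edge_core ` Q \<in> families"
proof (rule familiesI)
  show "X \<in> blocks" if "X \<in> edge_core ` Q" for X
    using that edge_core_block families_block[OF Q] by auto
  show "X = Y" if XY: "X \<in> edge_core ` Q" "Y \<in> edge_core ` Q" "u \<in> X" "u \<in> Y" for X Y u
  proof -
    obtain C C' where C: "C \<in> Q" "C' \<in> Q" "X = edge_core C" "Y = edge_core C'" using XY by auto
    then have "C = C'"
      using families_unique[OF Q, of C C' u] XY(3,4) edge_core_subset[of C] edge_core_subset[of C'] by auto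
    then show ?thesis using C by simp
  qed
qed

lemma edge_cores_finer: "finer (edge_core ` Q) Q"
  unfolding finer_def using edge_core_subset by blast

lemma edge_cores_greatest:
  assumes "Z \<subseteq> edge_unions" "finer Z Q"
  shows "finer Z (edge_core ` Q)"
proof (rule finerI)
  fix X assume X: "X \<in> Z"
  obtain C where C: "C \<in> Q" "X \<subseteq> C" using finerE[OF assms(2) X] by metis
  have "X \<subseteq> edge_core C" by (rule edge_core_greatest[OF subsetD[OF assms(1) X] C(2)])
  then show "\<exists>Y\<in>edge_core ` Q. X \<subseteq> Y" using C(1) by auto
qed

text \<open>Replacing each block by its core retracts all families onto those in the intersection lattice.\<close>
lemma collapses_edge_families_below:
  assumes S: "\<And>c. c \<in> S \<Longrightarrow> c \<subseteq> edge_families_below B"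
  shows "collapses (order_complex strictly_finer (interval {} {B}) - S)
    (order_complex strictly_finer (edge_families_below B) - S)"
proof (rule refinement.collapses_order_complex_subset[OF _ _ S])
  show "edge_families_below B \<subseteq> interval {} {B}" unfolding edge_families_below_def by auto
  fix Q assume Q: "Q \<in> interval {} {B} - edge_families_below B"
  then have Q': "Q \<in> families" "strictly_finer {} Q" "strictly_finer Q {B}" "\<not> Q \<subseteq> edge_unions"
    unfolding edge_families_below_def by simp_all
  note core = edge_cores_families[OF Q'(1)]
  have unions: "edge_core ` Q \<subseteq> edge_unions" using edge_core_edge_unions by auto
  then have less: "strictly_finer (edge_core ` Q) Q"
    using strictly_finer_iff[OF core Q'(1)] edge_cores_finer Q'(4) by auto
  have "strictly_finer {} (edge_core ` Q)" using Q'(2) by (simp add: empty_strictly_finer)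
  then have mem: "edge_core ` Q \<in> edge_families_below B"
    unfolding edge_families_below_def using core refinement.trans[OF less Q'(3)] unions by simp
  show "collapsible (order_complex strictly_finer {Z\<in>edge_families_below B. strictly_finer Z Q})"
  proof (rule collapsible_order_complex_cone[of _ "edge_core ` Q"])
    show "edge_core ` Q \<in> {Z\<in>edge_families_below B. strictly_finer Z Q}" using mem less by simp
    fix Z assume "Z \<in> {Z\<in>edge_families_below B. strictly_finer Z Q}"
    then have Z: "Z \<in> families" "Z \<subseteq> edge_unions" "finer Z Q"
      unfolding edge_families_below_def strictly_finer_def by simp_all
    then have "finer Z (edge_core ` Q)" by (intro edge_cores_greatest)
    then show "comparable strictly_finer (edge_core ` Q) Z"
      using finer_iff[OF Z(1) core] unfolding comparable_def by auto
  qed simp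
qed simp

end

section \<open>The intersection lattice as a poset of families\<close>

definition family_subspace :: "'n::finite set set \<Rightarrow> (real^'n) set" where
  "family_subspace Q = (\<Inter>X\<in>Q. diag_subspace X)"

definition indicator_vec :: "'n::finite set \<Rightarrow> real^'n" where
  "indicator_vec C = (\<chi> i. if i \<in> C then 1 else 0)"

lemma diag_subspaceI: "(\<And>i j. i \<in> X \<Longrightarrow> j \<in> X \<Longrightarrow> u $ i = u $ j) \<Longrightarrow> u \<in> diag_subspace X"
  unfolding diag_subspace_def by blast

lemma diag_subspaceD: "u \<in> diag_subspace X \<Longrightarrow> i \<in> X \<Longrightarrow> j \<in> X \<Longrightarrow> u $ i = u $ j"
  unfolding diag_subspace_def by blast

lemma family_subspaceI:
  "(\<And>X i j. X \<in> Q \<Longrightarrow> i \<in> X \<Longrightarrow> j \<in> X \<Longrightarrow> u $ i = u $ j) \<Longrightarrow> u \<in> family_subspace Q"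
  unfolding family_subspace_def diag_subspace_def by blast

lemma family_subspaceD: "u \<in> family_subspace Q \<Longrightarrow> X \<in> Q \<Longrightarrow> i \<in> X \<Longrightarrow> j \<in> X \<Longrightarrow> u $ i = u $ j"
  unfolding family_subspace_def diag_subspace_def by blast

lemma family_subspace_empty: "family_subspace {} = UNIV"
  unfolding family_subspace_def by simp

lemma family_subspace_singleton: "family_subspace {B} = diag_subspace B"
  unfolding family_subspace_def by simp

lemma family_subspace_antimono:
  assumes "finer P Q"
  shows "family_subspace Q \<subseteq> family_subspace P"
proof (intro subsetI family_subspaceI)
  fix u X i j assume u: "u \<in> family_subspace Q" and X: "X \<in> P" "i \<in> X" "j \<in> X"
  obtain Y where "Y \<in> Q" "X \<subseteq> Y" using finerE[OF assms X(1)] by metis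
  then show "u $ i = u $ j" using family_subspaceD[OF u, of Y i j] X(2,3) by auto
qed

lemma indicator_vec_diag_subspace: "indicator_vec C \<in> diag_subspace X \<longleftrightarrow> X \<inter> C = {} \<or> X \<subseteq> C"
proof -
  have "indicator_vec C \<in> diag_subspace X \<longleftrightarrow> (\<forall>i\<in>X. \<forall>j\<in>X. i \<in> C \<longleftrightarrow> j \<in> C)"
    unfolding diag_subspace_def indicator_vec_def by simp blast
  also have "\<dots> \<longleftrightarrow> X \<inter> C = {} \<or> X \<subseteq> C" by blast
  finally show ?thesis .
qed

lemma indicator_vec_family_subspace:
  "indicator_vec C \<in> family_subspace Q \<longleftrightarrow> (\<forall>X\<in>Q. X \<inter> C = {} \<or> X \<subseteq> C)"
  unfolding family_subspace_def INT_iff indicator_vec_diag_subspace ..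

lemma family_subspace_subset_diag_subspace:
  assumes disj: "disjoint Q" and sub: "family_subspace Q \<subseteq> diag_subspace X" and X: "x \<in> X" "\<not> X \<subseteq> {x}"
  shows "\<exists>Y\<in>Q. X \<subseteq> Y"
proof -
  have separated: "X \<subseteq> C" if "x \<in> C" "\<And>Y. Y \<in> Q \<Longrightarrow> Y \<inter> C = {} \<or> Y \<subseteq> C" for C
  proof -
    have "indicator_vec C \<in> family_subspace Q"
      unfolding indicator_vec_family_subspace using that(2) by simp
    then have "X \<inter> C = {} \<or> X \<subseteq> C"
      using sub unfolding indicator_vec_diag_subspace[symmetric] by (rule subsetD[rotated])
    then show ?thesis using that(1) X(1) by auto
  qed
  have "\<exists>C\<in>Q. x \<in> C"
  proof (rule ccontr)
    assume no: "\<not> (\<exists>C\<in>Q. x \<in> C)"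
    have "X \<subseteq> {x}" by (rule separated) (use no in auto)
    then show False using X(2) by simp
  qed
  then obtain C where C: "C \<in> Q" "x \<in> C" by auto
  have "Y \<inter> C = {} \<or> Y \<subseteq> C" if "Y \<in> Q" for Y
    using disjointD[OF disj that C(1)] by auto
  then have "X \<subseteq> C" by (rule separated[OF C(2)])
  then show ?thesis using C(1) by auto
qed

context block_system
begin

lemma family_subspace_subset_iff:
  assumes "P \<in> families" "Q \<in> families"
  shows "family_subspace Q \<subseteq> family_subspace P \<longleftrightarrow> finer P Q"
proof
  assume sub: "family_subspace Q \<subseteq> family_subspace P"
  show "finer P Q"
  proof (rule finerI)
    fix X assume X: "X \<in> P"
    obtain x where x: "x \<in> X" using families_nonempty[OF assms(1) X] by auto
    have "family_subspace P \<subseteq> diag_subspace X"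
      unfolding family_subspace_def using X by (rule INT_lower)
    with sub have "family_subspace Q \<subseteq> diag_subspace X" by (rule subset_trans)
    moreover have "disjoint Q" using assms(2) unfolding families_def by simp
    ultimately show "\<exists>Y\<in>Q. X \<subseteq> Y"
      using family_subspace_subset_diag_subspace x block_not_subset_singleton[OF families_block[OF assms(1) X]] by metis
  qed
qed (rule family_subspace_antimono)

lemma family_subspace_psubset_iff:
  "P \<in> families \<Longrightarrow> Q \<in> families \<Longrightarrow> family_subspace Q \<subset> family_subspace P \<longleftrightarrow> strictly_finer P Q"
  unfolding strictly_finer_def less_le_not_le
  using family_subspace_subset_iff[of P Q] family_subspace_subset_iff[of Q P] by simp

lemma inj_on_family_subspace: "inj_on family_subspace families"
proof (rule inj_onI)
  fix P Q assume "P \<in> families" "Q \<in> families" "family_subspace P = family_subspace Q"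
  then show "P = Q"
    using family_subspace_subset_iff[of P Q] family_subspace_subset_iff[of Q P] finer_antisym by simp
qed

lemma comparable_family_subspace:
  assumes "P \<in> families" "Q \<in> families"
  shows "comparable (\<subset>) (family_subspace P) (family_subspace Q) \<longleftrightarrow> comparable strictly_finer P Q"
  unfolding comparable_def family_subspace_psubset_iff[OF assms] family_subspace_psubset_iff[OF assms(2,1)]
    inj_on_eq_iff[OF inj_on_family_subspace assms]
  by (rule disj_cong[OF HOL.refl disj_commute])

end

subsection \<open>Coordinate classes\<close>

definition coordinate_class :: "(real^'n) set \<Rightarrow> 'n::finite \<Rightarrow> 'n set" where
  "coordinate_class L x = {y. \<forall>u\<in>L. u $ x = u $ y}"

definition coordinate_classes :: "(real^'n) set \<Rightarrow> 'n::finite set set" where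
  "coordinate_classes L = {coordinate_class L x | x. coordinate_class L x \<noteq> {x}}"

lemma coordinate_class_self: "x \<in> coordinate_class L x"
  unfolding coordinate_class_def by simp

lemma coordinate_class_eq:
  assumes "z \<in> coordinate_class L x" "z \<in> coordinate_class L y"
  shows "coordinate_class L x = coordinate_class L y"
proof -
  have "u $ x = u $ y" if "u \<in> L" for u using that assms unfolding coordinate_class_def by simp
  then show ?thesis unfolding coordinate_class_def by (simp cong: ball_cong)
qed

lemma coordinate_classesE:
  assumes "C \<in> coordinate_classes L" "x \<in> C"
  shows "C = coordinate_class L x" "\<not> C \<subseteq> {x}"
proof -
  obtain z where z: "C = coordinate_class L z" "coordinate_class L z \<noteq> {z}"
    using assms(1) unfolding coordinate_classes_def by auto
  show "C = coordinate_class L x"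
    using coordinate_class_eq[of x L z x] coordinate_class_self[of x L] assms(2) z(1) by simp
  show "\<not> C \<subseteq> {x}" using z coordinate_class_self[of z L] by auto
qed

lemma coordinate_classes_unique:
  "C \<in> coordinate_classes L \<Longrightarrow> C' \<in> coordinate_classes L \<Longrightarrow> x \<in> C \<Longrightarrow> x \<in> C' \<Longrightarrow> C = C'"
  using coordinate_classesE(1) by metis

lemma subset_coordinate_class: "X \<in> Q \<Longrightarrow> x \<in> X \<Longrightarrow> X \<subseteq> coordinate_class (family_subspace Q) x"
  unfolding coordinate_class_def by (auto intro: family_subspaceD)

lemma family_subspace_coordinate_classes:
  "family_subspace (coordinate_classes (family_subspace Q)) = family_subspace Q"
proof (intro equalityI subsetI family_subspaceI)
  fix u X i j assume u: "u \<in> family_subspace (coordinate_classes (family_subspace Q))" and X: "X \<in> Q" "i \<in> X" "j \<in> X"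
  let ?C = "coordinate_class (family_subspace Q) i"
  have C: "i \<in> ?C" "j \<in> ?C" using subset_coordinate_class[OF X(1,2)] X(2,3) by auto
  show "u $ i = u $ j"
  proof (cases "i = j")
    case False
    then have "?C \<in> coordinate_classes (family_subspace Q)"
      unfolding coordinate_classes_def using C(2) by auto
    then show ?thesis using family_subspaceD[OF u] C by blast
  qed simp
next
  fix u C i j assume "u \<in> family_subspace Q" "C \<in> coordinate_classes (family_subspace Q)" "i \<in> C" "j \<in> C"
  then show "u $ i = u $ j" using coordinate_classesE(1)[of C _ i] unfolding coordinate_class_def by auto
qed

lemma coordinate_classes_covered:
  assumes C: "C \<in> coordinate_classes (family_subspace Q)" and x: "x \<in> C"
  shows "\<exists>X\<in>Q. x \<in> X \<and> X \<subseteq> C"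
proof -
  note C_eq = coordinate_classesE(1)[OF C x]
  obtain y where y: "y \<in> C" "y \<noteq> x" using coordinate_classesE(2)[OF C x] by auto
  have "\<exists>X\<in>Q. x \<in> X"
  proof (rule ccontr)
    assume "\<not> (\<exists>X\<in>Q. x \<in> X)"
    then have "indicator_vec {x} \<in> family_subspace Q" unfolding indicator_vec_family_subspace by auto
    then have "indicator_vec {x} $ x = indicator_vec {x} $ y"
      using y(1) unfolding C_eq coordinate_class_def by blast
    then show False using y(2) unfolding indicator_vec_def by simp
  qed
  then obtain X where "X \<in> Q" "x \<in> X" by auto
  then show ?thesis using subset_coordinate_class[of X Q x] unfolding C_eq by auto
qed

subsection \<open>Unions of edges\<close>

context shelled_edges
begin

lemma edge_bridge:
  assumes "i < q" "j < q"
  shows "\<exists>k<q. E k \<subseteq> E i \<union> E j \<and> E k \<inter> E i \<noteq> {} \<and> E k \<inter> E j \<noteq> {}"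
  using assms
proof (induction i j rule: linorder_wlog)
  case (le i j)
  show ?case
  proof (cases "i = j")
    case True
    then show ?thesis using le(2) block_nonempty[of "E i"] unfolding blocks_def by (intro exI[of _ i]) auto
  next
    case False
    then have "i < j" using le(1) by simp
    then obtain v k where v: "v \<in> E i" "v \<notin> E j" "k < j" "E k \<subseteq> insert v (E j)"
      using shelling_exchange[OF _ le(3)] by blast
    have k: "k < q" using v(3) le(3) by simp
    have "v \<in> E k"
    proof (rule ccontr)
      assume "v \<notin> E k"
      then have "E k \<subseteq> E j" using v(4) by auto
      then show False using edge_antichain[OF k le(3)] v(3) by simp
    qed
    moreover have "\<not> E k \<subseteq> {v}"
      by (rule block_not_subset_singleton) (use k in \<open>auto simp: blocks_def\<close>)
    then have "E k \<inter> E j \<noteq> {}" using v(4) by auto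
    ultimately show ?thesis using k v(1,4) by (intro exI[of _ k]) auto
  qed
next
  case (sym i j)
  then show ?case by (simp add: Un_commute conj_commute)
qed

text \<open>Any two edges inside \<open>X\<close> are linked by a third one, so a vector that is constant on each edge inside
  \<open>X\<close> is constant on their union.\<close>
lemma diag_subspace_edge_union:
  assumes X: "X \<in> edge_unions"
  shows "diag_subspace X = family_subspace {E i | i. i < q \<and> E i \<subseteq> X}"
proof (intro equalityI subsetI family_subspaceI diag_subspaceI)
  fix u x y assume u: "u \<in> family_subspace {E i | i. i < q \<and> E i \<subseteq> X}" and xy: "x \<in> X" "y \<in> X"
  have const: "u $ a = u $ b" if "k < q" "E k \<subseteq> X" "a \<in> E k" "b \<in> E k" for k a b
    using family_subspaceD[OF u, of "E k"] that by blast
  obtain i where i: "i < q" "E i \<subseteq> X" "x \<in> E i" using edge_unionsE[OF X xy(1)] by metis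
  obtain j where j: "j < q" "E j \<subseteq> X" "y \<in> E j" using edge_unionsE[OF X xy(2)] by metis
  obtain k where k: "k < q" "E k \<subseteq> E i \<union> E j" "E k \<inter> E i \<noteq> {}" "E k \<inter> E j \<noteq> {}"
    using edge_bridge[OF i(1) j(1)] by auto
  obtain a b where ab: "a \<in> E k" "a \<in> E i" "b \<in> E k" "b \<in> E j" using k(3,4) by auto
  have "E k \<subseteq> X" using k(2) i(2) j(2) by auto
  then show "u $ x = u $ y"
    using const[OF i ab(2)] const[OF k(1) _ ab(1,3)] const[OF j(1,2) ab(4) j(3)] by simp
qed (auto intro: diag_subspaceD)

lemma family_subspace_edge_unions:
  assumes "Q \<subseteq> edge_unions"
  shows "family_subspace Q = family_subspace {E i | i. i < q \<and> (\<exists>X\<in>Q. E i \<subseteq> X)}"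
proof -
  have "family_subspace Q = (\<Inter>X\<in>Q. family_subspace {E i | i. i < q \<and> E i \<subseteq> X})"
    unfolding family_subspace_def[of Q] using assms diag_subspace_edge_union
    by (intro INF_cong[OF HOL.refl]) auto
  also have "\<dots> = family_subspace {E i | i. i < q \<and> (\<exists>X\<in>Q. E i \<subseteq> X)}"
    unfolding family_subspace_def by blast
  finally show ?thesis .
qed

lemma
  assumes "\<E> \<subseteq> E ` {..<q}"
  shows coordinate_classes_edge_unions: "coordinate_classes (family_subspace \<E>) \<subseteq> edge_unions"
    and coordinate_classes_families: "coordinate_classes (family_subspace \<E>) \<in> families"
proof -
  have covered: "\<exists>i<q. E i \<subseteq> C \<and> x \<in> E i" if "C \<in> coordinate_classes (family_subspace \<E>)" "x \<in> C" for C x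
    using coordinate_classes_covered[OF that] assms by auto
  then show "coordinate_classes (family_subspace \<E>) \<subseteq> edge_unions"
    by (intro subsetI edge_unionsI)
  show "coordinate_classes (family_subspace \<E>) \<in> families"
  proof (rule familiesI)
    fix C assume C: "C \<in> coordinate_classes (family_subspace \<E>)"
    obtain x where "x \<in> C" using C coordinate_class_self unfolding coordinate_classes_def by blast
    then show "C \<in> blocks" using covered[OF C] unfolding blocks_def by auto
  qed (rule coordinate_classes_unique)
qed

end

subsection \<open>Intervals of the lattice of a shelled complex\<close>

lemma order_complex_interval_open_interval:
  "order_complex_interval \<Delta> U = order_complex (\<subset>) (open_interval \<Delta> U)"
  unfolding order_complex_interval_def order_complex_def comparable_psubset ..

locale shelled_complex =
  fixes \<Delta> :: "('n::finite) set set" and Fs :: "'n set list"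
  assumes dim_le: "\<forall>F\<in>\<Delta>. int (card F) - 1 \<le> int CARD('n) - 3"
    and shelling: "shelling \<Delta> Fs"
begin

definition E :: "nat \<Rightarrow> 'n set" where
  "E i = UNIV - Fs ! i"

abbreviation q :: nat where
  "q \<equiv> length Fs"

lemma set_Fs: "set Fs = facets \<Delta>" and distinct_Fs: "distinct Fs"
  using shelling unfolding shelling_def by auto

lemma Fs_facet: "i < q \<Longrightarrow> Fs ! i \<in> facets \<Delta>"
  unfolding set_Fs[symmetric] by (rule nth_mem)

lemma card_E: "card (E i) + card (Fs ! i) = CARD('n)"
proof -
  have "card (E i) = CARD('n) - card (Fs ! i)" unfolding E_def by (simp add: card_Diff_subset)
  moreover have "card (Fs ! i) \<le> CARD('n)" by (simp add: card_mono)
  ultimately show ?thesis by simp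
qed

lemma card_E_ge_2:
  assumes "i < q"
  shows "2 \<le> card (E i)"
proof -
  have "Fs ! i \<in> \<Delta>" using Fs_facet[OF assms] unfolding facets_def by auto
  then have "int (card (Fs ! i)) - 1 \<le> int CARD('n) - 3" using dim_le by auto
  then show ?thesis using card_E[of i] by linarith
qed

lemma complement_exchange:
  assumes "i < j" "j < q"
  shows "\<exists>v\<in>E i. v \<notin> E j \<and> (\<exists>k<j. E k \<subseteq> insert v (E j))"
proof -
  let ?K = "{t. t \<subseteq> Fs ! j \<and> (\<exists>i<j. t \<subseteq> Fs ! i)}"
  have pure: "pure_of_dim ?K (int (card (Fs ! j)) - 2)" using shelling assms unfolding shelling_def by auto
  have "Fs ! i \<inter> Fs ! j \<in> ?K" using assms(1) by auto
  then obtain G where G: "G \<in> ?K" "Fs ! i \<inter> Fs ! j \<subseteq> G" "\<forall>b\<in>?K. G \<subseteq> b \<longrightarrow> G = b"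
    using finite_has_maximal2[of ?K "Fs ! i \<inter> Fs ! j"] by auto
  then have "G \<in> facets ?K" unfolding facets_def by auto
  then have "card (Fs ! j) = card G + 1" using pure unfolding pure_of_dim_def by force
  then have "card (Fs ! j - G) = 1" using G(1) by (simp add: card_Diff_subset)
  then obtain v where v: "Fs ! j - G = {v}" by (auto simp: card_1_singleton_iff)
  then have "v \<in> Fs ! j" "v \<notin> G" by auto
  obtain k where k: "k < j" "G \<subseteq> Fs ! k" using G(1) by auto
  have "v \<in> E i" "v \<notin> E j"
    using \<open>v \<in> Fs ! j\<close> \<open>v \<notin> G\<close> G(2) unfolding E_def by auto
  moreover have "E k \<subseteq> insert v (E j)" using k(2) v unfolding E_def by auto
  ultimately show ?thesis using k(1) by auto
qed

sublocale shelled_edges E q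
proof
  show "i = j" if "i < q" "j < q" "E i \<subseteq> E j" for i j
  proof -
    have "Fs ! j \<subseteq> Fs ! i" using that(3) unfolding E_def by auto
    then have "Fs ! i = Fs ! j" using Fs_facet[OF that(2)] Fs_facet[OF that(1)] unfolding facets_def by auto
    then show ?thesis using distinct_Fs that by (simp add: nth_eq_iff_index_eq)
  qed
qed (rule card_E_ge_2 complement_exchange; assumption)+

lemma arrangement_eq: "arrangement \<Delta> = diag_subspace ` E ` {..<q}"
proof -
  have "facets \<Delta> = (!) Fs ` {..<q}" unfolding set_Fs[symmetric] by (auto simp: set_conv_nth)
  then show ?thesis unfolding arrangement_def E_def by auto
qed

lemma intersection_lattice_eq: "intersection_lattice \<Delta> = family_subspace ` {Q\<in>families. Q \<subseteq> edge_unions}"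
proof (intro equalityI subsetI)
  fix L assume "L \<in> intersection_lattice \<Delta>"
  then obtain S where S: "S \<subseteq> diag_subspace ` E ` {..<q}" "L = \<Inter>S"
    unfolding intersection_lattice_def arrangement_eq by auto
  obtain \<E> where \<E>: "\<E> \<subseteq> E ` {..<q}" "S = diag_subspace ` \<E>"
    by (rule subset_imageE[OF S(1)])
  have "L = family_subspace (coordinate_classes (family_subspace \<E>))"
    unfolding family_subspace_coordinate_classes S(2) \<E>(2) by (rule family_subspace_def[symmetric])
  then show "L \<in> family_subspace ` {Q\<in>families. Q \<subseteq> edge_unions}"
    using coordinate_classes_edge_unions[OF \<E>(1)] coordinate_classes_families[OF \<E>(1)] by blast
next
  fix L assume "L \<in> family_subspace ` {Q\<in>families. Q \<subseteq> edge_unions}"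
  then obtain Q where Q: "Q \<subseteq> edge_unions" "L = family_subspace Q" by auto
  let ?\<E> = "{E i | i. i < q \<and> (\<exists>X\<in>Q. E i \<subseteq> X)}"
  have "L = \<Inter>(diag_subspace ` ?\<E>)"
    unfolding Q(2) family_subspace_edge_unions[OF Q(1)] by (rule family_subspace_def)
  moreover have "diag_subspace ` ?\<E> \<subseteq> arrangement \<Delta>"
    unfolding arrangement_eq by (rule image_mono) auto
  ultimately show "L \<in> intersection_lattice \<Delta>" unfolding intersection_lattice_def by blast
qed

lemma diag_subspace_lattice_block:
  assumes "diag_subspace B \<in> intersection_lattice \<Delta>" "diag_subspace B \<noteq> UNIV"
  shows "B \<in> blocks"
proof -
  obtain Q where Q: "Q \<in> families" "diag_subspace B = family_subspace Q"
    using assms(1) unfolding intersection_lattice_eq by auto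
  have "Q \<noteq> {}" using Q(2) assms(2) family_subspace_empty by metis
  then obtain C where C: "C \<in> Q" by auto
  note block = families_block[OF Q(1) C]
  obtain x where "x \<in> C" using block_nonempty[OF block] by auto
  moreover have "family_subspace {B} \<subseteq> diag_subspace C"
    unfolding family_subspace_singleton Q(2) unfolding family_subspace_def using C by (rule INT_lower)
  ultimately have "\<exists>Y\<in>{B}. C \<subseteq> Y"
    using block_not_subset_singleton[OF block] by (intro family_subspace_subset_diag_subspace) auto
  then show ?thesis using block_mono[OF block] by simp
qed

lemma open_interval_eq:
  assumes B: "B \<in> blocks"
  shows "open_interval \<Delta> (diag_subspace B) = family_subspace ` edge_families_below B"
proof -
  have bounds_iff: "diag_subspace B \<subset> family_subspace Q \<and> family_subspace Q \<subset> UNIV \<longleftrightarrow> strictly_finer {} Q \<and> strictly_finer Q {B}"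
    if "Q \<in> families" for Q
    unfolding family_subspace_singleton[symmetric] family_subspace_empty[symmetric]
    using family_subspace_psubset_iff[OF that] family_subspace_psubset_iff[OF empty_families that] B
    by (auto simp: singleton_families)
  have "{Q\<in>{Q\<in>families. Q \<subseteq> edge_unions}. diag_subspace B \<subset> family_subspace Q \<and> family_subspace Q \<subset> UNIV}
      = edge_families_below B"
    unfolding edge_families_below_def by (rule set_eqI) (simp only: mem_Collect_eq, metis bounds_iff)
  then show ?thesis unfolding open_interval_def intersection_lattice_eq Compr_image_eq by simp
qed

end

section \<open>Shelling-trapped decompositions\<close>

lemma saturated_chain_insert_ends:
  assumes U: "U \<in> intersection_lattice \<Delta>" and c: "max_chain (\<subset>) (open_interval \<Delta> U) c"
  shows "saturated_chain \<Delta> U (insert UNIV (insert U c))"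
  unfolding saturated_chain_def
proof (intro conjI ballI impI)
  have mem: "X \<in> intersection_lattice \<Delta> \<and> U \<subset> X \<and> X \<subset> UNIV" if "X \<in> c" for X
    using subsetD[OF max_chain_subset[OF c] that] unfolding open_interval_def by simp
  have "UNIV \<in> intersection_lattice \<Delta>"
    unfolding intersection_lattice_def by (auto intro: exI[of _ "{}"])
  then show "insert UNIV (insert U c) \<subseteq> intersection_lattice \<Delta>" using U mem by auto
  show bottom: "U \<subseteq> X" if "X \<in> insert UNIV (insert U c)" for X using that mem by auto
  fix X Y assume XY: "X \<in> insert UNIV (insert U c)" "Y \<in> insert UNIV (insert U c)"
  show "X \<subseteq> Y \<or> Y \<subseteq> X"
  proof (cases "X \<in> c \<and> Y \<in> c")
    case True
    then show ?thesis
      using order_complex_comparable[OF max_chain_order_complex[OF c], of X Y] unfolding comparable_psubset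
      by simp
  next
    case False
    then show ?thesis using XY bottom[OF XY(1)] bottom[OF XY(2)] by auto
  qed
next
  fix X assume X: "X \<in> intersection_lattice \<Delta>" "U \<subseteq> X \<and> (\<forall>Y\<in>insert UNIV (insert U c). X \<subseteq> Y \<or> Y \<subseteq> X)"
  show "X \<in> insert UNIV (insert U c)"
  proof (cases "X = UNIV \<or> X = U")
    case False
    then have "X \<in> open_interval \<Delta> U" unfolding open_interval_def using X by auto
    then have "X \<in> c"
      by (rule max_chain_mem[OF c]) (use X(2) in \<open>simp add: comparable_psubset\<close>)
    then show ?thesis by simp
  qed auto
qed simp_all

lemma bij_betw_Sigma:
  assumes f: "bij_betw f A B" and g: "\<And>a. a \<in> A \<Longrightarrow> bij_betw (g a) (C a) (D (f a))"
  shows "bij_betw (\<lambda>(a, c). (f a, g a c)) (Sigma A C) (Sigma B D)"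
  unfolding bij_betw_def
proof
  show "inj_on (\<lambda>(a, c). (f a, g a c)) (Sigma A C)"
  proof (rule inj_onI, clarify)
    fix a c a' c' assume mem: "a \<in> A" "c \<in> C a" "a' \<in> A" "c' \<in> C a'" and eq: "f a = f a'" "g a c = g a' c'"
    have "a = a'" by (rule inj_onD[OF bij_betw_imp_inj_on[OF f] eq(1) mem(1,3)])
    then show "a = a' \<and> c = c'"
      using inj_onD[OF bij_betw_imp_inj_on[OF g[OF mem(1)]] _ mem(2), of c'] eq(2) mem(4) by simp
  qed
  have "(\<lambda>(a, c). (f a, g a c)) ` Sigma A C = (\<Union>a\<in>A. {f a} \<times> g a ` C a)" by auto
  also have "\<dots> = (\<Union>a\<in>A. {f a} \<times> D (f a))"
    by (rule SUP_cong[OF HOL.refl]) (simp add: bij_betw_imp_surj_on[OF g])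
  also have "\<dots> = Sigma (f ` A) D" by auto
  finally show "(\<lambda>(a, c). (f a, g a c)) ` Sigma A C = Sigma B D"
    unfolding bij_betw_imp_surj_on[OF f] .
qed

context shelled_complex
begin

lemma restriction_eq: "restriction i = {v. v \<in> Fs ! i \<and> (\<exists>k<i. Fs ! i - {v} \<subseteq> Fs ! k)}"
proof -
  have "E k \<subseteq> insert v (E i) \<longleftrightarrow> Fs ! i - {v} \<subseteq> Fs ! k" for k v
    unfolding E_def by blast
  moreover have "v \<notin> E i \<longleftrightarrow> v \<in> Fs ! i" for v unfolding E_def by simp
  ultimately show ?thesis unfolding restriction_def by simp
qed

lemma shelling_G_eq: "shelling_G Fs i = Fs ! i - restriction i"
proof (cases "i = 0")
  case True
  then show ?thesis unfolding shelling_G_def restriction_eq by simp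
next
  case False
  have "old_walls Fs i = (\<lambda>v. Fs ! i - {v}) ` restriction i"   
    unfolding old_walls_def restriction_eq by (rule setcompr_eq_image)
  then show ?thesis using False unfolding shelling_G_def by auto
qed

lemma trapping_indices_iff:
  "i \<in> trapping_indices q \<tau> \<longleftrightarrow> i < q \<and> shelling_G Fs i \<subseteq> UNIV - \<tau> \<and> UNIV - \<tau> \<subseteq> Fs ! i"
proof -
  have "\<tau> \<subseteq> E i \<union> restriction i \<longleftrightarrow> shelling_G Fs i \<subseteq> UNIV - \<tau>" unfolding shelling_G_eq E_def by auto
  moreover have "E i \<subseteq> \<tau> \<longleftrightarrow> UNIV - \<tau> \<subseteq> Fs ! i"
    unfolding E_def by auto
  ultimately show ?thesis unfolding trapping_indices_def by auto
qed

definition facet_decomp :: "('n set \<times> nat) set \<Rightarrow> ('n set \<times> 'n set) set" where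
  "facet_decomp D = map_prod id ((!) Fs) ` D"

definition index_decomp :: "('n set \<times> 'n set) set \<Rightarrow> ('n set \<times> nat) set" where
  "index_decomp = inv_into (Pow (UNIV \<times> {..<q})) facet_decomp"

lemma bij_betw_facet: "bij_betw (map_prod id ((!) Fs)) (UNIV \<times> {..<q}) (UNIV \<times> set Fs)"
  by (rule bij_betw_map_prod[OF bij_betw_id bij_betw_nth[OF distinct_Fs HOL.refl HOL.refl]])

lemma bij_betw_facet_decomp: "bij_betw facet_decomp (Pow (UNIV \<times> {..<q})) (Pow (UNIV \<times> set Fs))"
  unfolding facet_decomp_def[abs_def] by (rule bij_betw_Pow[OF bij_betw_facet])

lemma trapped_decomps_subset: "trapped_decomps B \<subseteq> Pow (UNIV \<times> {..<q})"
proof (intro subsetI PowI)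
  fix D p assume "D \<in> trapped_decomps B" "p \<in> D"
  then show "p \<in> UNIV \<times> {..<q}"
    using trapping_less[OF trappings_index[OF trapped_decomps_trappings]] by (simp add: mem_Times_iff)
qed

lemma trapped_decomps_iff:
  "D \<in> trapped_decomps B \<longleftrightarrow> \<Union>(fst ` D) = B
    \<and> (\<forall>p\<in>D. \<forall>r\<in>D. p \<noteq> r \<longrightarrow> fst p \<inter> fst r = {}) \<and> (\<forall>p\<in>D. snd p \<in> trapping_indices q (fst p))"
proof (cases "\<forall>p\<in>D. snd p \<in> trapping_indices q (fst p)")
  case True
  then have block: "fst p \<in> blocks" if "p \<in> D" for p
    using that unfolding trapping_indices_def blocks_def by auto
  have "fst ` D \<in> families \<and> inj_on fst D \<longleftrightarrow> (\<forall>p\<in>D. \<forall>r\<in>D. p \<noteq> r \<longrightarrow> fst p \<inter> fst r = {})"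
  proof (intro iffI conjI ballI impI)
    fix p r assume fam: "fst ` D \<in> families \<and> inj_on fst D" and pr: "p \<in> D" "r \<in> D" "p \<noteq> r"
    then have "fst p \<noteq> fst r" by (auto dest: inj_onD)
    moreover have "disjoint (fst ` D)" using fam unfolding families_def by simp
    ultimately show "fst p \<inter> fst r = {}" using pr(1,2) by (intro disjointD) auto
  next
    assume disj: "\<forall>p\<in>D. \<forall>r\<in>D. p \<noteq> r \<longrightarrow> fst p \<inter> fst r = {}"
    have same: "p = r" if "p \<in> D" "r \<in> D" "x \<in> fst p" "x \<in> fst r" for p r x
      using disj that by (metis IntI emptyE)
    show "fst ` D \<in> families"
      by (rule familiesI) (use block same in \<open>blast+\<close>)
    show "inj_on fst D"
    proof (rule inj_onI)
      fix p r assume "p \<in> D" "r \<in> D" "fst p = fst r"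
      moreover obtain x where "x \<in> fst p"
        using block_nonempty[OF block[OF \<open>p \<in> D\<close>]] by auto
      ultimately show "p = r" using same by metis
    qed
  qed
  then show ?thesis using True unfolding trapped_decomps_def trappings_def mem_Collect_eq by argo
next
  case False
  then show ?thesis unfolding trapped_decomps_def trappings_def mem_Collect_eq by argo
qed

lemma shelling_trapped_facet_decomp:
  assumes "D \<subseteq> UNIV \<times> {..<q}"
  shows "shelling_trapped_decomp Fs B (facet_decomp D) \<longleftrightarrow> D \<in> trapped_decomps B"
proof -
  have inj: "inj_on (map_prod id ((!) Fs)) D"
    by (rule inj_on_subset[OF bij_betw_imp_inj_on[OF bij_betw_facet] assms])
  have "(\<exists>i<q. Fs ! i = Fs ! snd p \<and> shelling_G Fs i \<subseteq> UNIV - fst p \<and> UNIV - fst p \<subseteq> Fs ! snd p)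
      \<longleftrightarrow> snd p \<in> trapping_indices q (fst p)" if "p \<in> D" for p
  proof -
    have "i = snd p" if "i < q" "Fs ! i = Fs ! snd p" for i
      using that assms \<open>p \<in> D\<close> by (auto simp: nth_eq_iff_index_eq[OF distinct_Fs])
    then show ?thesis unfolding trapping_indices_iff by auto
  qed
  then have "(\<forall>(\<tau>, F)\<in>facet_decomp D. \<exists>i<q. Fs ! i = F \<and> shelling_G Fs i \<subseteq> UNIV - \<tau> \<and> UNIV - \<tau> \<subseteq> F)
      \<longleftrightarrow> (\<forall>p\<in>D. snd p \<in> trapping_indices q (fst p))"
    unfolding facet_decomp_def by (simp add: case_prod_unfold)
  moreover have "(\<forall>a\<in>facet_decomp D. \<forall>b\<in>facet_decomp D. a \<noteq> b \<longrightarrow> fst a \<inter> fst b = {})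
      \<longleftrightarrow> (\<forall>p\<in>D. \<forall>r\<in>D. p \<noteq> r \<longrightarrow> fst p \<inter> fst r = {})"
    unfolding facet_decomp_def by (simp add: inj_on_eq_iff[OF inj] cong: ball_cong)
  moreover have "fst ` facet_decomp D = fst ` D" unfolding facet_decomp_def by (simp add: image_image)
  ultimately show ?thesis unfolding shelling_trapped_decomp_def trapped_decomps_iff by simp
qed

lemma shelling_trapped_decomp_facets:
  assumes "shelling_trapped_decomp Fs B D"
  shows "D \<in> facet_decomp ` Pow (UNIV \<times> {..<q})"
  unfolding bij_betw_imp_surj_on[OF bij_betw_facet_decomp]
proof (intro PowI subsetI)
  fix d assume "d \<in> D"
  then obtain i where "i < q" "Fs ! i = snd d" using assms unfolding shelling_trapped_decomp_def by fastforce
  then show "d \<in> UNIV \<times> set Fs" using nth_mem[of i Fs] by (simp add: mem_Times_iff)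
qed

lemma facet_decomp_index_decomp: "shelling_trapped_decomp Fs B D \<Longrightarrow> facet_decomp (index_decomp D) = D"
  unfolding index_decomp_def by (rule f_inv_into_f[OF shelling_trapped_decomp_facets])

lemma bij_betw_index_decomp: "bij_betw index_decomp {D. shelling_trapped_decomp Fs B D} (trapped_decomps B)"
  unfolding index_decomp_def
proof (rule bij_betw_inv_into_subset[OF bij_betw_facet_decomp trapped_decomps_subset], intro equalityI subsetI)
  fix D assume "D \<in> facet_decomp ` trapped_decomps B"
  then show "D \<in> {D. shelling_trapped_decomp Fs B D}"
    using shelling_trapped_facet_decomp trapped_decomps_subset by blast
next
  fix D assume "D \<in> {D. shelling_trapped_decomp Fs B D}"
  then have D: "shelling_trapped_decomp Fs B D" by simp
  obtain D' where D': "D' \<subseteq> UNIV \<times> {..<q}" "D = facet_decomp D'"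
    using shelling_trapped_decomp_facets[OF D] by blast
  then show "D \<in> facet_decomp ` trapped_decomps B" using D shelling_trapped_facet_decomp[OF D'(1)] by simp
qed

lemma index_decomp_trapped: "shelling_trapped_decomp Fs B D \<Longrightarrow> index_decomp D \<in> trapped_decomps B"
  using bij_betwE[OF bij_betw_index_decomp] by simp

subsection \<open>The dimension of a decomposition\<close>

context
  fixes B :: "'n set" and D :: "('n set \<times> nat) set"
  assumes D: "D \<in> trapped_decomps B"
begin

lemma inj_on_fst_trapped: "inj_on fst D"
  by (rule trappings_inj[OF trapped_decomps_trappings[OF D]])

lemma inj_on_facet_trapped: "inj_on (map_prod id ((!) Fs)) D"
  using bij_betw_imp_inj_on[OF bij_betw_facet] trapped_decomps_subset D by (blast intro: inj_on_subset)

lemma card_facet_decomp: "card (facet_decomp D) = card (fst ` D)"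
  unfolding facet_decomp_def card_image[OF inj_on_facet_trapped] card_image[OF inj_on_fst_trapped] ..

lemma sum_card_facets: "(\<Sum>d\<in>facet_decomp D. int (card (snd d))) = (\<Sum>p\<in>D. int CARD('n) - int (card (E (snd p))))"
proof -
  have "int (card (Fs ! i)) = int CARD('n) - int (card (E i))" for i using card_E[of i] by linarith
  then show ?thesis unfolding facet_decomp_def by (simp add: sum.reindex[OF inj_on_facet_trapped])
qed

lemma card_Union_trapped: "card B = (\<Sum>p\<in>D. card (fst p))"
proof -
  have "card (\<Union>(fst ` D)) = (\<Sum>X\<in>fst ` D. card X)"
    using trapped_decomps_families[OF D] unfolding families_def
    by (intro card_Union_disjoint) (auto simp: disjoint_def pairwise_def disjnt_def)
  then show ?thesis unfolding trapped_decomps_Union[OF D] by (simp add: sum.reindex[OF inj_on_fst_trapped])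
qed

lemma int_trapping_size: "int (trapping_size D) = (\<Sum>p\<in>D. int (card (fst p)) - int (card (E (snd p))) + 1)"
  unfolding trapping_size_def of_nat_sum
proof (rule sum.cong[OF HOL.refl])
  fix p assume "p \<in> D"
  then have "E (snd p) \<subseteq> fst p"
    by (rule trapping_subset[OF trappings_index[OF trapped_decomps_trappings[OF D]]])
  then have "card (E (snd p)) \<le> card (fst p)" by (simp add: card_mono)
  then show "int (card (fst p) - card (E (snd p)) + 1) = int (card (fst p)) - int (card (E (snd p))) + 1"
    by (simp add: of_nat_diff)
qed

lemma decomp_dim_facet_decomp: "decomp_dim (facet_decomp D) B + 3 = int (trapping_size D + card (fst ` D))"
  unfolding decomp_dim_def sum_card_facets card_Union_trapped of_nat_add int_trapping_size card_facet_decomp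
  by (simp add: card_image[OF inj_on_fst_trapped] sum.distrib sum_subtractf algebra_simps)

end

subsection \<open>Critical chains of subspaces\<close>

definition decomp_perms :: "'n set \<Rightarrow> (('n set \<times> 'n set) set \<times> (nat \<Rightarrow> nat)) set" where
  "decomp_perms B = {(D, w). shelling_trapped_decomp Fs B D \<and> w permutes {1..card D - 1}}"

definition perm_coarsening :: "('n set \<times> 'n set) set \<Rightarrow> (nat \<Rightarrow> nat) \<Rightarrow> 'n set set set" where
  "perm_coarsening D = (SOME h. bij_betw h {w. w permutes {1..card D - 1}} (coarsening_chains (fst ` index_decomp D)))"

definition interior_chain :: "'n set \<Rightarrow> ('n set \<times> 'n set) set \<Rightarrow> (nat \<Rightarrow> nat) \<Rightarrow> (real^'n) set set" where
  "interior_chain B D w = family_subspace ` decomp_chain B (index_decomp D) (perm_coarsening D w)"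

definition saturated_decomp_chain :: "'n set \<Rightarrow> ('n set \<times> 'n set) set \<Rightarrow> (nat \<Rightarrow> nat) \<Rightarrow> (real^'n) set set" where
  "saturated_decomp_chain B D w = insert UNIV (insert (diag_subspace B) (interior_chain B D w))"

definition removed_chains :: "'n set \<Rightarrow> (real^'n) set set set" where
  "removed_chains B = (`) family_subspace ` decomp_chains B"

lemma decomp_perms_Sigma:
  "decomp_perms B = (SIGMA D:{D. shelling_trapped_decomp Fs B D}. {w. w permutes {1..card D - 1}})"
  unfolding decomp_perms_def by auto

lemma bij_betw_perm_coarsening:
  assumes "shelling_trapped_decomp Fs B D"
  shows "bij_betw (perm_coarsening D) {w. w permutes {1..card D - 1}} (coarsening_chains (fst ` index_decomp D))"
proof -
  note trapped = index_decomp_trapped[OF assms]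
  have "card (coarsening_chains (fst ` index_decomp D)) = fact (card D - 1)"
    using card_coarsening_chains[OF trapped_decomps_families[OF trapped]] card_facet_decomp[OF trapped]
    unfolding facet_decomp_index_decomp[OF assms] by simp
  moreover have "card {w. w permutes {1..card D - 1}} = fact (card D - 1)" by (rule card_permutations) auto
  ultimately have "\<exists>h. bij_betw h {w. w permutes {1..card D - 1}} (coarsening_chains (fst ` index_decomp D))"
    by (intro finite_same_card_bij) (auto intro: finite_permutations)
  then show ?thesis unfolding perm_coarsening_def by (rule someI_ex)
qed

lemma bij_betw_decomp_perms:
  "bij_betw (\<lambda>(D, w). (index_decomp D, perm_coarsening D w)) (decomp_perms B) (chain_index B)"
  unfolding decomp_perms_Sigma chain_index_def
  by (rule bij_betw_Sigma[OF bij_betw_index_decomp]) (unfold mem_Collect_eq, rule bij_betw_perm_coarsening)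

lemma edge_families_below_families: "edge_families_below B \<subseteq> families"
  unfolding edge_families_below_def by auto

context
  fixes B :: "'n set"
  assumes B: "B \<in> blocks"
begin

lemma decomp_chains_subset:
  assumes "c \<in> decomp_chains B"
  shows "c \<subseteq> edge_families_below B"
proof
  fix Q assume Q: "Q \<in> c"
  have "Q \<in> interval {} {B}"
    using max_chain_subset[OF max_chain_decomp_chains[OF B assms]] Q by (rule subsetD)
  moreover have "Q \<subseteq> edge_unions"
    using assms Q decomp_chain_edge_unions[OF B] unfolding chain_index_def by auto
  ultimately show "Q \<in> edge_families_below B" unfolding edge_families_below_def by simp
qed

lemma max_chain_edge_families_below:
  assumes "c \<in> decomp_chains B"
  shows "max_chain strictly_finer (edge_families_below B) c"
  by (rule max_chain_restrict[OF max_chain_decomp_chains[OF B assms] decomp_chains_subset[OF assms]])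
    (auto simp: edge_families_below_def)

lemma bij_betw_interior_chain: "bij_betw (\<lambda>(D, w). interior_chain B D w) (decomp_perms B) (removed_chains B)"
proof -
  have "decomp_chains B \<subseteq> Pow families"
    using decomp_chains_subset edge_families_below_families by blast
  then have "bij_betw ((`) family_subspace) (decomp_chains B) (removed_chains B)"
    unfolding removed_chains_def
    by (intro inj_on_imp_bij_betw inj_on_subset[OF inj_on_image_Pow[OF inj_on_family_subspace]])
  with inj_on_imp_bij_betw[OF inj_on_decomp_chain[OF B]]
  have "bij_betw ((`) family_subspace \<circ> (\<lambda>(D, t). decomp_chain B D t)) (chain_index B) (removed_chains B)"
    by (rule bij_betw_trans)
  from bij_betw_trans[OF bij_betw_decomp_perms this] show ?thesis
    by (simp add: comp_def case_prod_unfold interior_chain_def)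
qed

lemma removed_chains_max:
  assumes "s \<in> removed_chains B"
  shows "max_chain (\<subset>) (open_interval \<Delta> (diag_subspace B)) s"
proof -
  obtain c where c: "c \<in> decomp_chains B" "s = family_subspace ` c"
    using assms unfolding removed_chains_def by blast
  have "max_chain (\<subset>) (family_subspace ` edge_families_below B) (family_subspace ` c)
      \<longleftrightarrow> max_chain strictly_finer (edge_families_below B) c"
    using edge_families_below_families
    by (intro max_chain_image decomp_chains_subset[OF c(1)] inj_on_subset[OF inj_on_family_subspace]
        comparable_family_subspace) auto
  then show ?thesis unfolding open_interval_eq[OF B] c(2) using max_chain_edge_families_below[OF c(1)] by simp
qed

lemma removed_chains_facets: "removed_chains B \<subseteq> facets (order_complex_interval \<Delta> (diag_subspace B))"
  unfolding order_complex_interval_open_interval using max_chain_facet[OF removed_chains_max] by blast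

lemma int_card_interior_chain:
  assumes "(D, w) \<in> decomp_perms B"
  shows "int (card (interior_chain B D w)) = decomp_dim D B + 1"
proof -
  let ?D = "index_decomp D"
  have D: "shelling_trapped_decomp Fs B D" using assms unfolding decomp_perms_def by simp
  have index: "(?D, perm_coarsening D w) \<in> chain_index B"
    using bij_betwE[OF bij_betw_decomp_perms[of B]] assms by fastforce
  then have "decomp_chain B ?D (perm_coarsening D w) \<in> decomp_chains B" by force
  then have "decomp_chain B ?D (perm_coarsening D w) \<subseteq> families"
    by (rule subset_trans[OF decomp_chains_subset edge_families_below_families])
  then have "card (interior_chain B D w) = card (decomp_chain B ?D (perm_coarsening D w))"
    unfolding interior_chain_def by (rule card_image[OF inj_on_subset[OF inj_on_family_subspace]])
  moreover have "card (decomp_chain B ?D (perm_coarsening D w)) + 2 = trapping_size ?D + card (fst ` ?D)"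
    using index unfolding chain_index_def by (intro card_decomp_chain[OF B]) auto
  ultimately show ?thesis
    using decomp_dim_facet_decomp[OF index_decomp_trapped[OF D]] unfolding facet_decomp_index_decomp[OF D]
    by linarith
qed

lemma card_removed_chains:
  "card {s\<in>removed_chains B. int (card s) - 1 = d}
    = (\<Sum>D\<in>{D. shelling_trapped_decomp Fs B D \<and> decomp_dim D B = d}. fact (card D - 1))"
proof -
  let ?A = "{D. shelling_trapped_decomp Fs B D \<and> decomp_dim D B = d}"
  let ?P = "SIGMA D:?A. {w. w permutes {1..card D - 1}}"
  let ?f = "\<lambda>(D, w). interior_chain B D w"
  have "int (card (?f p)) - 1 = decomp_dim (fst p) B" if "p \<in> decomp_perms B" for p
    using int_card_interior_chain that by (cases p) auto
  then have "{s\<in>removed_chains B. int (card s) - 1 = d} = ?f ` {p\<in>decomp_perms B. decomp_dim (fst p) B = d}"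
    unfolding bij_betw_imp_surj_on[OF bij_betw_interior_chain, symmetric] by auto
  also have "{p\<in>decomp_perms B. decomp_dim (fst p) B = d} = ?P" unfolding decomp_perms_def by auto
  finally have "card {s\<in>removed_chains B. int (card s) - 1 = d} = card (?f ` ?P)" by simp
  also have "\<dots> = card ?P"
    by (rule card_image[OF inj_on_subset[OF bij_betw_imp_inj_on[OF bij_betw_interior_chain]]]) (auto simp: decomp_perms_def)
  also have "\<dots> = (\<Sum>D\<in>?A. card {w. w permutes {1..card D - 1}})"
    by (rule card_SigmaI) (auto intro: finite_permutations)
  also have "\<dots> = (\<Sum>D\<in>?A. fact (card D - 1))"
    by (rule sum.cong[OF HOL.refl]) (rule card_permutations, simp_all)
  finally show ?thesis .
qed

lemma order_complex_diff_family_subspace: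
  assumes "X \<subseteq> families" "S \<subseteq> order_complex strictly_finer X"
  shows "(`) family_subspace ` (order_complex strictly_finer X - S)
    = order_complex (\<subset>) (family_subspace ` X) - (`) family_subspace ` S"
  using assms
  by (intro order_complex_image_diff inj_on_subset[OF inj_on_family_subspace] comparable_family_subspace) auto

lemma removed_chains_critical: "critical_chains (\<subset>) (family_subspace ` interval {} {B}) (removed_chains B)"
  unfolding removed_chains_def
  by (intro critical_chains_image[OF _ _ interval_critical[OF B]] inj_on_subset[OF inj_on_family_subspace]
      comparable_family_subspace) auto

lemma collapses_remaining:
  "collapses (order_complex (\<subset>) (family_subspace ` interval {} {B}) - removed_chains B)
    (order_complex_interval \<Delta> (diag_subspace B) - removed_chains B)"
proof -
  let ?I = "interval {} {B}" and ?J = "edge_families_below B" and ?S = "decomp_chains B"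
  have I: "?I \<subseteq> families" by auto
  have chains: "?S \<subseteq> order_complex strictly_finer ?I" "?S \<subseteq> order_complex strictly_finer ?J"
    by (rule subsetI, erule max_chain_order_complex[OF max_chain_decomp_chains[OF B]])
      (rule subsetI, erule max_chain_order_complex[OF max_chain_edge_families_below])
  have "\<Union>(order_complex strictly_finer ?I - ?S) \<subseteq> families"
    using order_complex_subset I by fast
  from collapses_image[OF collapses_edge_families_below[OF decomp_chains_subset] inj_on_subset[OF inj_on_family_subspace this]]
  show ?thesis
    unfolding order_complex_diff_family_subspace[OF I chains(1)]
      order_complex_diff_family_subspace[OF edge_families_below_families chains(2)]
      order_complex_interval_open_interval open_interval_eq[OF B] removed_chains_def .
qed

lemma contractible_remaining_nonvoid:
  assumes "{} \<notin> removed_chains B"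
  shows "contractible_space (geom_realization (order_complex_interval \<Delta> (diag_subspace B) - removed_chains B))
    \<and> points (order_complex_interval \<Delta> (diag_subspace B) - removed_chains B) \<noteq> {}"
proof (rule contractible_space_collapses[OF _ _ collapses_remaining])
  show "collapsible (order_complex (\<subset>) (family_subspace ` interval {} {B}) - removed_chains B)"
    by (rule critical_chains_collapsible[OF removed_chains_critical])
  show "simplicial_complex (order_complex (\<subset>) (family_subspace ` interval {} {B}) - removed_chains B)"
    by (rule simplicial_complex_diff_facets[OF simplicial_complex_order_complex critical_chains_facets[OF removed_chains_critical]])
  show "{} \<in> order_complex_interval \<Delta> (diag_subspace B) - removed_chains B"
    unfolding order_complex_interval_open_interval using empty_order_complex assms by simp
qed

lemma removed_chains_void:
  assumes "{} \<in> removed_chains B"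
  shows "order_complex_interval \<Delta> (diag_subspace B) = {{}}" "removed_chains B = {{}}"
proof -
  have void: "open_interval \<Delta> (diag_subspace B) = {}"
    using max_chain_mem[OF removed_chains_max[OF assms]] by blast
  then show "order_complex_interval \<Delta> (diag_subspace B) = {{}}"
    unfolding order_complex_interval_open_interval by simp
  show "removed_chains B = {{}}" using max_chain_subset[OF removed_chains_max] assms void by blast
qed

lemma contractible_remaining:
  "contractible_space (geom_realization (order_complex_interval \<Delta> (diag_subspace B) - removed_chains B))"
proof (cases "{} \<in> removed_chains B")
  case True
  then show ?thesis using removed_chains_void unfolding geom_realization_points by (simp add: points_void)
next
  case False
  then show ?thesis using contractible_remaining_nonvoid by simp
qed

lemma interval_homotopy_wedge:
  assumes ss: "distinct ss" "set ss = removed_chains B"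
  shows "geom_realization (order_complex_interval \<Delta> (diag_subspace B))
    homotopy_equivalent_space wedge_of_spheres (map (\<lambda>s. int (card s) - 1) ss)"
proof (cases "{} \<in> removed_chains B")
  case True
  then have "set ss = {{}}" using ss(2) removed_chains_void(2) by simp
  then have "ss = [{}]" using ss(1) by (cases ss) (auto simp: subset_singleton_iff)
  moreover have "wedge_of_spheres [-1] = trivial_topology"
    unfolding wedge_of_spheres_def wedge_sphere_def by simp
  ultimately show ?thesis
    unfolding removed_chains_void(1)[OF True] geom_realization_points points_void
    by (simp add: homeomorphic_imp_homotopy_equivalent_space homeomorphic_empty_space_eq)
next
  case False
  interpret cells_attached_list "order_complex_interval \<Delta> (diag_subspace B)" "removed_chains B" ss
  proof
    show "finite (order_complex_interval \<Delta> (diag_subspace B))"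
      unfolding order_complex_interval_open_interval open_interval_eq[OF B]
      by (rule finite_order_complex) simp
    show "simplicial_complex (order_complex_interval \<Delta> (diag_subspace B))"
      unfolding order_complex_interval_open_interval by (rule simplicial_complex_order_complex)
  qed (rule removed_chains_facets False ss)+
  show ?thesis using contractible_remaining_nonvoid[OF False] by (intro homotopy_equivalent_wedge) simp_all
qed

lemma interval_wedge_of_spheres:
  "\<exists>ds. (\<forall>d. count (mset ds) d
      = (\<Sum>D\<in>{D. shelling_trapped_decomp Fs B D \<and> decomp_dim D B = d}. fact (card D - 1)))
    \<and> geom_realization (order_complex_interval \<Delta> (diag_subspace B)) homotopy_equivalent_space wedge_of_spheres ds"
proof -
  have "finite (removed_chains B)"
    unfolding removed_chains_def by (rule finite_imageI[OF finite])
  then obtain ss where ss: "set ss = removed_chains B" "distinct ss"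
    using finite_distinct_list by metis
  have "count (mset (map f ss)) d = card {s\<in>removed_chains B. f s = d}" for f :: "(real^'n) set set \<Rightarrow> int" and d
  proof -
    have "count (mset (map f ss)) d = (\<Sum>s | s \<in># mset ss \<and> d = f s. count (mset ss) s)"
      unfolding mset_map by (rule count_image_mset')
    also have "\<dots> = (\<Sum>s | s \<in> removed_chains B \<and> f s = d. 1)"
      using ss by (intro sum.cong) (auto simp: distinct_count_atmost_1)
    finally show ?thesis by simp
  qed
  then show ?thesis using interval_homotopy_wedge[OF ss(2,1)] card_removed_chains by metis
qed

subsection \<open>Saturated chains of subspaces\<close>

lemma interior_chain_max:
  assumes "(D, w) \<in> decomp_perms B"
  shows "max_chain (\<subset>) (open_interval \<Delta> (diag_subspace B)) (interior_chain B D w)"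
  using bij_betwE[OF bij_betw_interior_chain] assms by (intro removed_chains_max) auto

lemma saturated_decomp_chain_interior:
  assumes "(D, w) \<in> decomp_perms B"
  shows "saturated_decomp_chain B D w - {UNIV, diag_subspace B} = interior_chain B D w"
  using max_chain_subset[OF interior_chain_max[OF assms]]
  unfolding saturated_decomp_chain_def open_interval_def by auto

lemma saturated_decomp_chain_interiors:
  "{saturated_decomp_chain B D w - {UNIV, diag_subspace B} | D w.
    shelling_trapped_decomp Fs B D \<and> w permutes {1..card D - 1}} = removed_chains B"
proof -
  have "{saturated_decomp_chain B D w - {UNIV, diag_subspace B} | D w.
      shelling_trapped_decomp Fs B D \<and> w permutes {1..card D - 1}}
    = (\<lambda>(D, w). saturated_decomp_chain B D w - {UNIV, diag_subspace B}) ` decomp_perms B"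
    unfolding decomp_perms_def by (auto simp: image_iff)
  also have "\<dots> = (\<lambda>(D, w). interior_chain B D w) ` decomp_perms B"
    by (rule image_cong[OF HOL.refl]) (clarify, rule saturated_decomp_chain_interior)
  also have "\<dots> = removed_chains B" by (rule bij_betw_imp_surj_on[OF bij_betw_interior_chain])
  finally show ?thesis .
qed

lemma inj_on_saturated_decomp_chain: "inj_on (\<lambda>(D, w). saturated_decomp_chain B D w) (decomp_perms B)"
proof (rule inj_on_imageI2)
  show "inj_on ((\<lambda>c. c - {UNIV, diag_subspace B}) \<circ> (\<lambda>(D, w). saturated_decomp_chain B D w)) (decomp_perms B)"
    using bij_betw_imp_inj_on[OF bij_betw_interior_chain]
    by (rule inj_on_cong[THEN iffD2, rotated]) (unfold comp_def, clarify, rule saturated_decomp_chain_interior)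
qed

lemma
  assumes "(D, w) \<in> decomp_perms B"
  shows saturated_decomp_chain_saturated:
      "diag_subspace B \<in> intersection_lattice \<Delta> \<Longrightarrow> saturated_chain \<Delta> (diag_subspace B) (saturated_decomp_chain B D w)"
    and saturated_decomp_chain_simplex:
      "saturated_decomp_chain B D w - {UNIV, diag_subspace B} \<in> order_complex_interval \<Delta> (diag_subspace B)"
    and card_saturated_decomp_chain:
      "int (card (saturated_decomp_chain B D w - {UNIV, diag_subspace B})) = decomp_dim D B + 1"
  unfolding saturated_decomp_chain_interior[OF assms] order_complex_interval_open_interval
  using saturated_chain_insert_ends[OF _ interior_chain_max[OF assms]] max_chain_order_complex[OF interior_chain_max[OF assms]]
    int_card_interior_chain[OF assms]
  by (simp_all add: saturated_decomp_chain_def)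

end

end

theorem theorem4p1:
  fixes \<Delta> :: "('n::finite) set set" and Fs :: "'n set list" and \<sigma>bar :: "'n set"
  assumes cx: "simplicial_complex \<Delta>"
    and dim: "\<forall>F\<in>\<Delta>. int (card F) - 1 \<le> int CARD('n) - 3"
    and sh: "shelling \<Delta> Fs"
    and inL: "diag_subspace \<sigma>bar \<in> intersection_lattice \<Delta>"
    and nonbot: "diag_subspace \<sigma>bar \<noteq> UNIV"
  shows "(\<exists>ds. (\<forall>d. count (mset ds) d =
              (\<Sum>D\<in>{D. shelling_trapped_decomp Fs \<sigma>bar D \<and> decomp_dim D \<sigma>bar = d}.
                  fact (card D - 1)))
            \<and> geom_realization (order_complex_interval \<Delta> (diag_subspace \<sigma>bar))
                homotopy_equivalent_space wedge_of_spheres ds)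
       \<and> (\<exists>C. (\<forall>D w. shelling_trapped_decomp Fs \<sigma>bar D \<and> w permutes {1..card D - 1} \<longrightarrow>
                 saturated_chain \<Delta> (diag_subspace \<sigma>bar) (C D w) \<and>
                 C D w - {UNIV, diag_subspace \<sigma>bar}
                   \<in> order_complex_interval \<Delta> (diag_subspace \<sigma>bar) \<and>
                 int (card (C D w - {UNIV, diag_subspace \<sigma>bar})) = decomp_dim D \<sigma>bar + 1)
            \<and> inj_on (\<lambda>(D, w). C D w)
                {(D, w). shelling_trapped_decomp Fs \<sigma>bar D \<and> w permutes {1..card D - 1}}
            \<and> simplicial_complex (order_complex_interval \<Delta> (diag_subspace \<sigma>bar) -
                 {C D w - {UNIV, diag_subspace \<sigma>bar} | D w.
                    shelling_trapped_decomp Fs \<sigma>bar D \<and> w permutes {1..card D - 1}})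
            \<and> contractible_space (geom_realization (order_complex_interval \<Delta> (diag_subspace \<sigma>bar) -
                 {C D w - {UNIV, diag_subspace \<sigma>bar} | D w.
                    shelling_trapped_decomp Fs \<sigma>bar D \<and> w permutes {1..card D - 1}})))"
proof -
  interpret shelled_complex \<Delta> Fs by (rule shelled_complex.intro[OF dim sh])
  have B: "\<sigma>bar \<in> blocks" by (rule diag_subspace_lattice_block[OF inL nonbot])
  have "simplicial_complex (order_complex_interval \<Delta> (diag_subspace \<sigma>bar))"
    unfolding order_complex_interval_open_interval by (rule simplicial_complex_order_complex)
  then have complex: "simplicial_complex (order_complex_interval \<Delta> (diag_subspace \<sigma>bar) - removed_chains \<sigma>bar)"
    by (rule simplicial_complex_diff_facets[OF _ removed_chains_facets[OF B]])
  have inj: "inj_on (\<lambda>(D, w). saturated_decomp_chain \<sigma>bar D w)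
      {(D, w). shelling_trapped_decomp Fs \<sigma>bar D \<and> w permutes {1..card D - 1}}"
    using inj_on_saturated_decomp_chain[OF B] unfolding decomp_perms_def .
  have "(D, w) \<in> decomp_perms \<sigma>bar" if "shelling_trapped_decomp Fs \<sigma>bar D \<and> w permutes {1..card D - 1}" for D w
    using that unfolding decomp_perms_def by simp
  note chain = saturated_decomp_chain_saturated[OF B this inL] saturated_decomp_chain_simplex[OF B this]
    card_saturated_decomp_chain[OF B this]
  show ?thesis
    by (intro conjI interval_wedge_of_spheres[OF B] exI[of _ "saturated_decomp_chain \<sigma>bar"] allI impI,
        unfold saturated_decomp_chain_interiors[OF B]) (rule chain inj complex contractible_remaining[OF B]; assumption?)+
qed

end
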